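(* Let $R$ be a Hecke symmetry (with arbitrary parameter $q$) on a $3$-dimensional vector space $V$ over a field $\Bbbk$ of characteristic $\neq 2,3$. Then $\mathbb{S}(V,R)$ is not an Artin–Schelter regular algebra of type $A$.
   Context: A Hecke symmetry on $V$ with parameter $0\neq q\in\Bbbk$ is a linear map $R:V\otimes V\to V\otimes V$ satisfying $(R\otimes\mathrm{Id}_V)(\mathrm{Id}_V\otimes R)(R\otimes\mathrm{Id}_V)=(\mathrm{Id}_V\otimes R)(R\otimes\mathrm{Id}_V)(\mathrm{Id}_V\otimes R)$ and $(R-q\,\mathrm{Id})(R+\mathrm{Id})=0$ ($q=-1$ and roots of unity allowed). $\mathbb{S}(V,R)$ is the quotient of the tensor algebra $\mathbb{T}(V)$ by the ideal generated by $\mathrm{Im}(R-q\,\mathrm{Id})\subset V^{\otimes2}$, a graded algebra generated in degree $1$ by $V$. For $a,b,c$ in a field, $\mathrm{Skl}_3(a,b,c)$ is the graded algebra generated by $x_1,x_2,x_3$ in degree 1 with the three relations $a x_{i+1}x_{i-1}+b x_{i-1}x_{i+1}+c x_i^2=0$, $i\in\mathbb{Z}/3\mathbb{Z}$. The $3$-dimensional Artin–Schelter regular quadratic algebras of type $A$ (in the sense of Artin–Tate–Van den Bergh: the point scheme is a smooth cubic curve and the associated automorphism is a translation) are, over an algebraically closed field, precisely the algebras $\mathrm{Skl}_3(a,b,c)$ with $abc\neq0$ and $(a^3+b^3+c^3)^3\neq 27a^3b^3c^3$; for an algebra over $\Bbbk$ being of type $A$ means this holds after extension of scalars to an algebraic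 closure of $\Bbbk$, as graded algebras. *)

theory Defs
  imports "HOL-Computational_Algebra.Polynomial"
begin

text \<open>Noncommutative polynomials: coefficient functions on words (lists of letters),
  the word [i1,...,in] standing for the monomial x_i1 ... x_in.\<close>

type_synonym 'a ncpoly = "nat list \<Rightarrow> 'a"

definition nc_T :: "'a::comm_ring_1 ncpoly set" where
  "nc_T = {p. finite {w. p w \<noteq> 0} \<and> (\<forall>w. p w \<noteq> 0 \<longrightarrow> set w \<subseteq> {..<3})}"

definition nc_zero :: "'a::comm_ring_1 ncpoly" where
  "nc_zero = (\<lambda>w. 0)"

definition nc_one :: "'a::comm_ring_1 ncpoly" where
  "nc_one = (\<lambda>w. if w = [] then 1 else 0)"

definition nc_add :: "'a::comm_ring_1 ncpoly \<Rightarrow> 'a ncpoly \<Rightarrow> 'a ncpoly" where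
  "nc_add p r = (\<lambda>w. p w + r w)"

definition nc_smult :: "'a::comm_ring_1 \<Rightarrow> 'a ncpoly \<Rightarrow> 'a ncpoly" where
  "nc_smult c p = (\<lambda>w. c * p w)"

definition nc_mul :: "'a::comm_ring_1 ncpoly \<Rightarrow> 'a ncpoly \<Rightarrow> 'a ncpoly" where
  "nc_mul p r = (\<lambda>w. \<Sum>i\<le>length w. p (take i w) * r (drop i w))"

definition nc_mono :: "nat list \<Rightarrow> 'a::comm_ring_1 ncpoly" where
  "nc_mono u = (\<lambda>w. if w = u then 1 else 0)"

definition nc_homog :: "nat \<Rightarrow> 'a::comm_ring_1 ncpoly \<Rightarrow> bool" where
  "nc_homog n p \<longleftrightarrow> (\<forall>w. p w \<noteq> 0 \<longrightarrow> length w = n)"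

inductive_set nc_ideal :: "'a::comm_ring_1 ncpoly set \<Rightarrow> 'a ncpoly set" for G where
  gen: "g \<in> G \<Longrightarrow> g \<in> nc_ideal G"
| zero: "nc_zero \<in> nc_ideal G"
| add: "p \<in> nc_ideal G \<Longrightarrow> r \<in> nc_ideal G \<Longrightarrow> nc_add p r \<in> nc_ideal G"
| mul: "p \<in> nc_ideal G \<Longrightarrow> a \<in> nc_T \<Longrightarrow> b \<in> nc_T \<Longrightarrow> nc_mul (nc_mul a p) b \<in> nc_ideal G"

text \<open>The quotients T/I and T/J (I, J generated in degree 2) are isomorphic as graded
  algebras: a graded algebra automorphism of T carrying I onto J (it induces a graded
  isomorphism T/I -> T/J, and every graded isomorphism of such quotients arises this way,
  by lifting its degree-1 component).\<close>

definition nc_graded_iso :: "'a::comm_ring_1 ncpoly set \<Rightarrow> 'a ncpoly set \<Rightarrow> bool" where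
  "nc_graded_iso I J \<longleftrightarrow>
     (\<exists>\<Phi>. bij_betw \<Phi> nc_T nc_T
       \<and> (\<forall>p\<in>nc_T. \<forall>r\<in>nc_T. \<Phi> (nc_add p r) = nc_add (\<Phi> p) (\<Phi> r))
       \<and> (\<forall>p\<in>nc_T. \<forall>r\<in>nc_T. \<Phi> (nc_mul p r) = nc_mul (\<Phi> p) (\<Phi> r))
       \<and> (\<forall>c. \<forall>p\<in>nc_T. \<Phi> (nc_smult c p) = nc_smult c (\<Phi> p))
       \<and> \<Phi> nc_one = nc_one
       \<and> (\<forall>n. \<forall>p\<in>nc_T. nc_homog n p \<longrightarrow> nc_homog n (\<Phi> p))
       \<and> \<Phi> ` I = J)"

text \<open>R is given by its matrix: R(e_k \<otimes> e_l) = \<Sum>_{i,j} R i j k l e_i \<otimes> e_j.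
  Elements of V\<otimes>V are coefficient functions v i j (i,j<3), of V\<otimes>V\<otimes>V are t i j k.\<close>

definition applyR :: "(nat \<Rightarrow> nat \<Rightarrow> nat \<Rightarrow> nat \<Rightarrow> 'a::comm_ring_1) \<Rightarrow> (nat \<Rightarrow> nat \<Rightarrow> 'a) \<Rightarrow> nat \<Rightarrow> nat \<Rightarrow> 'a" where
  "applyR R v i j = (\<Sum>k<3. \<Sum>l<3. R i j k l * v k l)"

definition R12 :: "(nat \<Rightarrow> nat \<Rightarrow> nat \<Rightarrow> nat \<Rightarrow> 'a::comm_ring_1) \<Rightarrow> (nat \<Rightarrow> nat \<Rightarrow> nat \<Rightarrow> 'a) \<Rightarrow> nat \<Rightarrow> nat \<Rightarrow> nat \<Rightarrow> 'a" where
  "R12 R t i j k = (\<Sum>a<3. \<Sum>b<3. R i j a b * t a b k)"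

definition R23 :: "(nat \<Rightarrow> nat \<Rightarrow> nat \<Rightarrow> nat \<Rightarrow> 'a::comm_ring_1) \<Rightarrow> (nat \<Rightarrow> nat \<Rightarrow> nat \<Rightarrow> 'a) \<Rightarrow> nat \<Rightarrow> nat \<Rightarrow> nat \<Rightarrow> 'a" where
  "R23 R t i j k = (\<Sum>b<3. \<Sum>c<3. R j k b c * t i b c)"

definition is_hecke_symmetry :: "(nat \<Rightarrow> nat \<Rightarrow> nat \<Rightarrow> nat \<Rightarrow> 'a::field) \<Rightarrow> 'a \<Rightarrow> bool" where
  "is_hecke_symmetry R q \<longleftrightarrow> q \<noteq> 0
     \<and> (\<forall>t. \<forall>i<3. \<forall>j<3. \<forall>k<3.
           R12 R (R23 R (R12 R t)) i j k = R23 R (R12 R (R23 R t)) i j k)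
     \<and> (\<forall>v. \<forall>i<3. \<forall>j<3.
           applyR R (\<lambda>a b. applyR R v a b + v a b) i j - q * (applyR R v i j + v i j) = 0)"

definition quad_elem :: "(nat \<Rightarrow> nat \<Rightarrow> 'a::comm_ring_1) \<Rightarrow> 'a ncpoly" where
  "quad_elem v = (\<lambda>w. if length w = 2 \<and> set w \<subseteq> {..<3} then v (w ! 0) (w ! 1) else 0)"

definition S_rels :: "(nat \<Rightarrow> nat \<Rightarrow> nat \<Rightarrow> nat \<Rightarrow> 'a::comm_ring_1) \<Rightarrow> 'a \<Rightarrow> 'a ncpoly set" where
  "S_rels R q = {quad_elem (\<lambda>i j. applyR R v i j - q * v i j) | v. True}"

definition skl_rel :: "'a::comm_ring_1 \<Rightarrow> 'a \<Rightarrow> 'a \<Rightarrow> nat \<Rightarrow> 'a ncpoly" where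
  "skl_rel a b c i = (\<lambda>w. a * nc_mono [(i + 1) mod 3, (i + 2) mod 3] w
                         + b * nc_mono [(i + 2) mod 3, (i + 1) mod 3] w
                         + c * nc_mono [i, i] w)"

definition Skl_rels :: "'a::comm_ring_1 \<Rightarrow> 'a \<Rightarrow> 'a \<Rightarrow> 'a ncpoly set" where
  "Skl_rels a b c = skl_rel a b c ` {..<3}"

definition skl_typeA_params :: "'a::field \<Rightarrow> 'a \<Rightarrow> 'a \<Rightarrow> bool" where
  "skl_typeA_params a b c \<longleftrightarrow> a * b * c \<noteq> 0 \<and> (a^3 + b^3 + c^3)^3 \<noteq> 27 * a^3 * b^3 * c^3"

definition is_alg_closure :: "('k::field \<Rightarrow> 'K::field) \<Rightarrow> bool" where
  "is_alg_closure f \<longleftrightarrow>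
     (\<forall>x y. f (x + y) = f x + f y) \<and> (\<forall>x y. f (x * y) = f x * f y) \<and> f 1 = 1
     \<and> (\<forall>p :: 'K poly. degree p > 0 \<longrightarrow> (\<exists>z. poly p z = 0))
     \<and> (\<forall>z. \<exists>p :: 'k poly. p \<noteq> 0 \<and> poly (map_poly f p) z = 0)"

text \<open>Over an algebraically closed field K, the quadratic algebra T/I is AS-regular of
  type A iff it is graded-isomorphic to some Skl_3(a,b,c) with abc \<noteq> 0 and
  (a^3+b^3+c^3)^3 \<noteq> 27a^3b^3c^3.\<close>

definition typeA_over :: "'K::field ncpoly set \<Rightarrow> bool" where
  "typeA_over G \<longleftrightarrow> (\<exists>a b c :: 'K. skl_typeA_params a b c
      \<and> nc_graded_iso (nc_ideal G) (nc_ideal (Skl_rels a b c)))"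

end

theory Submission
  imports Defs "HOL-Analysis.Determinants"
begin

text \<open>Let \<open>w\<close> be the cyclic superpotential of \<open>Skl\<^sub>3(a,b,c)\<close>, so that the slices \<open>w n _ _\<close> span the
  relation space \<open>W = Im (R - q)\<close>, and write \<open>R - q\<close> as the sum of \<open>w n i j * \<Phi> n k l\<close> over \<open>n\<close>. Since
  \<open>W\<close> contains no tensor of rank one and the intersection of \<open>W \<otimes> V\<close> and \<open>V \<otimes> W\<close> is spanned by \<open>w\<close>, the
  Hecke and braid relations say that \<open>w\<close> and \<open>\<Phi>\<close>, drawn as trivalent vertices, satisfy the bigon and
  square relations of a web calculus twisted by a matrix \<open>M\<close>. These relations force
  \<open>tr M = tr M\<inverse> = q + 1 + q\<inverse>\<close> and \<open>M\<^sup>\<otimes>\<^sup>3 w = w\<close>. Hence \<open>M\<close> acts on the pencil spanned by the two cubics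
  \<open>w(x,x,x)\<close> and \<open>det w(x,_,_)\<close>, which is the Hesse pencil, and sends the triangle
  \<open>x\<^sub>0 x\<^sub>1 x\<^sub>2\<close> to one of its triangles: \<open>M\<close> is either monomial or has only nonzero
  entries. The second case contradicts the trace identities. In the first case \<open>M\<close> is the identity,
  has the three cube roots of unity as eigenvalues, or is an involution with eigenvalues \<open>1, 1, -1\<close>,
  and in an eigenbasis a few square relations are contradictory, for \<open>M = 1\<close> because they
  place \<open>(a\<^sup>3 : b\<^sup>3 : c\<^sup>3)\<close> on the discriminant \<open>(a\<^sup>3 + b\<^sup>3 + c\<^sup>3)\<^sup>3 = 27 a\<^sup>3 b\<^sup>3 c\<^sup>3\<close>.\<close>

section \<open>Tensors over a three-element index set\<close>

text \<open>Of \<open>q\<close> one knows only that it is nonzero, so nothing can be drawn from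
  semisimplicity of Hecke algebras; the argument stays in tensor degrees two and three and treats
  \<open>q\<close> as an unknown to be eliminated. Equality of the traces of \<open>M\<close> and
  its inverse is what remains of it. This equality detects multiplication of \<open>M\<close> by a
  cube root of unity, which invariance of \<open>w\<close> does not. The Hesse pencil alone cannot
  force \<open>M\<close> to be monomial, because Fourier matrices preserve it too. For
  \<open>a \<noteq> b\<close> such matrices are excluded by a relation between
  \<open>w 0 1 _\<close> and \<open>w 1 0 _\<close>; for \<open>a = b\<close> that relation is
  empty, and what remains is arithmetic with cube roots of unity and the traces. Indices live in the
  three-element type so that the cyclic symmetry of the Sklyanin relations is a translation of
  indices.\<close>

lemma UNIV_3': "UNIV = {0::3, 1, 2}" using UNIV_3 by auto

text \<open>Index arithmetic is modulo 3; these rules normalise what sums such as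
  \<open>1 + 2\<close> and \<open>2 + 2\<close> produce.\<close>

lemma numerals_3 [simp]: "(3::3) = 0" "(4::3) = 1" by simp_all

lemma sum_3': "sum f (UNIV :: 3 set) = f 0 + f 1 + f 2"
  unfolding UNIV_3' by (simp add: add.assoc)

lemma forall_3': "(\<forall>i::3. P i) \<longleftrightarrow> P 0 \<and> P 1 \<and> P 2"
  using UNIV_3' by (metis UNIV_I insertE singletonD)

definition kd :: "3 \<Rightarrow> 3 \<Rightarrow> 'a::comm_ring_1" where
  "kd i j = (if i = j then 1 else 0)"

lemma kd_refl [simp]: "kd i i = 1" by (simp add: kd_def)

lemma kd_sym: "kd i j = kd j i" by (simp add: kd_def)

lemma kd_sum [simp]:
  "(\<Sum>i\<in>UNIV. kd i j * f i) = f j"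
  "(\<Sum>i\<in>UNIV. kd j i * f i) = f j"
  "(\<Sum>i\<in>UNIV. f i * kd i j) = f j"
  "(\<Sum>i\<in>UNIV. f i * kd j i) = f j"
  by (simp_all add: kd_def if_distrib if_distribR cong: if_cong)

lemma matrix_inverse_ex:
  fixes A :: "3 \<Rightarrow> 3 \<Rightarrow> 'a::field"
  assumes "\<And>x. (\<And>i. (\<Sum>j\<in>UNIV. A i j * x j) = 0) \<Longrightarrow> \<forall>j. x j = 0"
  obtains B where "\<And>i k. (\<Sum>j\<in>UNIV. B i j * A j k) = kd i k" "\<And>i k. (\<Sum>j\<in>UNIV. A i j * B j k) = kd i k"
proof -
  define A' :: "'a^3^3" where "A' = (\<chi> i j. A i j)"
  have "\<forall>x. A' *v x = 0 \<longrightarrow> x = 0"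
    using assms by (auto simp: A'_def matrix_vector_mult_def vec_eq_iff)
  then obtain B' where B': "B' ** A' = mat 1"
    using matrix_left_invertible_ker by blast
  then have B'': "A' ** B' = mat 1" by (simp add: matrix_left_right_inverse)
  show ?thesis
    using B' B'' by (intro that[of "\<lambda>i j. B' $ i $ j"])
      (auto simp: A'_def matrix_matrix_mult_def vec_eq_iff mat_def kd_def)
qed

section \<open>Twisted webs\<close>

type_synonym 'a tensor3 = "3 \<Rightarrow> 3 \<Rightarrow> 3 \<Rightarrow> 'a"

text \<open>\<open>Bw\<close> and \<open>Cw\<close> are the two ways of joining a \<open>w\<close>-vertex to a \<open>\<Phi>\<close>-vertex along one edge; composing them
  gives the square.\<close>

definition Bw :: "'a::comm_ring_1 tensor3 \<Rightarrow> 'a tensor3 \<Rightarrow> 3 \<Rightarrow> 3 \<Rightarrow> 3 \<Rightarrow> 3 \<Rightarrow> 'a" where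
  "Bw w \<Phi> k m i j = (\<Sum>l\<in>UNIV. w i k l * \<Phi> m l j)"

definition Cw :: "'a::comm_ring_1 tensor3 \<Rightarrow> 'a tensor3 \<Rightarrow> 3 \<Rightarrow> 3 \<Rightarrow> 3 \<Rightarrow> 3 \<Rightarrow> 'a" where
  "Cw w \<Phi> n b k m = (\<Sum>p\<in>UNIV. w m p b * \<Phi> n k p)"

lemmas flatten_sums = sum_distrib_left sum_distrib_right sum.cartesian_product UNIV_Times_UNIV

text \<open>\<open>square\<close> resolves a square into two pairings of its four outer legs, the
  second one twisted by \<open>M\<close>. The vertex \<open>w\<close> is strictly cyclic, whereas by
  \<open>rot\<close> a rotation of \<open>\<Phi>\<close> costs a factor \<open>M\<close>.\<close>

locale web =
  fixes w \<Phi> :: "'a::field tensor3" and M :: "3 \<Rightarrow> 3 \<Rightarrow> 'a" and q :: 'a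
  assumes q0: "q \<noteq> 0"
    and cyc: "w i j k = w j k i"
    and bigon: "(\<Sum>k\<in>UNIV. \<Sum>l\<in>UNIV. w j k l * \<Phi> i k l) = - (1 + q) * kd i j"
    and square: "(\<Sum>k\<in>UNIV. \<Sum>m\<in>UNIV. Cw w \<Phi> n b k m * Bw w \<Phi> k m i j) = q * (kd n i * kd b j + kd n b * M i j)"
    and rot: "\<Phi> m l j = (\<Sum>i\<in>UNIV. M i j * \<Phi> l i m)"
begin

section \<open>Nondegeneracy of the third leg and invertibility of the twist\<close>

lemma nondeg3:
  assumes "\<And>m l. (\<Sum>j\<in>UNIV. \<Phi> m l j * x j) = 0"
  shows "x b = 0"
proof -
  \<comment> \<open>With \<open>n\<close> different from \<open>b\<close> and \<open>i = n\<close>,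
    the right-hand side of \<open>square\<close> is \<open>q * kd b j\<close>. The square then reads
    off \<open>x b\<close>, although \<open>x\<close> enters it only through the third leg of
    \<open>\<Phi>\<close>.\<close>
  define n where "n = b + 1"
  have n: "n \<noteq> b" by (simp add: n_def)
  have B: "(\<Sum>j\<in>UNIV. Bw w \<Phi> k m i j * x j) = 0" for k m i
  proof -
    have "(\<Sum>j\<in>UNIV. Bw w \<Phi> k m i j * x j) = (\<Sum>l\<in>UNIV. w i k l * (\<Sum>j\<in>UNIV. \<Phi> m l j * x j))"
      unfolding Bw_def flatten_sums
      by (rule sum.reindex_bij_witness[of _ "\<lambda>(l,j). (j,l)" "\<lambda>(j,l). (l,j)"]) (auto simp: mult_ac)
    then show ?thesis using assms by simp
  qed
  have "(\<Sum>j\<in>UNIV. (\<Sum>k\<in>UNIV. \<Sum>m\<in>UNIV. Cw w \<Phi> n b k m * Bw w \<Phi> k m n j) * x j)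
      = (\<Sum>k\<in>UNIV. \<Sum>m\<in>UNIV. Cw w \<Phi> n b k m * (\<Sum>j\<in>UNIV. Bw w \<Phi> k m n j * x j))"
    unfolding flatten_sums
    by (rule sum.reindex_bij_witness[of _ "\<lambda>(k,m,j). (j,k,m)" "\<lambda>(j,k,m). (k,m,j)"]) (auto simp: mult_ac)
  then have "(\<Sum>j\<in>UNIV. q * (kd n n * kd b j + kd n b * M n j) * x j) = 0"
    using B by (simp add: square)
  then have "q * (\<Sum>j\<in>UNIV. kd b j * x j) = 0"
    using n by (simp add: kd_def[of n] mult.assoc sum_distrib_left[symmetric])
  then show ?thesis using q0 by simp
qed

text \<open>By \<open>rot\<close>, contraction with the third leg of \<open>\<Phi>\<close> factors
  through \<open>M\<close>, so a kernel vector of \<open>M\<close> is also one of that leg.\<close>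

lemma M_inj:
  assumes "\<And>i. (\<Sum>j\<in>UNIV. M i j * x j) = 0"
  shows "x b = 0"
proof (rule nondeg3)
  fix m l
  have "(\<Sum>j\<in>UNIV. \<Phi> m l j * x j) = (\<Sum>i\<in>UNIV. \<Phi> l i m * (\<Sum>j\<in>UNIV. M i j * x j))"
    unfolding rot[of m l] flatten_sums
    by (rule sum.reindex_bij_witness[of _ "\<lambda>(l,j). (j,l)" "\<lambda>(j,l). (l,j)"]) (auto simp: mult_ac)
  then show "(\<Sum>j\<in>UNIV. \<Phi> m l j * x j) = 0" using assms by simp
qed

definition N where "N = (SOME B. (\<forall>i k. (\<Sum>j\<in>UNIV. B i j * M j k) = kd i k) \<and> (\<forall>i k. (\<Sum>j\<in>UNIV. M i j * B j k) = kd i k))"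

lemma NM: "(\<Sum>j\<in>UNIV. N i j * M j k) = kd i k" and MN: "(\<Sum>j\<in>UNIV. M i j * N j k) = kd i k"
proof -
  have "\<exists>B. (\<forall>i k. (\<Sum>j\<in>UNIV. B i j * M j k) = kd i k) \<and> (\<forall>i k. (\<Sum>j\<in>UNIV. M i j * B j k) = kd i k)"
    by (rule matrix_inverse_ex[of M]) (use M_inj in blast)+
  from someI_ex[OF this] show "(\<Sum>j\<in>UNIV. N i j * M j k) = kd i k" "(\<Sum>j\<in>UNIV. M i j * N j k) = kd i k"
    unfolding N_def by blast+
qed

lemma rotN: "(\<Sum>j\<in>UNIV. \<Phi> m l j * N j b) = \<Phi> l b m"
proof -
  have "(\<Sum>j\<in>UNIV. \<Phi> m l j * N j b) = (\<Sum>i\<in>UNIV. (\<Sum>j\<in>UNIV. M i j * N j b) * \<Phi> l i m)"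
    unfolding rot[of m l] flatten_sums
    by (rule sum.reindex_bij_witness[of _ "\<lambda>(l,j). (j,l)" "\<lambda>(j,l). (l,j)"]) (auto simp: mult_ac)
  then show ?thesis by (simp add: MN)
qed

text \<open>Joining the strands \<open>i\<close> and \<open>j\<close> of a square leaves two nested
  bigons, worth \<open>(1 + q)^2\<close>. On the right, with \<open>n = b = 0\<close>, the first
  pairing contributes 1 and the twisted one the trace.\<close>

lemma trace_M: "(1 + q)^2 = q * (1 + (\<Sum>i\<in>UNIV. M i i))"
proof -
  have B: "(\<Sum>i\<in>UNIV. Bw w \<Phi> k m i i) = - (1 + q) * kd m k" for k m
  proof -
    have "(\<Sum>i\<in>UNIV. Bw w \<Phi> k m i i) = (\<Sum>l\<in>UNIV. \<Sum>i\<in>UNIV. w k l i * \<Phi> m l i)"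
      unfolding Bw_def by (subst sum.swap) (simp add: cyc[of _ k])
    then show ?thesis by (simp add: bigon)
  qed
  have "(\<Sum>i\<in>UNIV. \<Sum>k\<in>UNIV. \<Sum>m\<in>UNIV. Cw w \<Phi> 0 0 k m * Bw w \<Phi> k m i i)
     = (\<Sum>k\<in>UNIV. \<Sum>m\<in>UNIV. Cw w \<Phi> 0 0 k m * (\<Sum>i\<in>UNIV. Bw w \<Phi> k m i i))"
    unfolding flatten_sums
    by (rule sum.reindex_bij_witness[of _ "\<lambda>(k,m,j). (j,k,m)" "\<lambda>(j,k,m). (k,m,j)"]) (auto simp: mult_ac)
  also have "\<dots> = - (1 + q) * (\<Sum>k\<in>UNIV. \<Sum>m\<in>UNIV. Cw w \<Phi> 0 0 k m * kd m k)"
    unfolding B by (simp add: sum_distrib_left sum_negf mult_ac)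
  also have "\<dots> = - (1 + q) * (\<Sum>k\<in>UNIV. \<Sum>p\<in>UNIV. w 0 k p * \<Phi> 0 k p)"
    by (simp add: Cw_def cyc[of _ _ 0] cyc[of _ 0])
  also have "\<dots> = (1 + q)^2" unfolding bigon by (simp add: power2_eq_square algebra_simps)
  finally show ?thesis
    by (simp add: square sum_distrib_left[symmetric] sum.distrib)
qed

text \<open>The other closure: \<open>n = i = 0\<close>, and \<open>N\<close> joins \<open>j\<close>
  to \<open>b\<close>. By \<open>rotN\<close> the factor \<open>N\<close> is absorbed in a rotation
  of a \<open>\<Phi>\<close>-vertex, so again two bigons remain, while on the right \<open>N\<close>
  cancels \<open>M\<close> in the twisted pairing.\<close>

lemma trace_N: "(1 + q)^2 = q * (1 + (\<Sum>i\<in>UNIV. N i i))"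
proof -
  have "(\<Sum>b\<in>UNIV. \<Sum>j\<in>UNIV. N j b * (\<Sum>k\<in>UNIV. \<Sum>m\<in>UNIV. Cw w \<Phi> 0 b k m * Bw w \<Phi> k m 0 j))
     = (\<Sum>k\<in>UNIV. \<Sum>l\<in>UNIV. \<Sum>p\<in>UNIV. w 0 k l * \<Phi> 0 k p * (\<Sum>m\<in>UNIV. \<Sum>b\<in>UNIV. w m p b * (\<Sum>j\<in>UNIV. \<Phi> m l j * N j b)))"
    unfolding Bw_def Cw_def flatten_sums
    by (rule sum.reindex_bij_witness[of _ "\<lambda>(k,l,p,m,b,j). (b,j,k,m,l,p)" "\<lambda>(b,j,k,m,l,p). (k,l,p,m,b,j)"]) (auto simp: mult_ac)
  also have "\<dots> = (\<Sum>k\<in>UNIV. \<Sum>l\<in>UNIV. \<Sum>p\<in>UNIV. w 0 k l * \<Phi> 0 k p * (- (1 + q) * kd l p))"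
  proof -
    have "(\<Sum>m\<in>UNIV. \<Sum>b\<in>UNIV. w m p b * \<Phi> l b m) = - (1 + q) * kd l p" for l p
      by (subst sum.swap) (simp add: cyc[of _ p] bigon)
    then show ?thesis by (simp add: rotN)
  qed
  also have "\<dots> = - (1 + q) * (\<Sum>k\<in>UNIV. \<Sum>l\<in>UNIV. w 0 k l * \<Phi> 0 k l)"
  proof -
    have "(\<Sum>p\<in>UNIV. w 0 k l * \<Phi> 0 k p * (- (1 + q) * kd l p)) = - (1 + q) * (w 0 k l * \<Phi> 0 k l)" for k l
    proof -
      have "(\<Sum>p\<in>UNIV. w 0 k l * \<Phi> 0 k p * (- (1 + q) * kd l p)) = (\<Sum>p\<in>UNIV. (w 0 k l * \<Phi> 0 k p * (- (1 + q))) * kd l p)"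
        by (simp only: mult.assoc)
      then show ?thesis by (simp only: kd_sum mult_ac)
    qed
    then show ?thesis by (simp add: sum_distrib_left)
  qed
  also have "\<dots> = (1 + q)^2" unfolding bigon by (simp add: power2_eq_square algebra_simps)
  finally have "(1 + q)^2 = (\<Sum>b\<in>UNIV. \<Sum>j\<in>UNIV. N j b * (q * (kd 0 0 * kd b j + kd 0 b * M 0 j)))"
    by (simp add: square)
  also have "\<dots> = q * ((\<Sum>b\<in>UNIV. \<Sum>j\<in>UNIV. kd b j * N j b) + (\<Sum>b\<in>UNIV. kd 0 b * (\<Sum>j\<in>UNIV. M 0 j * N j b)))"
    by (simp add: sum_distrib_left sum.distrib algebra_simps del: kd_sum)
  also have "\<dots> = q * (1 + (\<Sum>i\<in>UNIV. N i i))" by (simp add: MN)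
  finally show ?thesis .
qed

text \<open>This form is free of \<open>q\<close>. It is used wherever a cube root of unity as a
  factor of \<open>M\<close> has to be excluded.\<close>

lemma trace_eq: "(\<Sum>i\<in>UNIV. N i i) = (\<Sum>i\<in>UNIV. M i i)"
  using trace_M trace_N q0 by simp

section \<open>The other legs of \<open>\<Phi>\<close>, and invariance under the twist\<close>

lemma nondeg2:
  assumes "\<And>a c. (\<Sum>s\<in>UNIV. y s * \<Phi> a s c) = 0"
  shows "y b = 0"
proof -
  \<comment> \<open>\<open>N\<close> carries a vector killed by the second leg to one killed by the
    third, by \<open>rotN\<close>.\<close>
  have "(\<Sum>j\<in>UNIV. N i j * y j) = 0" for i
  proof (rule nondeg3)
    fix m l
    have "(\<Sum>j\<in>UNIV. \<Phi> m l j * (\<Sum>k\<in>UNIV. N j k * y k)) = (\<Sum>k\<in>UNIV. y k * (\<Sum>j\<in>UNIV. \<Phi> m l j * N j k))"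
      unfolding flatten_sums
      by (rule sum.reindex_bij_witness[of _ "\<lambda>(l,j). (j,l)" "\<lambda>(j,l). (l,j)"]) (auto simp: mult_ac)
    then show "(\<Sum>j\<in>UNIV. \<Phi> m l j * (\<Sum>k\<in>UNIV. N j k * y k)) = 0" using assms by (simp add: rotN)
  qed
  then have "(\<Sum>i\<in>UNIV. M b i * (\<Sum>j\<in>UNIV. N i j * y j)) = 0" by simp
  also have "(\<Sum>i\<in>UNIV. M b i * (\<Sum>j\<in>UNIV. N i j * y j)) = (\<Sum>j\<in>UNIV. (\<Sum>i\<in>UNIV. M b i * N i j) * y j)"
    unfolding flatten_sums
    by (rule sum.reindex_bij_witness[of _ "\<lambda>(l,j). (j,l)" "\<lambda>(j,l). (l,j)"]) (auto simp: mult_ac)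
  finally show ?thesis by (simp add: MN)
qed

lemma nondeg1:
  assumes "\<And>s c. (\<Sum>a\<in>UNIV. y a * \<Phi> a s c) = 0"
  shows "y b = 0"
proof (rule nondeg2)
  fix m c
  have "(\<Sum>s\<in>UNIV. y s * \<Phi> m s c) = (\<Sum>i\<in>UNIV. M i c * (\<Sum>s\<in>UNIV. y s * \<Phi> s i m))"
    unfolding rot[of m] flatten_sums
    by (rule sum.reindex_bij_witness[of _ "\<lambda>(l,j). (j,l)" "\<lambda>(j,l). (l,j)"]) (auto simp: mult_ac)
  then show "(\<Sum>s\<in>UNIV. y s * \<Phi> m s c) = 0" using assms by simp
qed

text \<open>If \<open>z a \<noteq> 0\<close>, then \<open>D\<close> is invertible, and a combination of two slices of \<open>\<Phi>\<close> vanishes.\<close>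

lemma kernel_zero:
  assumes D: "\<And>a c d. (\<Sum>s\<in>UNIV. D s d * \<Phi> a s c) = kd c d * z a"
  shows "D s d = 0"
proof -
  have z: "z a = 0" for a
  proof (rule ccontr)
    assume za: "z a \<noteq> 0"
    have inj: "\<forall>d. x d = 0" if x: "\<And>s. (\<Sum>d\<in>UNIV. D s d * x d) = 0" for x
    proof
      fix c
      have "(\<Sum>d\<in>UNIV. x d * (\<Sum>s\<in>UNIV. D s d * \<Phi> a s c)) = (\<Sum>s\<in>UNIV. \<Phi> a s c * (\<Sum>d\<in>UNIV. D s d * x d))"
        unfolding flatten_sums
        by (rule sum.reindex_bij_witness[of _ "\<lambda>(l,j). (j,l)" "\<lambda>(j,l). (l,j)"]) (auto simp: mult_ac)
      then have "(\<Sum>d\<in>UNIV. kd c d * (x d * z a)) = 0" using x by (simp add: D mult_ac)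
      then show "x c = 0" using za by simp
    qed
    obtain E where E: "\<And>i k. (\<Sum>j\<in>UNIV. D i j * E j k) = kd i k"
      by (rule matrix_inverse_ex[of D]) (use inj in blast)+
    define a' where "a' = a + 1"
    have a': "a' \<noteq> a" by (simp add: a'_def)
    define y where "y i = z a * kd i a' - z a' * kd i a" for i
    have 1: "(\<Sum>i\<in>UNIV. y i * z i) = 0"
      unfolding y_def by (simp add: left_diff_distrib sum_subtractf mult.assoc sum_distrib_left[symmetric])
    have "y a' = 0"
    proof (rule nondeg1)
      fix t c
      have "(\<Sum>i\<in>UNIV. y i * \<Phi> i t c) = (\<Sum>i\<in>UNIV. y i * (\<Sum>s\<in>UNIV. kd s t * \<Phi> i s c))" by simp
      also have "\<dots> = (\<Sum>d\<in>UNIV. E d t * (\<Sum>i\<in>UNIV. y i * (\<Sum>s\<in>UNIV. D s d * \<Phi> i s c)))"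
        unfolding E[symmetric] flatten_sums
        by (rule sum.reindex_bij_witness[of _ "\<lambda>(d,i,s). (i,s,d)" "\<lambda>(i,s,d). (d,i,s)"]) (auto simp: mult_ac)
      also have "\<dots> = (\<Sum>d\<in>UNIV. E d t * kd c d * (\<Sum>i\<in>UNIV. y i * z i))"
        unfolding D by (simp add: sum_distrib_left mult_ac)
      finally show "(\<Sum>i\<in>UNIV. y i * \<Phi> i t c) = 0" using 1 by simp
    qed
    then show False using za a' by (simp add: y_def kd_def)
  qed
  show ?thesis
    by (rule nondeg2[of "\<lambda>s. D s d"]) (simp add: D z)
qed

text \<open>Three rotations return every leg of \<open>\<Phi>\<close> to its place with one factor
  \<open>M\<close> on each; the factor on the third leg is moved to the other side as
  \<open>N\<close>.\<close>

lemma \<Phi>_inv: "(\<Sum>n\<in>UNIV. M n i * (\<Sum>s\<in>UNIV. M s k * \<Phi> n s p)) = (\<Sum>c\<in>UNIV. N c p * \<Phi> i k c)"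
proof -
  have "\<Phi> i k c = (\<Sum>a\<in>UNIV. M a c * (\<Sum>n\<in>UNIV. M n i * (\<Sum>s\<in>UNIV. M s k * \<Phi> n s a)))" for c
    by (subst rot, subst rot, subst rot) simp
  then have "(\<Sum>c\<in>UNIV. N c p * \<Phi> i k c)
      = (\<Sum>c\<in>UNIV. N c p * (\<Sum>a\<in>UNIV. M a c * (\<Sum>n\<in>UNIV. M n i * (\<Sum>s\<in>UNIV. M s k * \<Phi> n s a))))"
    by simp
  also have "\<dots> = (\<Sum>a\<in>UNIV. (\<Sum>c\<in>UNIV. M a c * N c p) * (\<Sum>n\<in>UNIV. M n i * (\<Sum>s\<in>UNIV. M s k * \<Phi> n s a)))"
    unfolding flatten_sums
    by (rule sum.reindex_bij_witness[of _ "\<lambda>(a,(n,s),c). (c,a,n,s)" "\<lambda>(c,a,n,s). (a,(n,s),c)"]) (auto simp: mult_ac)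
  finally show ?thesis by (simp add: MN)
qed

text \<open>Applying \<open>N\<close> to the strand \<open>j\<close> and rotating one
  \<open>\<Phi>\<close>-vertex puts the twist on an internal edge. In this form two different
  instances acquire the same value after a contraction with \<open>M\<close>, which is what
  \<open>w_inv1\<close> exploits.\<close>

lemma square_rot:
  "(\<Sum>k\<in>UNIV. \<Sum>m\<in>UNIV. \<Sum>p\<in>UNIV. \<Sum>l\<in>UNIV. \<Sum>s\<in>UNIV. w m p b * w i k l * \<Phi> n k p * M s m * \<Phi> a s l)
    = q * (kd n i * N b a + kd n b * kd i a)"
proof -
  have 1: "(\<Sum>j\<in>UNIV. N j a * Bw w \<Phi> k m i j) = (\<Sum>l\<in>UNIV. \<Sum>s\<in>UNIV. w i k l * (M s m * \<Phi> a s l))" for k m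
  proof -
    have "(\<Sum>j\<in>UNIV. N j a * Bw w \<Phi> k m i j) = (\<Sum>l\<in>UNIV. w i k l * (\<Sum>j\<in>UNIV. \<Phi> m l j * N j a))"
      unfolding Bw_def flatten_sums
      by (rule sum.reindex_bij_witness[of _ "\<lambda>(l,j). (j,l)" "\<lambda>(j,l). (l,j)"]) (auto simp: mult_ac)
    also have "\<dots> = (\<Sum>l\<in>UNIV. w i k l * (\<Sum>s\<in>UNIV. M s m * \<Phi> a s l))"
      unfolding rotN by (subst rot) (rule refl)
    finally show ?thesis by (simp only: sum_distrib_left)
  qed
  have "(\<Sum>k\<in>UNIV. \<Sum>m\<in>UNIV. \<Sum>p\<in>UNIV. \<Sum>l\<in>UNIV. \<Sum>s\<in>UNIV. w m p b * w i k l * \<Phi> n k p * M s m * \<Phi> a s l)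
     = (\<Sum>k\<in>UNIV. \<Sum>m\<in>UNIV. Cw w \<Phi> n b k m * (\<Sum>j\<in>UNIV. N j a * Bw w \<Phi> k m i j))"
    unfolding 1 Cw_def flatten_sums
    by (rule sum.reindex_bij_witness[of _ "\<lambda>(k,m,(l,s),p). (k,m,p,l,s)" "\<lambda>(k,m,p,l,s). (k,m,(l,s),p)"]) (auto simp: mult_ac)
  also have "\<dots> = (\<Sum>j\<in>UNIV. N j a * (\<Sum>k\<in>UNIV. \<Sum>m\<in>UNIV. Cw w \<Phi> n b k m * Bw w \<Phi> k m i j))"
    unfolding flatten_sums
    by (rule sum.reindex_bij_witness[of _ "\<lambda>(a,k,m). (k,m,a)" "\<lambda>(k,m,a). (a,k,m)"]) (auto simp: mult_ac)
  also have "\<dots> = (\<Sum>j\<in>UNIV. (q * kd n i) * (kd b j * N j a) + (q * kd n b) * (M i j * N j a))"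
    unfolding square by (simp add: algebra_simps del: kd_sum)
  also have "\<dots> = q * (kd n i * N b a + kd n b * kd i a)"
    by (simp add: sum.distrib sum_distrib_left[symmetric] MN) (simp add: algebra_simps)
  finally show ?thesis .
qed

lemma square_rot':
  "(\<Sum>k\<in>UNIV. \<Sum>m\<in>UNIV. \<Sum>p\<in>UNIV. \<Sum>l\<in>UNIV. \<Sum>s\<in>UNIV. w b m p * w l i k * \<Phi> n k p * M s m * \<Phi> a s l)
    = q * (kd n i * N b a + kd n b * kd i a)"
  "(\<Sum>k\<in>UNIV. \<Sum>m\<in>UNIV. \<Sum>p\<in>UNIV. \<Sum>l\<in>UNIV. \<Sum>s\<in>UNIV. w p b m * w i k l * \<Phi> n k p * M s m * \<Phi> a s l)
    = q * (kd n i * N b a + kd n b * kd i a)"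
proof -
  have "w b m p = w m p b" "w l i k = w i k l" "w p b m = w m p b" for m p k l
    using cyc by metis+
  then show "(\<Sum>k\<in>UNIV. \<Sum>m\<in>UNIV. \<Sum>p\<in>UNIV. \<Sum>l\<in>UNIV. \<Sum>s\<in>UNIV. w b m p * w l i k * \<Phi> n k p * M s m * \<Phi> a s l)
    = q * (kd n i * N b a + kd n b * kd i a)"
  "(\<Sum>k\<in>UNIV. \<Sum>m\<in>UNIV. \<Sum>p\<in>UNIV. \<Sum>l\<in>UNIV. \<Sum>s\<in>UNIV. w p b m * w i k l * \<Phi> n k p * M s m * \<Phi> a s l)
    = q * (kd n i * N b a + kd n b * kd i a)"
    using square_rot[of b i n a] by presburger+
qed

text \<open>The difference of both sides, contracted with \<open>\<Phi>\<close>, is computed by two evaluations of the same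
  network and hence satisfies the hypothesis of \<open>kernel_zero\<close>.\<close>

lemma w_inv1:
  "(\<Sum>m\<in>UNIV. \<Sum>b\<in>UNIV. M s m * M r b * w b m p) = (\<Sum>c\<in>UNIV. N p c * w r s c)"
proof -
  define D where "D s p = (\<Sum>m\<in>UNIV. \<Sum>b\<in>UNIV. M s m * M r b * w b m p) - (\<Sum>c\<in>UNIV. N p c * w r s c)" for s p
  \<comment> \<open>Both summands of \<open>D\<close> give
    \<open>q * (kd n i * kd r a + M r n * kd i a)\<close>: the first by
    \<open>square_rot'(1)\<close> contracted with \<open>M r b\<close>, the second by
    \<open>square_rot'(2)\<close> contracted with \<open>M n' n\<close>, where
    \<open>\<Phi>_inv\<close> supplies the factor \<open>N\<close>.\<close>
  have eq: "(\<Sum>l\<in>UNIV. \<Sum>p\<in>UNIV. (\<Sum>s\<in>UNIV. D s p * \<Phi> a s l) * Bw w \<Phi> i n l p) = 0" for i n a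
  proof -
    have "(\<Sum>b\<in>UNIV. M r b * (\<Sum>k\<in>UNIV. \<Sum>m\<in>UNIV. \<Sum>p\<in>UNIV. \<Sum>l\<in>UNIV. \<Sum>s\<in>UNIV. w b m p * w l i k * \<Phi> n k p * M s m * \<Phi> a s l))
        = (\<Sum>l\<in>UNIV. \<Sum>p\<in>UNIV. (\<Sum>s\<in>UNIV. (\<Sum>m\<in>UNIV. \<Sum>b\<in>UNIV. M s m * M r b * w b m p) * \<Phi> a s l) * Bw w \<Phi> i n l p)"
      unfolding Bw_def flatten_sums
      by (rule sum.reindex_bij_witness[of _ "\<lambda>(l,p,k,s,m,b). (b,k,m,p,l,s)" "\<lambda>(b,k,m,p,l,s). (l,p,k,s,m,b)"])
        (auto simp: mult_ac)
    moreover have "(\<Sum>b\<in>UNIV. M r b * (q * (kd n i * N b a + kd n b * kd i a))) = q * (kd n i * kd r a + M r n * kd i a)"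
    proof -
      have "(\<Sum>b\<in>UNIV. M r b * (q * (kd n i * N b a + kd n b * kd i a)))
         = (\<Sum>b\<in>UNIV. (q * kd n i) * (M r b * N b a) + (q * kd i a) * (kd n b * M r b))"
        by (simp add: algebra_simps del: kd_sum)
      then show ?thesis by (simp add: sum.distrib sum_distrib_left[symmetric] MN) (simp add: algebra_simps)
    qed
    moreover have "(\<Sum>n'\<in>UNIV. M n' n * (\<Sum>k\<in>UNIV. \<Sum>m\<in>UNIV. \<Sum>p\<in>UNIV. \<Sum>l\<in>UNIV. \<Sum>s\<in>UNIV. w p i m * w r k l * \<Phi> a k p * M s m * \<Phi> n' s l))
        = (\<Sum>l\<in>UNIV. \<Sum>p\<in>UNIV. (\<Sum>s\<in>UNIV. (\<Sum>c\<in>UNIV. N p c * w r s c) * \<Phi> a s l) * Bw w \<Phi> i n l p)"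
    proof -
      have "(\<Sum>n'\<in>UNIV. M n' n * (\<Sum>k\<in>UNIV. \<Sum>m\<in>UNIV. \<Sum>p\<in>UNIV. \<Sum>l\<in>UNIV. \<Sum>s\<in>UNIV. w p i m * w r k l * \<Phi> a k p * M s m * \<Phi> n' s l))
        = (\<Sum>k\<in>UNIV. \<Sum>m\<in>UNIV. \<Sum>p\<in>UNIV. \<Sum>l\<in>UNIV. w p i m * w r k l * \<Phi> a k p * (\<Sum>n'\<in>UNIV. M n' n * (\<Sum>s\<in>UNIV. M s m * \<Phi> n' s l)))"
        unfolding flatten_sums
        by (rule sum.reindex_bij_witness[of _ "\<lambda>(k,m,p,l,n,s). (n,k,m,p,l,s)" "\<lambda>(n,k,m,p,l,s). (k,m,p,l,n,s)"]) (auto simp: mult_ac)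
      also have "\<dots> = (\<Sum>l\<in>UNIV. \<Sum>p\<in>UNIV. (\<Sum>s\<in>UNIV. (\<Sum>c\<in>UNIV. N p c * w r s c) * \<Phi> a s l) * Bw w \<Phi> i n l p)"
        unfolding \<Phi>_inv unfolding Bw_def flatten_sums
        by (rule sum.reindex_bij_witness[of _ "\<lambda>(p,c,m,k,l). (k,m,p,l,c)" "\<lambda>(k,m,p,l,c). (p,c,m,k,l)"])
          (auto simp: mult_ac)
      finally show ?thesis .
    qed
    moreover have "(\<Sum>n'\<in>UNIV. M n' n * (q * (kd a r * N i n' + kd a i * kd r n'))) = q * (kd n i * kd r a + M r n * kd i a)"
    proof -
      have "(\<Sum>n'\<in>UNIV. M n' n * (q * (kd a r * N i n' + kd a i * kd r n')))
         = (\<Sum>n'\<in>UNIV. (q * kd a r) * (N i n' * M n' n) + (q * kd a i) * (kd r n' * M n' n))"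
        by (simp add: algebra_simps del: kd_sum)
      then show ?thesis by (simp add: sum.distrib sum_distrib_left[symmetric] NM) (simp add: kd_sym[of a r] kd_sym[of a i] kd_sym[of i n] algebra_simps)
    qed
    ultimately show ?thesis
      unfolding D_def square_rot' by (simp add: left_diff_distrib sum_subtractf)
  qed
  \<comment> \<open>Composing \<open>eq\<close> with \<open>Cw\<close> undoes \<open>Bw\<close> by
    \<open>square\<close>, up to a multiple of \<open>kd c d\<close>; \<open>z\<close> collects that
    multiple.\<close>
  define z where "z a = - (\<Sum>l\<in>UNIV. \<Sum>p\<in>UNIV. (\<Sum>s\<in>UNIV. D s p * \<Phi> a s l) * M l p)" for a
  have "(\<Sum>s\<in>UNIV. D s d * \<Phi> a s c) = kd c d * z a" for a c d
  proof -
    have "0 = (\<Sum>i\<in>UNIV. \<Sum>n\<in>UNIV. Cw w \<Phi> c d i n * (\<Sum>l\<in>UNIV. \<Sum>p\<in>UNIV. (\<Sum>s\<in>UNIV. D s p * \<Phi> a s l) * Bw w \<Phi> i n l p))"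
      by (simp add: eq)
    also have "\<dots> = (\<Sum>l\<in>UNIV. \<Sum>p\<in>UNIV. (\<Sum>s\<in>UNIV. D s p * \<Phi> a s l) * (\<Sum>i\<in>UNIV. \<Sum>n\<in>UNIV. Cw w \<Phi> c d i n * Bw w \<Phi> i n l p))"
      unfolding flatten_sums
      by (rule sum.reindex_bij_witness[of _ "\<lambda>(l,p,(i,n),s). (i,n,l,p,s)" "\<lambda>(i,n,l,p,s). (l,p,(i,n),s)"]) (auto simp: mult_ac)
    also have "\<dots> = (\<Sum>l\<in>UNIV. \<Sum>p\<in>UNIV. q * (kd c l * (kd d p * (\<Sum>s\<in>UNIV. D s p * \<Phi> a s l)))
        + q * kd c d * ((\<Sum>s\<in>UNIV. D s p * \<Phi> a s l) * M l p))"
      unfolding square by (simp add: algebra_simps del: kd_sum)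
    also have "\<dots> = q * (\<Sum>s\<in>UNIV. D s d * \<Phi> a s c) - q * kd c d * z a"
      by (simp add: sum.distrib sum_distrib_left[symmetric] z_def)
    finally show ?thesis using q0 by simp
  qed
  then have "D s p = 0" by (rule kernel_zero)
  then show ?thesis by (simp add: D_def)
qed

lemma w_inv: "(\<Sum>a\<in>UNIV. \<Sum>b\<in>UNIV. \<Sum>c\<in>UNIV. M i a * M j b * M k c * w a b c) = w i j k"
proof -
  have "(\<Sum>a\<in>UNIV. \<Sum>b\<in>UNIV. \<Sum>c\<in>UNIV. M i a * M j b * M k c * w a b c)
      = (\<Sum>c\<in>UNIV. M k c * (\<Sum>m\<in>UNIV. \<Sum>b\<in>UNIV. M j m * M i b * w b m c))"
    unfolding flatten_sums
    by (rule sum.reindex_bij_witness[of _ "\<lambda>(c,b,a). (a,b,c)" "\<lambda>(a,b,c). (c,b,a)"]) (auto simp: mult_ac)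
  also have "\<dots> = (\<Sum>c\<in>UNIV. M k c * (\<Sum>d\<in>UNIV. N c d * w i j d))"
    by (simp only: w_inv1)
  also have "\<dots> = (\<Sum>d\<in>UNIV. (\<Sum>c\<in>UNIV. M k c * N c d) * w i j d)"
    unfolding flatten_sums
    by (rule sum.reindex_bij_witness[of _ "\<lambda>(c,b). (b,c)" "\<lambda>(a,b). (b,a)"]) (auto simp: mult_ac)
  finally show ?thesis by (simp add: MN)
qed

end

section \<open>From the braid relation to webs\<close>

definition phi :: "'a::comm_ring_1 tensor3 \<Rightarrow> 3 \<Rightarrow> (3 \<Rightarrow> 3 \<Rightarrow> 'a) \<Rightarrow> 'a" where
  "phi \<Phi> n v = (\<Sum>k\<in>UNIV. \<Sum>l\<in>UNIV. \<Phi> n k l * v k l)"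

definition A12 :: "'a::comm_ring_1 tensor3 \<Rightarrow> 'a tensor3 \<Rightarrow> 'a tensor3 \<Rightarrow> 'a tensor3" where
  "A12 w \<Phi> t i j k = (\<Sum>n\<in>UNIV. w n i j * phi \<Phi> n (\<lambda>a b. t a b k))"

definition A23 :: "'a::comm_ring_1 tensor3 \<Rightarrow> 'a tensor3 \<Rightarrow> 'a tensor3 \<Rightarrow> 'a tensor3" where
  "A23 w \<Phi> t i j k = (\<Sum>n\<in>UNIV. w n j k * phi \<Phi> n (\<lambda>a b. t i a b))"

text \<open>The span \<open>W\<close> of the (linearly independent) slices of \<open>w\<close> contains no nonzero tensor of rank at most one.\<close>

definition no_rank_one :: "'a::comm_ring_1 tensor3 \<Rightarrow> bool" where
  "no_rank_one w \<longleftrightarrow> (\<forall>\<xi> u z. (\<forall>j d. (\<Sum>m\<in>UNIV. w m j d * \<xi> m) = u j * z d) \<longrightarrow> (\<forall>m. \<xi> m = 0))"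

text \<open>For cyclic \<open>w\<close>: the intersection of \<open>W \<otimes> V\<close> and \<open>V \<otimes> W\<close> is the line through \<open>w\<close>.\<close>

definition simple_overlap :: "'a::comm_ring_1 tensor3 \<Rightarrow> bool" where
  "simple_overlap w \<longleftrightarrow> (\<forall>X Y. (\<forall>i j k. (\<Sum>n\<in>UNIV. w n i j * Y n k) = (\<Sum>n\<in>UNIV. X i n * w n j k)) \<longrightarrow>
     (\<exists>y. \<forall>n k. Y n k = y * kd n k))"

text \<open>The two sides of \<open>braid\<close> lie in \<open>W \<otimes> V\<close> and in
  \<open>V \<otimes> W\<close>, hence on the line through \<open>w\<close>. The input is
  \<open>v i\<close> tensored with a basis vector, where \<open>v i\<close> is a preimage of
  \<open>w i\<close>. The multiple of \<open>w\<close> that results is a matrix entry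
  \<open>y i j\<close>, and \<open>M\<close> is \<open>y\<close> divided by
  \<open>q\<close>.\<close>

lemma web_of_braid:
  fixes w \<Phi> :: "'a::field tensor3" and q :: 'a
  assumes q0: "q \<noteq> 0"
    and cyc: "\<And>i j k. w i j k = w j k i"
    and r1: "no_rank_one w"
    and ov: "simple_overlap w"
    and surj: "\<And>m. \<exists>v. \<forall>n. phi \<Phi> n v = kd n m"
    and hecke: "\<And>v i j. (\<Sum>n\<in>UNIV. w n i j * phi \<Phi> n (\<lambda>a b. \<Sum>m\<in>UNIV. w m a b * phi \<Phi> m v)) = - (1 + q) * (\<Sum>n\<in>UNIV. w n i j * phi \<Phi> n v)"
    and braid: "\<And>t i j k. A12 w \<Phi> (A23 w \<Phi> (A12 w \<Phi> t)) i j k - q * A12 w \<Phi> t i j k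
        = A23 w \<Phi> (A12 w \<Phi> (A23 w \<Phi> t)) i j k - q * A23 w \<Phi> t i j k"
  obtains M where "web w \<Phi> M q"
proof -
  obtain v where v: "\<And>m n. phi \<Phi> n (v m) = kd n m"
    using surj by metis
  have bigon: "phi \<Phi> n (w m) = - (1 + q) * kd n m" for n m
  proof -
    have "(\<Sum>n\<in>UNIV. w n i j * (phi \<Phi> n (w m) - - (1 + q) * kd n m)) = 0 * 0" for i j
    proof -
      have "(\<Sum>n\<in>UNIV. w n i j * phi \<Phi> n (w m)) = - (1 + q) * w m i j"
        using hecke[of i j "v m"] by (simp add: v)
      moreover have "(\<Sum>n\<in>UNIV. w n i j * (- (1 + q) * kd n m)) = - (1 + q) * w m i j"
        using kd_sum(3)[of "\<lambda>n. w n i j * - (1 + q)" m] by (simp add: mult_ac del: kd_sum)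
      ultimately show ?thesis by (simp only: right_diff_distrib sum_subtractf) simp
    qed
    \<comment> \<open>For zero vectors \<open>u\<close> and \<open>z\<close>,
      \<open>no_rank_one\<close> is the linear independence of the slices of
      \<open>w\<close>.\<close>
    then have "\<forall>n. phi \<Phi> n (w m) - - (1 + q) * kd n m = 0"
      using r1[unfolded no_rank_one_def, rule_format, of "\<lambda>n. phi \<Phi> n (w m) - - (1 + q) * kd n m" "\<lambda>_. 0" "\<lambda>_. 0"] by blast
    then show ?thesis by simp
  qed
  have "\<exists>y. \<forall>n b. (\<Sum>k\<in>UNIV. \<Sum>m\<in>UNIV. Cw w \<Phi> n b k m * Bw w \<Phi> k m i j) - q * (kd n i * kd b j) = y * kd n b" for i j
  proof -
    define t where "t a b c = v i a b * kd c j" for a b c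
    have t1: "A12 w \<Phi> t = (\<lambda>a b c. w i a b * kd c j)"
    proof (intro ext)
      fix a b c
      have "phi \<Phi> n (\<lambda>a b. t a b c) = phi \<Phi> n (v i) * kd c j" for n
        by (simp add: phi_def t_def sum_distrib_left mult_ac del: kd_sum)
      then show "A12 w \<Phi> t a b c = w i a b * kd c j"
        using kd_sum(3)[of "\<lambda>n. w n a b * kd c j" i] by (simp add: A12_def v mult_ac del: kd_sum)
    qed
    have t2: "A23 w \<Phi> (A12 w \<Phi> t) a b c = (\<Sum>m\<in>UNIV. w m b c * Bw w \<Phi> a m i j)" for a b c
      by (simp add: A23_def t1 phi_def Bw_def mult.assoc[symmetric]) (simp add: mult_ac)
    have t3: "phi \<Phi> n (\<lambda>a b. A23 w \<Phi> (A12 w \<Phi> t) a b z) = (\<Sum>k\<in>UNIV. \<Sum>m\<in>UNIV. Cw w \<Phi> n z k m * Bw w \<Phi> k m i j)" for n z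
      unfolding t2 phi_def Cw_def flatten_sums
      by (rule sum.reindex_bij_witness[of _ "\<lambda>(k,m,p). (k,p,m)" "\<lambda>(k,p,m). (k,m,p)"]) (auto simp: mult_ac)
    have "(\<Sum>n\<in>UNIV. w n x y * ((\<Sum>k\<in>UNIV. \<Sum>m\<in>UNIV. Cw w \<Phi> n z k m * Bw w \<Phi> k m i j) - q * (kd n i * kd z j)))
        = (\<Sum>n\<in>UNIV. (phi \<Phi> n (\<lambda>a b. A12 w \<Phi> (A23 w \<Phi> t) x a b) - q * phi \<Phi> n (\<lambda>a b. t x a b)) * w n y z)" for x y z
    proof -
      have "A12 w \<Phi> (A23 w \<Phi> (A12 w \<Phi> t)) x y z = (\<Sum>n\<in>UNIV. w n x y * (\<Sum>k\<in>UNIV. \<Sum>m\<in>UNIV. Cw w \<Phi> n z k m * Bw w \<Phi> k m i j))"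
        by (subst A12_def) (simp only: t3)
      moreover have "A12 w \<Phi> t x y z = (\<Sum>n\<in>UNIV. w n x y * (kd n i * kd z j))"
        using kd_sum(3)[of "\<lambda>n. w n x y * kd z j" i] by (simp add: t1 mult_ac del: kd_sum)
      ultimately have "A12 w \<Phi> (A23 w \<Phi> (A12 w \<Phi> t)) x y z - q * A12 w \<Phi> t x y z = (\<Sum>n\<in>UNIV. w n x y * ((\<Sum>k\<in>UNIV. \<Sum>m\<in>UNIV. Cw w \<Phi> n z k m * Bw w \<Phi> k m i j) - q * (kd n i * kd z j)))"
        by (simp add: right_diff_distrib sum_subtractf sum_distrib_left mult_ac del: kd_sum)
      moreover have "A23 w \<Phi> (A12 w \<Phi> (A23 w \<Phi> t)) x y z - q * A23 w \<Phi> t x y z = (\<Sum>n\<in>UNIV. (phi \<Phi> n (\<lambda>a b. A12 w \<Phi> (A23 w \<Phi> t) x a b) - q * phi \<Phi> n (\<lambda>a b. t x a b)) * w n y z)"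
        unfolding A23_def[of w \<Phi> "A12 w \<Phi> (A23 w \<Phi> t)"] A23_def[of w \<Phi> t x y z]
        by (simp add: right_diff_distrib left_diff_distrib sum_subtractf sum_distrib_left mult_ac del: kd_sum)
      ultimately show ?thesis using braid[of t x y z] by simp
    qed
    then show ?thesis
      using ov[unfolded simple_overlap_def, rule_format,
          of "\<lambda>n z. (\<Sum>k\<in>UNIV. \<Sum>m\<in>UNIV. Cw w \<Phi> n z k m * Bw w \<Phi> k m i j) - q * (kd n i * kd z j)"
             "\<lambda>x n. phi \<Phi> n (\<lambda>a b. A12 w \<Phi> (A23 w \<Phi> t) x a b) - q * phi \<Phi> n (\<lambda>a b. t x a b)"]
      by blast
  qed
  then obtain y where y: "\<And>i j n b. (\<Sum>k\<in>UNIV. \<Sum>m\<in>UNIV. Cw w \<Phi> n b k m * Bw w \<Phi> k m i j) - q * (kd n i * kd b j) = y i j * kd n b"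
    by metis
  have sq: "(\<Sum>k\<in>UNIV. \<Sum>m\<in>UNIV. Cw w \<Phi> n b k m * Bw w \<Phi> k m i j) = q * (kd n i * kd b j) + kd n b * y i j" for n b i j
    using y[of n b i j] by (simp add: algebra_simps del: kd_sum)
  \<comment> \<open>A square with one more \<open>w\<close>-vertex and one more
    \<open>\<Phi>\<close>-vertex attached contains a second square. Resolving the one or the other
    and comparing gives a combination of slices of \<open>w\<close> equal to
    \<open>kd n b * z d\<close>. For fixed \<open>n\<close> this has rank at most one, so its
    coefficients \<open>\<xi>\<close> vanish.\<close>
  have rot: "(\<Sum>k\<in>UNIV. y k j * \<Phi> n k m) = q * \<Phi> m n j" for n m j
  proof -
    define \<xi> where "\<xi> m = (\<Sum>k\<in>UNIV. y k j * \<Phi> n k m) - q * \<Phi> m n j" for m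
    define z where "z d = (\<Sum>l\<in>UNIV. \<Sum>m\<in>UNIV. \<Sum>p\<in>UNIV. y l p * \<Phi> m l j * w m p d) + q * kd d j * (1 + q)" for d
    have "(\<Sum>m\<in>UNIV. w m b d * \<xi> m) = kd n b * z d" for b d
    proof -
      have "(\<Sum>l\<in>UNIV. \<Sum>m\<in>UNIV. \<Sum>p\<in>UNIV. (\<Sum>k\<in>UNIV. \<Sum>s\<in>UNIV. Cw w \<Phi> n b k s * Bw w \<Phi> k s l p) * \<Phi> m l j * w m p d)
        = (\<Sum>k\<in>UNIV. \<Sum>s\<in>UNIV. Cw w \<Phi> n b k s * (\<Sum>r\<in>UNIV. \<Sum>m\<in>UNIV. (\<Sum>p\<in>UNIV. w m p d * \<Phi> s r p) * (\<Sum>l\<in>UNIV. w l k r * \<Phi> m l j)))"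
        unfolding Bw_def flatten_sums
        by (rule sum.reindex_bij_witness[of _ "\<lambda>(k,s,r,m,l,p). (l,m,p,k,s,r)" "\<lambda>(l,m,p,k,s,r). (k,s,r,m,l,p)"])
           (auto simp: mult_ac)
      also have "\<dots> = (\<Sum>k\<in>UNIV. \<Sum>s\<in>UNIV. Cw w \<Phi> n b k s * (\<Sum>r\<in>UNIV. \<Sum>m\<in>UNIV. Cw w \<Phi> s d r m * Bw w \<Phi> r m k j))"
      proof -
        have "(\<Sum>l\<in>UNIV. w l k r * \<Phi> m l j) = Bw w \<Phi> r m k j" for k r m
          unfolding Bw_def by (rule sum.cong[OF refl]) (use cyc in metis)
        then show ?thesis by (simp only: Cw_def)
      qed
      also have "\<dots> = (q * kd d j) * (\<Sum>k\<in>UNIV. \<Sum>s\<in>UNIV. Cw w \<Phi> n b k s * kd s k) + (\<Sum>k\<in>UNIV. y k j * (\<Sum>s\<in>UNIV. Cw w \<Phi> n b k s * kd s d))"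
        unfolding sq by (simp add: algebra_simps sum.distrib sum_distrib_left del: kd_sum)
      also have "(\<Sum>k\<in>UNIV. \<Sum>s\<in>UNIV. Cw w \<Phi> n b k s * kd s k) = phi \<Phi> n (w b)"
      proof -
        have "w k p b = w b k p" for k p using cyc by metis
        then show ?thesis by (simp add: Cw_def phi_def mult_ac)
      qed
      also have "(\<Sum>k\<in>UNIV. y k j * (\<Sum>s\<in>UNIV. Cw w \<Phi> n b k s * kd s d)) = (\<Sum>m\<in>UNIV. w m b d * (\<Sum>k\<in>UNIV. y k j * \<Phi> n k m))"
      proof -
        have "w d p b = w p b d" for p using cyc by metis
        then have "(\<Sum>k\<in>UNIV. y k j * (\<Sum>s\<in>UNIV. Cw w \<Phi> n b k s * kd s d)) = (\<Sum>k\<in>UNIV. y k j * (\<Sum>p\<in>UNIV. w p b d * \<Phi> n k p))"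
          by (simp add: Cw_def)
        also have "\<dots> = (\<Sum>m\<in>UNIV. w m b d * (\<Sum>k\<in>UNIV. y k j * \<Phi> n k m))"
          unfolding flatten_sums
          by (rule sum.reindex_bij_witness[of _ "\<lambda>(l,j). (j,l)" "\<lambda>(j,l). (l,j)"]) (auto simp: mult_ac)
        finally show ?thesis .
      qed
      finally have 1: "(\<Sum>l\<in>UNIV. \<Sum>m\<in>UNIV. \<Sum>p\<in>UNIV. (\<Sum>k\<in>UNIV. \<Sum>s\<in>UNIV. Cw w \<Phi> n b k s * Bw w \<Phi> k s l p) * \<Phi> m l j * w m p d)
         = q * kd d j * (- (1 + q) * kd n b) + (\<Sum>m\<in>UNIV. w m b d * (\<Sum>k\<in>UNIV. y k j * \<Phi> n k m))"
        unfolding bigon .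
      have "(\<Sum>l\<in>UNIV. \<Sum>m\<in>UNIV. \<Sum>p\<in>UNIV. (\<Sum>k\<in>UNIV. \<Sum>s\<in>UNIV. Cw w \<Phi> n b k s * Bw w \<Phi> k s l p) * \<Phi> m l j * w m p d)
        = q * (\<Sum>l\<in>UNIV. kd n l * (\<Sum>m\<in>UNIV. (\<Sum>p\<in>UNIV. kd b p * w m p d) * \<Phi> m l j)) + kd n b * (\<Sum>l\<in>UNIV. \<Sum>m\<in>UNIV. \<Sum>p\<in>UNIV. y l p * \<Phi> m l j * w m p d)"
        unfolding sq by (simp add: algebra_simps sum.distrib sum_distrib_left del: kd_sum)
      also have "\<dots> = q * (\<Sum>m\<in>UNIV. w m b d * \<Phi> m n j) + kd n b * (\<Sum>l\<in>UNIV. \<Sum>m\<in>UNIV. \<Sum>p\<in>UNIV. y l p * \<Phi> m l j * w m p d)"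
        by simp
      finally have "(\<Sum>m\<in>UNIV. w m b d * (\<Sum>k\<in>UNIV. y k j * \<Phi> n k m)) - q * (\<Sum>m\<in>UNIV. w m b d * \<Phi> m n j) = kd n b * z d"
        unfolding 1 z_def by (simp add: algebra_simps del: kd_sum)
      then show ?thesis
        unfolding \<xi>_def by (simp add: right_diff_distrib sum_subtractf sum_distrib_left mult_ac)
    qed
    then have "\<forall>m. \<xi> m = 0"
      using r1[unfolded no_rank_one_def, rule_format, of \<xi> "kd n" z] by blast
    then show ?thesis by (simp add: \<xi>_def)
  qed
  have "web w \<Phi> (\<lambda>i j. y i j / q) q"
  proof
    show "q \<noteq> 0" by (rule q0)
    show "w i j k = w j k i" for i j k by (rule cyc)
    show "(\<Sum>k\<in>UNIV. \<Sum>l\<in>UNIV. w j k l * \<Phi> i k l) = - (1 + q) * kd i j" for i j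
      using bigon[of i j] by (simp add: phi_def mult_ac)
    show "(\<Sum>k\<in>UNIV. \<Sum>m\<in>UNIV. Cw w \<Phi> n b k m * Bw w \<Phi> k m i j) = q * (kd n i * kd b j + kd n b * (y i j / q))" for n b i j
      unfolding sq using q0 by (simp add: field_simps del: kd_sum)
    show "\<Phi> m l j = (\<Sum>i\<in>UNIV. y i j / q * \<Phi> l i m)" for m l j
      using rot[of j l m] q0 by (simp add: sum_divide_distrib[symmetric])
  qed
  then show ?thesis by (rule that)
qed

section \<open>Change of basis\<close>

definition up3 :: "(3 \<Rightarrow> 3 \<Rightarrow> 'a::comm_ring_1) \<Rightarrow> 'a tensor3 \<Rightarrow> 'a tensor3" where
  "up3 g w i j k = (\<Sum>a\<in>UNIV. \<Sum>b\<in>UNIV. \<Sum>c\<in>UNIV. g i a * g j b * g k c * w a b c)"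

definition down3 :: "(3 \<Rightarrow> 3 \<Rightarrow> 'a::comm_ring_1) \<Rightarrow> 'a tensor3 \<Rightarrow> 'a tensor3" where
  "down3 h \<Phi> i j k = (\<Sum>a\<in>UNIV. \<Sum>b\<in>UNIV. \<Sum>c\<in>UNIV. h a i * h b j * h c k * \<Phi> a b c)"

lemma Bw_base_change:
  assumes hg: "\<And>i k. (\<Sum>j\<in>UNIV. h i j * g j k) = kd i k"
  shows "Bw (up3 g w) (down3 h \<Phi>) k m i j
    = (\<Sum>i'\<in>UNIV. \<Sum>j'\<in>UNIV. \<Sum>k'\<in>UNIV. \<Sum>m'\<in>UNIV. g i i' * h j' j * g k k' * h m' m * Bw w \<Phi> k' m' i' j')"
proof -
  have "Bw (up3 g w) (down3 h \<Phi>) k m i j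
    = (\<Sum>i'\<in>UNIV. \<Sum>j'\<in>UNIV. \<Sum>k'\<in>UNIV. \<Sum>m'\<in>UNIV. g i i' * h j' j * g k k' * h m' m *
        (\<Sum>c\<in>UNIV. w i' k' c * (\<Sum>y\<in>UNIV. (\<Sum>l\<in>UNIV. h y l * g l c) * \<Phi> m' y j')))"
    unfolding Bw_def up3_def down3_def flatten_sums
    by (rule sum.reindex_bij_witness[of _ "\<lambda>(a,z,b,x,c,y,l). (l,(x,y,z),a,b,c)" "\<lambda>(l,(x,y,z),a,b,c). (a,z,b,x,c,y,l)"])
      (auto simp: mult_ac)
  then show ?thesis by (simp add: hg Bw_def)
qed

lemma Cw_base_change:
  assumes hg: "\<And>i k. (\<Sum>j\<in>UNIV. h i j * g j k) = kd i k"
  shows "Cw (up3 g w) (down3 h \<Phi>) n b k m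
    = (\<Sum>n'\<in>UNIV. \<Sum>b'\<in>UNIV. \<Sum>k'\<in>UNIV. \<Sum>m'\<in>UNIV. h n' n * g b b' * h k' k * g m m' * Cw w \<Phi> n' b' k' m')"
proof -
  have "Cw (up3 g w) (down3 h \<Phi>) n b k m
    = (\<Sum>n'\<in>UNIV. \<Sum>b'\<in>UNIV. \<Sum>k'\<in>UNIV. \<Sum>m'\<in>UNIV. h n' n * g b b' * h k' k * g m m' *
        (\<Sum>c\<in>UNIV. w m' c b' * (\<Sum>y\<in>UNIV. (\<Sum>l\<in>UNIV. h y l * g l c) * \<Phi> n' k' y)))"
    unfolding Cw_def up3_def down3_def flatten_sums
    by (rule sum.reindex_bij_witness[of _ "\<lambda>(n',b',k',m',c,y,l). (l,(n',k',y),m',c,b')" "\<lambda>(l,(n',k',y),m',c,b'). (n',b',k',m',c,y,l)"])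
      (auto simp: mult_ac)
  then show ?thesis by (simp add: hg Cw_def)
qed

text \<open>Every internal edge pairs an index transformed by \<open>g\<close> with one transformed
  by \<open>h\<close>, so these factors cancel along it. Only the outer legs see the new basis, and
  \<open>M\<close> is conjugated.\<close>

lemma (in web) base_change:
  assumes hg: "\<And>i k. (\<Sum>j\<in>UNIV. h i j * g j k) = kd i k"
    and gh: "\<And>i k. (\<Sum>j\<in>UNIV. g i j * h j k) = kd i k"
  shows "web (up3 g w) (down3 h \<Phi>) (\<lambda>i j. \<Sum>a\<in>UNIV. \<Sum>b\<in>UNIV. g i a * M a b * h b j) q"
proof
  show "q \<noteq> 0" by (rule q0)
  show "up3 g w i j k = up3 g w j k i" for i j k
  proof -
    have "w a b c = w b c a" for a b c by (rule cyc)
    then have "up3 g w i j k = (\<Sum>a\<in>UNIV. \<Sum>b\<in>UNIV. \<Sum>c\<in>UNIV. g i a * g j b * g k c * w b c a)"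
      unfolding up3_def by (intro sum.cong refl arg_cong2[where f = "(*)"])
    also have "\<dots> = up3 g w j k i"
      unfolding up3_def flatten_sums
      by (rule sum.reindex_bij_witness[of _ "\<lambda>(b,c,a). (a,b,c)" "\<lambda>(a,b,c). (b,c,a)"]) (auto simp: mult_ac)
    finally show ?thesis .
  qed
  show "(\<Sum>k\<in>UNIV. \<Sum>l\<in>UNIV. up3 g w j k l * down3 h \<Phi> i k l) = - (1 + q) * kd i j" for i j
  proof -
    have "(\<Sum>k\<in>UNIV. \<Sum>l\<in>UNIV. up3 g w j k l * down3 h \<Phi> i k l)
      = (\<Sum>x\<in>UNIV. h x i * (\<Sum>a\<in>UNIV. g j a *
          (\<Sum>b\<in>UNIV. \<Sum>c\<in>UNIV. w a b c * (\<Sum>y\<in>UNIV. (\<Sum>k\<in>UNIV. h y k * g k b) * (\<Sum>z\<in>UNIV. (\<Sum>l\<in>UNIV. h z l * g l c) * \<Phi> x y z)))))"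
      unfolding up3_def down3_def flatten_sums
      by (rule sum.reindex_bij_witness[of _ "\<lambda>(x,a,b,c,y,(z,l),k). (k,l,(x,y,z),a,b,c)" "\<lambda>(k,l,(x,y,z),a,b,c). (x,a,b,c,y,(z,l),k)"])
        (auto simp: mult_ac)
    also have "\<dots> = (\<Sum>x\<in>UNIV. h x i * (\<Sum>a\<in>UNIV. (g j a * - (1 + q)) * kd x a))"
      unfolding hg by (simp only: kd_sum bigon mult.assoc)
    also have "\<dots> = - (1 + q) * (\<Sum>x\<in>UNIV. g j x * h x i)"
      by (simp only: kd_sum sum_distrib_left mult_ac)
    finally show ?thesis by (simp add: gh kd_sym)
  qed
  show "(\<Sum>k\<in>UNIV. \<Sum>m\<in>UNIV. Cw (up3 g w) (down3 h \<Phi>) n b k m * Bw (up3 g w) (down3 h \<Phi>) k m i j)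
      = q * (kd n i * kd b j + kd n b * (\<Sum>a\<in>UNIV. \<Sum>b\<in>UNIV. g i a * M a b * h b j))" for n b i j
  proof -
    have "(\<Sum>k\<in>UNIV. \<Sum>m\<in>UNIV. Cw (up3 g w) (down3 h \<Phi>) n b k m * Bw (up3 g w) (down3 h \<Phi>) k m i j)
      = (\<Sum>n'\<in>UNIV. \<Sum>b'\<in>UNIV. \<Sum>i'\<in>UNIV. \<Sum>j'\<in>UNIV. h n' n * g b b' * g i i' * h j' j *
          (\<Sum>k1\<in>UNIV. \<Sum>m1\<in>UNIV. Cw w \<Phi> n' b' k1 m1 * (\<Sum>k2\<in>UNIV. (\<Sum>k\<in>UNIV. h k1 k * g k k2) *
            (\<Sum>m2\<in>UNIV. (\<Sum>m\<in>UNIV. h m2 m * g m m1) * Bw w \<Phi> k2 m2 i' j'))))"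
      unfolding Bw_base_change[of h g, OF hg] Cw_base_change[of h g, OF hg] flatten_sums
      by (rule sum.reindex_bij_witness[of _ "\<lambda>(n',b',i',j',k1,m1,k2,(m2,m),k). (k,m,(i',j',k2,m2),n',b',k1,m1)"
            "\<lambda>(k,m,(i',j',k2,m2),n',b',k1,m1). (n',b',i',j',k1,m1,k2,(m2,m),k)"])
        (auto simp: mult_ac)
    also have "\<dots> = (\<Sum>n'\<in>UNIV. \<Sum>b'\<in>UNIV. \<Sum>i'\<in>UNIV. \<Sum>j'\<in>UNIV. h n' n * g b b' * g i i' * h j' j *
          (q * (kd n' i' * kd b' j' + kd n' b' * M i' j')))"
      unfolding hg by (simp only: kd_sum square)
    also have "\<dots> = (\<Sum>n'\<in>UNIV. q * ((h n' n * (\<Sum>i'\<in>UNIV. kd n' i' * g i i')) * (\<Sum>b'\<in>UNIV. g b b' * (\<Sum>j'\<in>UNIV. kd b' j' * h j' j)))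
        + q * (h n' n * (\<Sum>b'\<in>UNIV. g b b' * kd n' b') * (\<Sum>i'\<in>UNIV. \<Sum>j'\<in>UNIV. g i i' * M i' j' * h j' j)))"
    proof (rule sum.cong[OF refl])
      fix n'
      have "(\<Sum>b'\<in>UNIV. \<Sum>i'\<in>UNIV. \<Sum>j'\<in>UNIV. h n' n * g b b' * g i i' * h j' j * (q * (kd n' i' * kd b' j' + kd n' b' * M i' j')))
        = (\<Sum>b'\<in>UNIV. \<Sum>i'\<in>UNIV. \<Sum>j'\<in>UNIV. h n' n * g b b' * g i i' * h j' j * (q * (kd n' i' * kd b' j')))
        + (\<Sum>b'\<in>UNIV. \<Sum>i'\<in>UNIV. \<Sum>j'\<in>UNIV. h n' n * g b b' * g i i' * h j' j * (q * (kd n' b' * M i' j')))"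
        by (simp only: distrib_left sum.distrib)
      also have "(\<Sum>b'\<in>UNIV. \<Sum>i'\<in>UNIV. \<Sum>j'\<in>UNIV. h n' n * g b b' * g i i' * h j' j * (q * (kd n' i' * kd b' j')))
        = q * (h n' n * (\<Sum>i'\<in>UNIV. kd n' i' * g i i') * (\<Sum>b'\<in>UNIV. g b b' * (\<Sum>j'\<in>UNIV. kd b' j' * h j' j)))"
        unfolding flatten_sums
        by (rule sum.reindex_bij_witness[of _ "\<lambda>((b',j'),i'). (b',i',j')" "\<lambda>(b',i',j'). ((b',j'),i')"])
          (auto simp: mult_ac)
      also have "(\<Sum>b'\<in>UNIV. \<Sum>i'\<in>UNIV. \<Sum>j'\<in>UNIV. h n' n * g b b' * g i i' * h j' j * (q * (kd n' b' * M i' j')))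
        = q * (h n' n * (\<Sum>b'\<in>UNIV. g b b' * kd n' b') * (\<Sum>i'\<in>UNIV. \<Sum>j'\<in>UNIV. g i i' * M i' j' * h j' j))"
        unfolding flatten_sums
        by (rule sum.reindex_bij_witness[of _ "\<lambda>((i',j'),b'). (b',i',j')" "\<lambda>(b',i',j'). ((i',j'),b')"])
          (auto simp: mult_ac)
      finally show "(\<Sum>b'\<in>UNIV. \<Sum>i'\<in>UNIV. \<Sum>j'\<in>UNIV. h n' n * g b b' * g i i' * h j' j * (q * (kd n' i' * kd b' j' + kd n' b' * M i' j')))
        = q * ((h n' n * (\<Sum>i'\<in>UNIV. kd n' i' * g i i')) * (\<Sum>b'\<in>UNIV. g b b' * (\<Sum>j'\<in>UNIV. kd b' j' * h j' j)))
        + q * (h n' n * (\<Sum>b'\<in>UNIV. g b b' * kd n' b') * (\<Sum>i'\<in>UNIV. \<Sum>j'\<in>UNIV. g i i' * M i' j' * h j' j))" .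
    qed
    also have "\<dots> = q * ((\<Sum>n'\<in>UNIV. g i n' * h n' n) * (\<Sum>b'\<in>UNIV. g b b' * h b' j)
        + (\<Sum>n'\<in>UNIV. g b n' * h n' n) * (\<Sum>i'\<in>UNIV. \<Sum>j'\<in>UNIV. g i i' * M i' j' * h j' j))"
    proof -
      have "(\<Sum>x\<in>UNIV. q * (h x n * g i x * Y) + q * (h x n * g b x * X))
          = q * ((\<Sum>x\<in>UNIV. g i x * h x n) * Y + (\<Sum>x\<in>UNIV. g b x * h x n) * X)" for X Y
        by (simp add: sum.distrib sum_distrib_left sum_distrib_right algebra_simps)
      then show ?thesis by (simp only: kd_sum)
    qed
    finally show ?thesis by (simp only: gh kd_sym)
  qed
  show "down3 h \<Phi> m l j = (\<Sum>i\<in>UNIV. (\<Sum>a\<in>UNIV. \<Sum>b\<in>UNIV. g i a * M a b * h b j) * down3 h \<Phi> l i m)" for m l j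
  proof -
    have "(\<Sum>i\<in>UNIV. (\<Sum>a\<in>UNIV. \<Sum>b\<in>UNIV. g i a * M a b * h b j) * down3 h \<Phi> l i m)
      = (\<Sum>z\<in>UNIV. \<Sum>x\<in>UNIV. \<Sum>b\<in>UNIV. h z m * h x l * h b j * (\<Sum>a\<in>UNIV. M a b * (\<Sum>y\<in>UNIV. (\<Sum>i\<in>UNIV. h y i * g i a) * \<Phi> x y z)))"
      unfolding down3_def flatten_sums
      by (rule sum.reindex_bij_witness[of _ "\<lambda>(z,x,b,a,y,i). (i,(x,y,z),a,b)" "\<lambda>(i,(x,y,z),a,b). (z,x,b,a,y,i)"])
        (auto simp: mult_ac)
    also have "\<dots> = down3 h \<Phi> m l j"
      unfolding hg down3_def by (simp add: rot[symmetric])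
    finally show ?thesis ..
  qed
qed

lemma up3_inverse:
  assumes gh: "\<And>i k. (\<Sum>j\<in>UNIV. g i j * h j k) = kd i k"
  shows "up3 g (up3 h w) = w"
proof (intro ext)
  fix i j k
  have "up3 g (up3 h w) i j k = (\<Sum>a\<in>UNIV. (\<Sum>x\<in>UNIV. g i x * h x a) * (\<Sum>b\<in>UNIV. (\<Sum>y\<in>UNIV. g j y * h y b) * (\<Sum>c\<in>UNIV. (\<Sum>z\<in>UNIV. g k z * h z c) * w a b c)))"
    unfolding up3_def flatten_sums
    by (rule sum.reindex_bij_witness[of _ "\<lambda>(a,(b,(c,z),y),x). (x,y,z,a,b,c)" "\<lambda>(x,y,z,a,b,c). (a,(b,(c,z),y),x)"])
      (auto simp: mult_ac)
  then show "up3 g (up3 h w) i j k = w i j k" by (simp add: gh)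
qed

lemma vec_transport_zero:
  fixes h g :: "3 \<Rightarrow> 3 \<Rightarrow> 'a::comm_ring_1"
  assumes hg: "\<And>i k. (\<Sum>j\<in>UNIV. h i j * g j k) = kd i k"
    and z: "\<And>j. (\<Sum>m\<in>UNIV. h m j * \<xi> m) = 0"
  shows "\<xi> n = 0"
proof -
  have "(\<Sum>j\<in>UNIV. g j n * (\<Sum>m\<in>UNIV. h m j * \<xi> m)) = (\<Sum>m\<in>UNIV. (\<Sum>j\<in>UNIV. h m j * g j n) * \<xi> m)"
    unfolding flatten_sums
    by (rule sum.reindex_bij_witness[of _ "\<lambda>(m,j). (j,m)" "\<lambda>(j,m). (m,j)"]) (auto simp: mult_ac)
  then show ?thesis by (simp add: hg z)
qed

lemma no_rank_one_up3:
  assumes gh: "\<And>i k. (\<Sum>j\<in>UNIV. g i j * h j k) = kd i k"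
    and hg: "\<And>i k. (\<Sum>j\<in>UNIV. h i j * g j k) = kd i k"
    and w: "no_rank_one w"
  shows "no_rank_one (up3 h w)"
  unfolding no_rank_one_def
proof (intro allI impI)
  fix \<xi> u z n
  assume eq: "\<forall>j d. (\<Sum>m\<in>UNIV. up3 h w m j d * \<xi> m) = u j * z d"
  have "(\<Sum>m\<in>UNIV. w m x y * (\<Sum>n\<in>UNIV. h n m * \<xi> n)) = (\<Sum>j\<in>UNIV. g x j * u j) * (\<Sum>d\<in>UNIV. g y d * z d)" for x y
  proof -
    have "(\<Sum>j\<in>UNIV. g x j * (\<Sum>d\<in>UNIV. g y d * (\<Sum>m\<in>UNIV. up3 h w m j d * \<xi> m)))
      = (\<Sum>m\<in>UNIV. \<Sum>n\<in>UNIV. h n m * \<xi> n * (\<Sum>b\<in>UNIV. (\<Sum>j\<in>UNIV. g x j * h j b) * (\<Sum>c\<in>UNIV. (\<Sum>d\<in>UNIV. g y d * h d c) * w m b c)))"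
      unfolding up3_def flatten_sums
      by (rule sum.reindex_bij_witness[of _ "\<lambda>(m,n,b,(c,d),j). (j,d,n,m,b,c)" "\<lambda>(j,d,n,m,b,c). (m,n,b,(c,d),j)"])
        (auto simp: mult_ac)
    also have "\<dots> = (\<Sum>m\<in>UNIV. w m x y * (\<Sum>n\<in>UNIV. h n m * \<xi> n))"
      by (simp add: gh sum_distrib_left mult_ac)
    finally have "(\<Sum>m\<in>UNIV. w m x y * (\<Sum>n\<in>UNIV. h n m * \<xi> n)) = (\<Sum>j\<in>UNIV. g x j * (\<Sum>d\<in>UNIV. g y d * (u j * z d)))"
      by (simp only: eq[rule_format])
    also have "\<dots> = (\<Sum>j\<in>UNIV. g x j * u j) * (\<Sum>d\<in>UNIV. g y d * z d)"
      unfolding flatten_sums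
      by (rule sum.reindex_bij_witness[of _ "\<lambda>(d,j). (j,d)" "\<lambda>(j,d). (d,j)"]) (auto simp: mult_ac)
    finally show ?thesis .
  qed
  then have "\<forall>m. (\<Sum>n\<in>UNIV. h n m * \<xi> n) = 0"
    using w[unfolded no_rank_one_def, rule_format, of "\<lambda>m. (\<Sum>n\<in>UNIV. h n m * \<xi> n)"
      "\<lambda>x. (\<Sum>j\<in>UNIV. g x j * u j)" "\<lambda>y. (\<Sum>d\<in>UNIV. g y d * z d)"] by blast
  then show "\<xi> n = 0" using vec_transport_zero[of h g \<xi> n, OF hg] by blast
qed

lemma simple_overlap_up3:
  assumes gh: "\<And>i k. (\<Sum>j\<in>UNIV. g i j * h j k) = kd i k"
    and hg: "\<And>i k. (\<Sum>j\<in>UNIV. h i j * g j k) = kd i k"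
    and w: "simple_overlap w"
  shows "simple_overlap (up3 h w)"
  unfolding simple_overlap_def
proof (intro allI impI)
  fix X Y
  assume eq: "\<forall>i j k. (\<Sum>n\<in>UNIV. up3 h w n i j * Y n k) = (\<Sum>n\<in>UNIV. X i n * up3 h w n j k)"
  define Y' where "Y' m z = (\<Sum>n\<in>UNIV. \<Sum>k\<in>UNIV. h n m * g z k * Y n k)" for m z
  define X' where "X' x m = (\<Sum>i\<in>UNIV. \<Sum>n\<in>UNIV. g x i * h n m * X i n)" for x m
  have "(\<Sum>n\<in>UNIV. w n x y * Y' n z) = (\<Sum>n\<in>UNIV. X' x n * w n y z)" for x y z
  proof -
    have "(\<Sum>i\<in>UNIV. g x i * (\<Sum>j\<in>UNIV. g y j * (\<Sum>k\<in>UNIV. g z k * (\<Sum>n\<in>UNIV. up3 h w n i j * Y n k))))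
      = (\<Sum>m\<in>UNIV. \<Sum>n\<in>UNIV. \<Sum>k\<in>UNIV. (h n m * g z k * Y n k) * (\<Sum>b\<in>UNIV. (\<Sum>i\<in>UNIV. g x i * h i b) * (\<Sum>c\<in>UNIV. (\<Sum>j\<in>UNIV. g y j * h j c) * w m b c)))"
      unfolding up3_def flatten_sums
      by (rule sum.reindex_bij_witness[of _ "\<lambda>(m,n,k,b,(c,j),i). (i,j,k,n,m,b,c)" "\<lambda>(i,j,k,n,m,b,c). (m,n,k,b,(c,j),i)"])
        (auto simp: mult_ac)
    moreover have "(\<Sum>i\<in>UNIV. g x i * (\<Sum>j\<in>UNIV. g y j * (\<Sum>k\<in>UNIV. g z k * (\<Sum>n\<in>UNIV. X i n * up3 h w n j k))))
      = (\<Sum>m\<in>UNIV. \<Sum>i\<in>UNIV. \<Sum>n\<in>UNIV. (g x i * h n m * X i n) * (\<Sum>b\<in>UNIV. (\<Sum>j\<in>UNIV. g y j * h j b) * (\<Sum>c\<in>UNIV. (\<Sum>k\<in>UNIV. g z k * h k c) * w m b c)))"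
      unfolding up3_def flatten_sums
      by (rule sum.reindex_bij_witness[of _ "\<lambda>(m,i,n,b,(c,k),j). (i,j,k,n,m,b,c)" "\<lambda>(i,j,k,n,m,b,c). (m,i,n,b,(c,k),j)"])
        (auto simp: mult_ac)
    ultimately have "(\<Sum>m\<in>UNIV. \<Sum>n\<in>UNIV. \<Sum>k\<in>UNIV. (h n m * g z k * Y n k) * w m x y)
        = (\<Sum>m\<in>UNIV. \<Sum>i\<in>UNIV. \<Sum>n\<in>UNIV. (g x i * h n m * X i n) * w m y z)"
      unfolding gh kd_sum eq[rule_format] by (rule trans[OF sym])
    then show ?thesis
      by (simp add: Y'_def X'_def sum_distrib_left sum_distrib_right mult_ac)
  qed
  then obtain y where y: "\<And>n k. Y' n k = y * kd n k"
    using w[unfolded simple_overlap_def, rule_format, of Y' X'] by blast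
  have "Y n k = y * kd n k" for n k
  proof -
    have "(\<Sum>m\<in>UNIV. \<Sum>z\<in>UNIV. g m n * h k z * Y' m z) = (\<Sum>n'\<in>UNIV. (\<Sum>m\<in>UNIV. h n' m * g m n) * (\<Sum>k'\<in>UNIV. (\<Sum>z\<in>UNIV. h k z * g z k') * Y n' k'))"
      unfolding Y'_def flatten_sums
      by (rule sum.reindex_bij_witness[of _ "\<lambda>(n',(k',z),m). (m,z,n',k')" "\<lambda>(m,z,n',k'). (n',(k',z),m)"]) (auto simp: mult_ac)
    also have "\<dots> = Y n k" by (simp add: hg)
    finally have "Y n k = (\<Sum>m\<in>UNIV. \<Sum>z\<in>UNIV. (g m n * h k z * y) * kd m z)"
      by (simp add: y mult.assoc del: kd_sum)
    also have "\<dots> = y * (\<Sum>m\<in>UNIV. h k m * g m n)"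
      by (simp only: kd_sum) (simp only: sum_distrib_left mult_ac)
    finally show ?thesis by (simp add: hg kd_sym)
  qed
  then show "\<exists>y. \<forall>n k. Y n k = y * kd n k" by blast
qed

text \<open>In terms of the quadratic algebra with relations \<open>w n _ _\<close>: no \<open>\<xi> \<otimes> \<xi>\<close> with \<open>\<xi> \<noteq> 0\<close> annihilates all relations.\<close>

definition no_singular_square :: "'a::comm_ring_1 tensor3 \<Rightarrow> bool" where
  "no_singular_square w \<longleftrightarrow> (\<forall>\<xi>. (\<forall>k. (\<Sum>i\<in>UNIV. \<Sum>j\<in>UNIV. w i j k * \<xi> i * \<xi> j) = 0) \<longrightarrow> (\<forall>i. \<xi> i = 0))"

lemma no_singular_square_up3:
  assumes gh: "\<And>i k. (\<Sum>j\<in>UNIV. g i j * h j k) = kd i k"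
    and hg: "\<And>i k. (\<Sum>j\<in>UNIV. h i j * g j k) = kd i k"
    and w: "no_singular_square w"
  shows "no_singular_square (up3 g w)"
  unfolding no_singular_square_def
proof (intro allI impI)
  fix \<xi> n
  assume eq: "\<forall>k. (\<Sum>i\<in>UNIV. \<Sum>j\<in>UNIV. up3 g w i j k * \<xi> i * \<xi> j) = 0"
  define \<eta> where "\<eta> a = (\<Sum>i\<in>UNIV. g i a * \<xi> i)" for a
  have "(\<Sum>i\<in>UNIV. \<Sum>j\<in>UNIV. w i j k * \<eta> i * \<eta> j) = 0" for k
  proof -
    have "(\<Sum>k'\<in>UNIV. h k k' * (\<Sum>i\<in>UNIV. \<Sum>j\<in>UNIV. up3 g w i j k' * \<xi> i * \<xi> j))
      = (\<Sum>c\<in>UNIV. (\<Sum>k'\<in>UNIV. h k k' * g k' c) * (\<Sum>a\<in>UNIV. \<Sum>b\<in>UNIV. w a b c * \<eta> a * \<eta> b))"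
      unfolding up3_def \<eta>_def flatten_sums
      by (rule sum.reindex_bij_witness[of _ "\<lambda>(c,(a,b,j,i),k). (k,i,j,a,b,c)" "\<lambda>(k,i,j,a,b,c). (c,(a,b,j,i),k)"])
        (auto simp: mult_ac)
    then show ?thesis using eq by (simp add: hg)
  qed
  then have "\<forall>a. \<eta> a = 0" using w unfolding no_singular_square_def by blast
  then show "\<xi> n = 0"
    using vec_transport_zero[of g h \<xi> n, OF gh] unfolding \<eta>_def by blast
qed

section \<open>The superpotential of the Sklyanin algebra\<close>

definition skl :: "'a::comm_ring_1 \<Rightarrow> 'a \<Rightarrow> 'a \<Rightarrow> 'a tensor3" where
  "skl a b c i j k = (if j = i \<and> k = i then c else if j = i + 1 \<and> k = i + 2 then a
     else if j = i + 2 \<and> k = i + 1 then b else 0)"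

lemma skl_cyc: "skl a b c i j k = skl a b c j k i"
proof -
  have "\<forall>i j k. skl a b c i j k = skl a b c j k i"
    by (simp add: forall_3' skl_def)
  then show ?thesis by blast
qed

text \<open>Both degenerations lie on the discriminant: the first because
  \<open>a^3 + b^3 - (a + b)^3 = - 3 * a * b * (a + b)\<close>, the second because both sides become
  \<open>27 * c^9\<close>.\<close>

lemma typeA_facts:
  fixes a b c :: "'a::field"
  assumes "skl_typeA_params a b c"
  shows "a \<noteq> 0" "b \<noteq> 0" "c \<noteq> 0" "c^3 + (a + b)^3 \<noteq> 0" "\<not> (a^3 = c^3 \<and> b^3 = c^3)"
proof -
  have *: "a \<noteq> 0" "b \<noteq> 0" "c \<noteq> 0" "(a^3 + b^3 + c^3)^3 \<noteq> 27 * a^3 * b^3 * c^3"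
    using assms by (auto simp: skl_typeA_params_def)
  show "a \<noteq> 0" "b \<noteq> 0" "c \<noteq> 0" using * by auto
  show "c^3 + (a + b)^3 \<noteq> 0"
  proof
    assume "c^3 + (a + b)^3 = 0"
    then have c3: "c^3 = - ((a + b)^3)" by (simp add: eq_neg_iff_add_eq_0)
    have "(a^3 + b^3 + c^3)^3 = 27 * a^3 * b^3 * c^3" unfolding c3 by algebra
    then show False using * by simp
  qed
  show "\<not> (a^3 = c^3 \<and> b^3 = c^3)"
  proof
    assume h: "a^3 = c^3 \<and> b^3 = c^3"
    have "(a^3 + b^3 + c^3)^3 = 27 * a^3 * b^3 * c^3" using h by algebra
    then show False using * by simp
  qed
qed

lemma no_rank_one_skl:
  fixes a b c :: "'a::field"
  assumes "skl_typeA_params a b c"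
  shows "no_rank_one (skl a b c)"
  unfolding no_rank_one_def
proof (intro allI impI)
  fix \<xi> u z n
  note nz = typeA_facts[OF assms]
  assume "\<forall>j d. (\<Sum>m\<in>UNIV. skl a b c m j d * \<xi> m) = u j * z d"
  then have e: "c * \<xi> 0 = u 0 * z 0" "a * \<xi> 2 = u 0 * z 1" "b * \<xi> 1 = u 0 * z 2"
    "b * \<xi> 2 = u 1 * z 0" "c * \<xi> 1 = u 1 * z 1" "a * \<xi> 0 = u 1 * z 2"
    "a * \<xi> 1 = u 2 * z 0" "b * \<xi> 0 = u 2 * z 1" "c * \<xi> 2 = u 2 * z 2"
    by (simp_all add: forall_3' sum_3' skl_def)
  \<comment> \<open>These are 2 by 2 minors of a matrix of rank at most one. By the first three, one
    vanishing coordinate makes all vanish; the last two compare the cubes of \<open>a\<close>,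
    \<open>b\<close>, \<open>c\<close> when no coordinate vanishes.\<close>
  have m: "c^2 * (\<xi> 0 * \<xi> 1) = a * b * \<xi> 2 ^ 2" "c^2 * (\<xi> 0 * \<xi> 2) = a * b * \<xi> 1 ^ 2" "c^2 * (\<xi> 1 * \<xi> 2) = a * b * \<xi> 0 ^ 2"
    "a^2 * (\<xi> 0 * \<xi> 2) = b * c * \<xi> 1 ^ 2" "b^2 * (\<xi> 0 * \<xi> 2) = a * c * \<xi> 1 ^ 2"
    using e by algebra+
  have "\<xi> 0 = 0 \<and> \<xi> 1 = 0 \<and> \<xi> 2 = 0"
  proof (cases "\<xi> 0 = 0 \<or> \<xi> 1 = 0 \<or> \<xi> 2 = 0")
    case True
    then show ?thesis using m(1-3) nz(1-3) by auto
  next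
    case False
    have "(a^3 - c^3) * (\<xi> 0 * \<xi> 2) = 0"  "(b^3 - c^3) * (\<xi> 0 * \<xi> 2) = 0"
    proof -
      have "a * b * (a^2 * (\<xi> 0 * \<xi> 2)) = b * c * (c^2 * (\<xi> 0 * \<xi> 2))"
        using m(2,4) by algebra
      then have "b * ((a^3 - c^3) * (\<xi> 0 * \<xi> 2)) = 0" by algebra
      then show "(a^3 - c^3) * (\<xi> 0 * \<xi> 2) = 0" using nz(2) by simp
      have "a * b * (b^2 * (\<xi> 0 * \<xi> 2)) = a * c * (c^2 * (\<xi> 0 * \<xi> 2))"
        using m(2,5) by algebra
      then have "a * ((b^3 - c^3) * (\<xi> 0 * \<xi> 2)) = 0" by algebra
      then show "(b^3 - c^3) * (\<xi> 0 * \<xi> 2) = 0" using nz(1) by simp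
    qed
    then show ?thesis using False nz(5) by simp
  qed
  then have "\<forall>n. \<xi> n = 0" by (simp add: forall_3')
  then show "\<xi> n = 0" by blast
qed

lemma no_singular_square_skl:
  fixes a b c :: "'a::field"
  assumes "skl_typeA_params a b c"
  shows "no_singular_square (skl a b c)"
  unfolding no_singular_square_def
proof (intro allI impI)
  fix \<xi> n
  note nz = typeA_facts[OF assms]
  assume "\<forall>k. (\<Sum>i\<in>UNIV. \<Sum>j\<in>UNIV. skl a b c i j k * \<xi> i * \<xi> j) = 0"
  then have e: "c * \<xi> 0 ^ 2 + (a + b) * (\<xi> 1 * \<xi> 2) = 0" "c * \<xi> 1 ^ 2 + (a + b) * (\<xi> 0 * \<xi> 2) = 0" "c * \<xi> 2 ^ 2 + (a + b) * (\<xi> 0 * \<xi> 1) = 0"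
    by (simp_all add: forall_3' sum_3' skl_def power2_eq_square algebra_simps)
  \<comment> \<open>Multiplied by its own coordinate, each equation reads
    \<open>c * \<xi> i ^ 3 = - (a + b) * P\<close>; the product of the three is an equation for
    \<open>P^3\<close>.\<close>
  define P where "P = \<xi> 0 * \<xi> 1 * \<xi> 2"
  have "(c^3 + (a + b)^3) * P^3 = 0"
  proof -
    have "c * \<xi> 0 ^ 3 = - (a + b) * P" "c * \<xi> 1 ^ 3 = - (a + b) * P" "c * \<xi> 2 ^ 3 = - (a + b) * P"
      using e unfolding P_def by algebra+
    then have "(c * \<xi> 0 ^ 3) * (c * \<xi> 1 ^ 3) * (c * \<xi> 2 ^ 3) = (- (a + b) * P) ^ 3"
      by (simp add: power3_eq_cube)
    then show ?thesis unfolding P_def by algebra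
  qed
  then have "P = 0" using nz(4) by simp
  then have "\<xi> 0 = 0 \<and> \<xi> 1 = 0 \<and> \<xi> 2 = 0" using e nz(3) unfolding P_def by auto
  then have "\<forall>n. \<xi> n = 0" by (simp add: forall_3')
  then show "\<xi> n = 0" by blast
qed

lemma simple_overlap_skl:
  fixes a b c :: "'a::field"
  assumes "skl_typeA_params a b c"
  shows "simple_overlap (skl a b c)"
  unfolding simple_overlap_def
proof (intro allI impI)
  fix X Y
  note nz = typeA_facts[OF assms]
  assume eq: "\<forall>i j k. (\<Sum>n\<in>UNIV. skl a b c n i j * Y n k) = (\<Sum>n\<in>UNIV. X i n * skl a b c n j k)"
  \<comment> \<open>Comparing coefficients respects the grading by index differences modulo 3:
    entries \<open>Y n (n + 1)\<close> meet only \<open>X i (i + 2)\<close>, and entries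
    \<open>Y n (n + 2)\<close> only \<open>X i (i + 1)\<close>. These are the two systems; a nonzero
    entry would make the cubes of \<open>a\<close>, \<open>b\<close>, \<open>c\<close>
    equal.\<close>
  have cancel: False if "y \<noteq> 0" "c * y = x1 * a" "a * y = x2 * b" "b * y = x3 * c" "c * y' = x2 * a" "a * y' = x3 * b" "b * y' = x1 * c" for y y' x1 x2 x3
  proof -
    have "(a^3 - b^3) * (c * y) = 0" "(a^3 - c^3) * (c * y) = 0"
      using that(2-) by algebra+
    then show False using that(1) nz(3,5) by simp
  qed
  have cancel': False if "y \<noteq> 0" "c * y = x1 * b" "b * y = x2 * a" "a * y = x3 * c" "c * y' = x2 * b" "b * y' = x3 * a" "a * y' = x1 * c" for y y' x1 x2 x3
  proof -
    have "(a^3 - b^3) * (c * y) = 0" "(b^3 - c^3) * (c * y) = 0"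
      using that(2-) by algebra+
    then show False using that(1) nz(3,5) by simp
  qed
  have d: "Y 1 1 = Y 0 0" "Y 2 2 = Y 0 0"
    using eq nz(1-3) by (auto simp: forall_3' sum_3' skl_def)
  note E = eq[unfolded forall_3' sum_3' skl_def, simplified]
  have "Y 0 1 = 0" by (rule ccontr, rule cancel[of "Y 0 1" "X 0 2" "X 1 0" "X 2 1" "Y 1 2"]) (use E in blast)+
  moreover have "Y 1 2 = 0" by (rule ccontr, rule cancel[of "Y 1 2" "X 1 0" "X 2 1" "X 0 2" "Y 2 0"]) (use E in blast)+
  moreover have "Y 2 0 = 0" by (rule ccontr, rule cancel[of "Y 2 0" "X 2 1" "X 0 2" "X 1 0" "Y 0 1"]) (use E in blast)+
  moreover have "Y 0 2 = 0" by (rule ccontr, rule cancel'[of "Y 0 2" "X 0 1" "X 2 0" "X 1 2" "Y 2 1"]) (use E in blast)+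
  moreover have "Y 2 1 = 0" by (rule ccontr, rule cancel'[of "Y 2 1" "X 2 0" "X 1 2" "X 0 1" "Y 1 0"]) (use E in blast)+
  moreover have "Y 1 0 = 0" by (rule ccontr, rule cancel'[of "Y 1 0" "X 1 2" "X 0 1" "X 2 0" "Y 0 2"]) (use E in blast)+
  ultimately have "\<forall>n k. Y n k = Y 0 0 * kd n k"
    using d by (simp add: forall_3' kd_def)
  then show "\<exists>y. \<forall>n k. Y n k = y * kd n k" by blast
qed

text \<open>The first two equations give \<open>h\<^sup>2 = 4 * g1 * g2\<close> for \<open>h = g1 + g2 - g0\<close>; this makes the quadric left after
  eliminating \<open>C\<close> a perfect square, and everything is then rational in \<open>k = h / (2 * g2)\<close>.\<close>

lemma hesse_point:
  fixes A B C :: "'a::field" and g0 g1 g2 :: 'a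
  assumes two: "(2::'a) \<noteq> 0" and nz: "A \<noteq> 0" "B \<noteq> 0" "C \<noteq> 0"
    and s: "g0 + g1 + g2 = -2" and e: "g0 * g1 + g1 * g2 + g2 * g0 = 1"
    and G1: "g2 * g0 * A + g0 * g1 * B + g1 * g2 * C = 0"
    and G2: "g0^2 * A * B + g1^2 * B * C + g2^2 * C * A = 0"
  shows "(A + B + C)^3 = 27 * A * B * C"
proof -
  have four: "(4::'a) \<noteq> 0" using two mult_eq_0_iff[of "2::'a" 2] by simp
  have g: "g0 \<noteq> 0" "g1 \<noteq> 0" "g2 \<noteq> 0" using e G1 nz by auto
  define h where "h = g1 + g2 - g0"
  have h2: "h^2 = 4 * g1 * g2" using s e unfolding h_def by algebra
  have "g0 * (g2^3 * A^2 + g1^3 * B^2 + g1 * g2 * h * A * B) = 0"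
    using G1 G2 unfolding h_def by algebra
  then have Q: "g2^3 * A^2 + g1^3 * B^2 + g1 * g2 * h * A * B = 0" using g by simp
  have "g2 * (2 * g2^2 * A + g1 * h * B)^2 = 0" using Q h2 by algebra
  then have A: "2 * g2^2 * A = - g1 * h * B" using g by (simp add: eq_neg_iff_add_eq_0)
  define k where "k = h / (2 * g2)"
  have hk: "h = 2 * g2 * k" using g two by (simp add: k_def)
  have "4 * (g2 * (g1 - k^2 * g2)) = 0" using h2 unfolding hk by algebra
  then have g1: "g1 = k^2 * g2" using g four by simp
  have k0: "k \<noteq> 0" using g g1 by auto
  have g0: "g0 = (1 - k)^2 * g2" using hk unfolding h_def g1 by algebra
  have "2 * g2^2 * (A + k^3 * B) = 0" using A unfolding hk g1 by algebra
  then have A': "A = - (k^3) * B" using g two by (simp add: eq_neg_iff_add_eq_0)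
  have "k^2 * g2^2 * (C + (1 - k)^3 * B) = 0" using G1 unfolding A' g1 g0 by algebra
  then have C': "C = - ((1 - k)^3) * B" using g k0 by (simp add: eq_neg_iff_add_eq_0)
  \<comment> \<open>\<open>A\<close>, \<open>B\<close>, \<open>C\<close> are now \<open>B\<close>
    times the cubes of \<open>- k\<close>, \<open>1\<close>, \<open>k - 1\<close>. These three sum
    to zero, so the sum of their cubes is three times their product.\<close>
  show ?thesis unfolding A' C' by algebra
qed

section \<open>Diagonal twists\<close>

lemma (in web) rot_diag:
  assumes "\<And>i j. M i j = \<mu> i * kd i j"
  shows "\<Phi> m l j = \<mu> j * \<Phi> l j m"
proof -
  have "\<Phi> m l j = (\<Sum>i\<in>UNIV. kd i j * (\<mu> i * \<Phi> l i m))"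
    by (subst rot) (simp only: assms mult_ac)
  then show ?thesis by simp
qed

lemma (in web) w_inv_diag:
  assumes "\<And>i j. M i j = \<mu> i * kd i j"
  shows "w i j k = \<mu> i * \<mu> j * \<mu> k * w i j k"
proof -
  have "w i j k = (\<Sum>a\<in>UNIV. \<Sum>b\<in>UNIV. \<Sum>c\<in>UNIV. M i a * M j b * M k c * w a b c)"
    by (rule w_inv[symmetric])
  also have "\<dots> = (\<Sum>a\<in>UNIV. kd i a * (\<Sum>b\<in>UNIV. kd j b * (\<Sum>c\<in>UNIV. kd k c * (\<mu> i * \<mu> j * \<mu> k * w a b c))))"
    unfolding assms by (simp add: sum_distrib_left mult_ac del: kd_sum)
  finally show ?thesis by simp
qed

text \<open>A diagonal twist gives the indices weights. Invariance multiplies \<open>w i j k\<close>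
  by the product of its weights, and so do three rotations for \<open>\<Phi> i j k\<close>.\<close>

lemma (in web) support_diag:
  assumes M: "\<And>i j. M i j = \<mu> i * kd i j" and "\<mu> i * \<mu> j * \<mu> k \<noteq> 1"
  shows "w i j k = 0" "\<Phi> i j k = 0"
proof -
  show "w i j k = 0" using w_inv_diag[OF M, of i j k] assms(2) by (metis mult_cancel_right1)
  have "\<Phi> i j k = \<mu> i * \<mu> j * \<mu> k * \<Phi> i j k"
    using rot_diag[OF M, of i j k] rot_diag[OF M, of j k i] rot_diag[OF M, of k i j] by (metis mult.assoc mult.commute)
  then show "\<Phi> i j k = 0" using assms(2) by (metis mult_cancel_right1)
qed

text \<open>The conditions on \<open>\<mu>\<close> make the eigenvalues the three cube roots of
  unity, so \<open>w\<close> and \<open>\<Phi>\<close> live on triples with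
  \<open>i + j + k = 0\<close> modulo 3.\<close>

lemma web_clock_False:
  fixes w :: "'a::field tensor3"
  assumes "web w \<Phi> M q" and M: "\<And>i j. M i j = \<mu> i * kd i j"
    and \<mu>: "\<mu> 0 = 1" "\<mu> 1 * \<mu> 1 = \<mu> 2" "\<mu> 2 * \<mu> 2 = \<mu> 1" "\<mu> 1 * \<mu> 2 = 1" "\<mu> 1 \<noteq> 1"
    and ns: "no_singular_square w"
  shows False
proof -
  interpret web w \<Phi> M q by fact
  note r = rot_diag[OF M]
  have \<mu>2: "\<mu> 2 \<noteq> 1" "\<mu> 2 * \<mu> 1 = 1" "\<mu> 1 \<noteq> 0" "\<mu> 2 \<noteq> 0" using \<mu> by (auto simp: mult.commute)
  have ne: "\<mu> i * \<mu> j * \<mu> k \<noteq> 1" if "i + j + k \<noteq> 0" for i j k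
  proof -
    have "\<forall>i j k. i + j + k \<noteq> 0 \<longrightarrow> \<mu> i * \<mu> j * \<mu> k \<noteq> 1"
      by (simp add: forall_3' \<mu> \<mu>2 mult.assoc)
    then show ?thesis using that by blast
  qed
  have wz: "w 0 0 1 = 0" "w 0 0 2 = 0" "w 0 1 0 = 0" "w 0 1 1 = 0" "w 0 2 0 = 0" "w 0 2 2 = 0" "w 1 0 0 = 0" "w 1 0 1 = 0" "w 1 1 0 = 0" "w 1 1 2 = 0" "w 1 2 1 = 0" "w 1 2 2 = 0" "w 2 0 0 = 0" "w 2 0 2 = 0" "w 2 1 1 = 0" "w 2 1 2 = 0" "w 2 2 0 = 0" "w 2 2 1 = 0"
    by (simp_all add: support_diag(1)[OF M ne])
  have \<Phi>z: "\<Phi> 0 0 1 = 0" "\<Phi> 0 0 2 = 0" "\<Phi> 0 1 0 = 0" "\<Phi> 0 1 1 = 0" "\<Phi> 0 2 0 = 0" "\<Phi> 0 2 2 = 0" "\<Phi> 1 0 0 = 0" "\<Phi> 1 0 1 = 0" "\<Phi> 1 1 0 = 0" "\<Phi> 1 1 2 = 0" "\<Phi> 1 2 1 = 0" "\<Phi> 1 2 2 = 0" "\<Phi> 2 0 0 = 0" "\<Phi> 2 0 2 = 0" "\<Phi> 2 1 1 = 0" "\<Phi> 2 1 2 = 0" "\<Phi> 2 2 0 = 0" "\<Phi> 2 2 1 = 0"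
    by (simp_all add: support_diag(2)[OF M ne])
  have \<Phi>0: "\<Phi> 1 1 1 = 0" "\<Phi> 2 2 2 = 0"
    using r[of 1 1 1] r[of 2 2 2] \<mu>(5) \<mu>2(1) by (metis mult_cancel_right1)+
  \<comment> \<open>Tested on a basis vector, \<open>no_singular_square\<close> gives some
    \<open>w i i k \<noteq> 0\<close>, and the support leaves only \<open>k = i\<close>.\<close>
  have "w 0 0 0 \<noteq> 0" "w 1 1 1 \<noteq> 0"
  proof -
    have "\<exists>k. w i i k \<noteq> 0" for i
    proof (rule ccontr)
      assume "\<not> (\<exists>k. w i i k \<noteq> 0)"
      then have "\<forall>k. (\<Sum>a\<in>UNIV. \<Sum>b\<in>UNIV. w a b k * kd i a * kd i b) = 0" by simp
      then have "kd i i = (0::'a)" using ns unfolding no_singular_square_def by blast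
      then show False by simp
    qed
    from this[of 0] this[of 1] have "\<not> (\<forall>k. w 0 0 k = 0)" "\<not> (\<forall>k. w 1 1 k = 0)" by auto
    then show "w 0 0 0 \<noteq> 0" "w 1 1 1 \<noteq> 0" by (simp_all add: forall_3' wz)
  qed
  \<comment> \<open>In this square one term survives and the value is 0. The next square has value
    \<open>q\<close>, which forces the \<open>\<Phi>\<close>-factors occurring here to be
    nonzero.\<close>
  moreover have "w 1 1 1 * \<Phi> 2 0 1 * (w 0 0 0 * \<Phi> 1 0 2) = 0"
    using square[of 2 1 0 2] by (simp add: sum_3' Cw_def Bw_def wz \<Phi>z \<Phi>0 kd_def)
  moreover have "\<Phi> 2 0 1 \<noteq> 0" "\<Phi> 2 1 0 \<noteq> 0"
    using square[of 2 1 2 1] q0 by (auto simp add: sum_3' Cw_def Bw_def wz \<Phi>z \<Phi>0 kd_def)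
  moreover have "\<Phi> 2 1 0 = \<Phi> 1 0 2" using r[of 2 1 0] \<mu>(1) by simp
  ultimately show False by simp
qed

text \<open>The trace gives \<open>(1 + q)^2 = 2 * q\<close>. In the normalised basis squares kill
  further entries, and two diagonal bigons multiply to \<open>(1 + q)^2 = 4 * q\<close>.\<close>

lemma web_reflection_False:
  fixes w :: "'a::field tensor3"
  assumes "web w \<Phi> M q" and M: "\<And>i j. M i j = \<mu> i * kd i j"
    and \<mu>: "\<mu> 0 = 1" "\<mu> 1 = 1" "\<mu> 2 = -1"
    and w220: "w 2 2 0 = 0" and \<Phi>220: "\<Phi> 2 2 0 = 0" and two: "(2::'a) \<noteq> 0"
  shows False
proof -
  interpret web w \<Phi> M q by fact
  note r = rot_diag[OF M]
  have q2: "(1 + q)^2 = 2 * q"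
  proof -
    have "(\<Sum>i\<in>UNIV. M i i) = 1" by (simp add: sum_3' M \<mu>)
    then show ?thesis using trace_M by simp
  qed
  have m1: "-1 \<noteq> (1::'a)" using two by (metis add.right_inverse one_add_one)
  \<comment> \<open>The condition says that an odd number of the three indices equals 2.\<close>
  have ne: "\<mu> i * \<mu> j * \<mu> k \<noteq> 1" if "(i = 2) \<noteq> ((j = 2) \<noteq> (k = 2))" for i j k
  proof -
    have "\<forall>i j k. (i = 2) \<noteq> ((j = 2) \<noteq> (k = 2)) \<longrightarrow> \<mu> i * \<mu> j * \<mu> k \<noteq> 1"
      by (simp add: forall_3' \<mu> m1)
    then show ?thesis using that by blast
  qed
  have wz: "w 0 0 2 = 0" "w 0 1 2 = 0" "w 0 2 0 = 0" "w 0 2 1 = 0" "w 1 0 2 = 0" "w 1 1 2 = 0" "w 1 2 0 = 0" "w 1 2 1 = 0" "w 2 0 0 = 0" "w 2 0 1 = 0" "w 2 1 0 = 0" "w 2 1 1 = 0" "w 2 2 2 = 0"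
    by (simp_all add: support_diag(1)[OF M ne])
  have \<Phi>z: "\<Phi> 0 0 2 = 0" "\<Phi> 0 1 2 = 0" "\<Phi> 0 2 0 = 0" "\<Phi> 0 2 1 = 0" "\<Phi> 1 0 2 = 0" "\<Phi> 1 1 2 = 0" "\<Phi> 1 2 0 = 0" "\<Phi> 1 2 1 = 0" "\<Phi> 2 0 0 = 0" "\<Phi> 2 0 1 = 0" "\<Phi> 2 1 0 = 0" "\<Phi> 2 1 1 = 0" "\<Phi> 2 2 2 = 0"
    by (simp_all add: support_diag(2)[OF M ne])
  have wc: "w 0 1 0 = w 0 0 1" "w 1 0 0 = w 0 0 1" "w 1 0 1 = w 0 1 1" "w 1 1 0 = w 0 1 1" "w 2 0 2 = 0" "w 2 1 2 = w 1 2 2" "w 2 2 1 = w 1 2 2" "w 0 2 2 = 0"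
    using cyc w220 by metis+
  have \<Phi>c: "\<Phi> 0 1 0 = \<Phi> 0 0 1" "\<Phi> 1 0 0 = \<Phi> 0 0 1" "\<Phi> 1 0 1 = \<Phi> 0 1 1" "\<Phi> 1 1 0 = \<Phi> 0 1 1"
     "\<Phi> 2 0 2 = 0" "\<Phi> 0 2 2 = 0" "\<Phi> 2 1 2 = \<Phi> 2 2 1" "\<Phi> 1 2 2 = - \<Phi> 2 2 1"
    using r[of 0 1 0] r[of 1 0 0] r[of 1 0 1] r[of 1 1 0] r[of 2 0 2] r[of 0 2 2] r[of 2 1 2] r[of 1 2 2] r[of 2 2 1] r[of 2 2 0] \<Phi>220
    by (simp_all add: \<mu>)
  note all = sum_3' Cw_def Bw_def wz \<Phi>z wc \<Phi>c w220 \<Phi>220 kd_def M \<mu>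
  have \<tau>: "2 * w 1 2 2 * \<Phi> 2 2 1 = - (1 + q)"
    using bigon[of 2 2] by (simp add: all algebra_simps)
  have \<tau>0: "1 + q \<noteq> 0" using q2 q0 two by auto
  have e1: "w 1 2 2 \<noteq> 0" "\<Phi> 2 2 1 \<noteq> 0" using \<tau> \<tau>0 by auto
  have u2: "w 0 1 1 = 0"
    using square[of 2 1 0 2] e1 by (simp add: all)
  have c0: "\<Phi> 0 1 1 = 0"
    using square[of 1 2 2 0] e1 by (simp add: all u2)
  have b: "\<Phi> 0 0 1 * \<Phi> 2 2 1 * w 0 0 1 * w 1 2 2 = q"
    using square[of 2 2 0 0] by (simp add: all u2 c0 mult_ac)
  then have "w 0 0 1 \<noteq> 0" using q0 by auto
  then have a0: "\<Phi> 0 0 0 = 0"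
    using bigon[of 1 0] by (simp add: all u2 c0)
  have "2 * \<Phi> 0 0 1 * w 0 0 1 = - (1 + q)"
    using bigon[of 0 0] by (simp add: all u2 c0 a0 algebra_simps)
  with \<tau> b have "(1 + q)^2 = 2 * q + 2 * q" by algebra
  with q2 have "2 * q + 2 * q = 2 * q + 0" by (simp only: add_0_right)
  then have "2 * q = 0" by (rule add_left_imp_eq)
  then show False using q0 two by simp
qed

text \<open>The trace forces \<open>q = 1\<close>. The off-diagonal bigons form two cyclic linear
  systems with determinant \<open>c^3 + (a + b)^3\<close>, so \<open>\<Phi>\<close> has the support
  of a Sklyanin tensor, with coefficients \<open>\<alpha>\<close>, \<open>\<beta>\<close>,
  \<open>\<gamma>\<close>. A diagonal bigon and three squares are then the hypotheses of
  \<open>hesse_point\<close> for \<open>c * \<gamma>\<close>, \<open>a * \<alpha>\<close>,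
  \<open>b * \<beta>\<close>.\<close>

lemma web_identity_False:
  fixes a b c :: "'a::field"
  assumes tA: "skl_typeA_params a b c" and "web (skl a b c) \<Phi> kd q" and two: "(2::'a) \<noteq> 0"
  shows False
proof -
  interpret web "skl a b c" \<Phi> kd q by fact
  note nz = typeA_facts[OF tA]
  have r: "\<Phi> m l j = \<Phi> l j m" for m l j by (subst rot) simp
  have q1: "q = 1"
  proof -
    have "(1 + q)^2 = q * (1 + 3)" using trace_M by (simp add: sum_3')
    then have "(q - 1)^2 = 0" by algebra
    then show ?thesis by simp
  qed
  note S = sum_3' skl_def
  have P: "c * \<Phi> j j i + (a + b) * \<Phi> i i k = 0" if "(j, i, k) \<in> {(0,1,2),(1,2,0),(2,0,1),(1,0,2),(0,2,1),(2,1,0)}" for i j k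
  proof -
    have "(\<Sum>k\<in>UNIV. \<Sum>l\<in>UNIV. skl a b c j k l * \<Phi> i k l) = 0"
      using that bigon[of j i] by (auto simp: kd_def)
    then show ?thesis
      using that r[of 0 1 1] r[of 1 0 1] r[of 0 2 2] r[of 2 0 2] r[of 1 2 2] r[of 2 1 2] r[of 0 0 1] r[of 0 1 0] r[of 0 0 2] r[of 0 2 0]
        r[of 1 1 0] r[of 1 1 2] r[of 1 2 1] r[of 2 2 0] r[of 2 2 1]
      by (elim insertE emptyE) (simp_all add: S algebra_simps)
  qed
  have Z: "x = 0" if "c * x + (a + b) * y = 0" "c * y + (a + b) * z = 0" "c * z + (a + b) * x = 0" for x y z
  proof -
    have "(c^3 + (a + b)^3) * x = 0" using that by algebra
    then show ?thesis using nz(4) by simp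
  qed
  have z: "\<Phi> 0 0 1 = 0" "\<Phi> 1 1 2 = 0" "\<Phi> 2 2 0 = 0" "\<Phi> 1 1 0 = 0" "\<Phi> 0 0 2 = 0" "\<Phi> 2 2 1 = 0"
    using Z[OF P[of 0 1 2] P[of 1 2 0] P[of 2 0 1]] Z[OF P[of 1 2 0] P[of 2 0 1] P[of 0 1 2]] Z[OF P[of 2 0 1] P[of 0 1 2] P[of 1 2 0]]
      Z[OF P[of 1 0 2] P[of 0 2 1] P[of 2 1 0]] Z[OF P[of 0 2 1] P[of 2 1 0] P[of 1 0 2]] Z[OF P[of 2 1 0] P[of 1 0 2] P[of 0 2 1]]
    by simp_all
  have z': "\<Phi> 0 1 0 = 0" "\<Phi> 1 0 0 = 0" "\<Phi> 1 2 1 = 0" "\<Phi> 2 1 1 = 0" "\<Phi> 2 0 2 = 0" "\<Phi> 0 2 2 = 0"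
     "\<Phi> 1 0 1 = 0" "\<Phi> 0 1 1 = 0" "\<Phi> 0 2 0 = 0" "\<Phi> 2 0 0 = 0" "\<Phi> 2 1 2 = 0" "\<Phi> 1 2 2 = 0"
    using z r by metis+
  define \<alpha> \<beta> \<gamma> where "\<alpha> = \<Phi> 0 1 2" "\<beta> = \<Phi> 0 2 1" "\<gamma> = \<Phi> 0 0 0"
  have ab: "\<Phi> 0 1 2 = \<alpha>" "\<Phi> 1 2 0 = \<alpha>" "\<Phi> 2 0 1 = \<alpha>" "\<Phi> 0 2 1 = \<beta>" "\<Phi> 2 1 0 = \<beta>" "\<Phi> 1 0 2 = \<beta>" "\<Phi> 0 0 0 = \<gamma>"
    using r unfolding \<alpha>_\<beta>_\<gamma>_def by metis+
  have s0: "c * \<gamma> + a * \<alpha> + b * \<beta> = - 2"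
    using bigon[of 0 0] by (simp add: S ab q1 algebra_simps)
  have "c * \<Phi> 1 1 1 + a * \<alpha> + b * \<beta> = - 2" "c * \<Phi> 2 2 2 + a * \<alpha> + b * \<beta> = - 2"
    using bigon[of 1 1] bigon[of 2 2] by (simp_all add: S ab q1 algebra_simps)
  then have "c * \<Phi> 1 1 1 = c * \<gamma>" "c * \<Phi> 2 2 2 = c * \<gamma>" using s0 by algebra+
  then have g: "\<Phi> 1 1 1 = \<gamma>" "\<Phi> 2 2 2 = \<gamma>" using nz(3) by simp_all
  note all = S Cw_def Bw_def ab g z z' q1 kd_def
  have e2: "c * \<gamma> * (a * \<alpha>) + a * \<alpha> * (b * \<beta>) + b * \<beta> * (c * \<gamma>) = 1"
    using square[of 0 2 0 2] by (simp add: all algebra_simps)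
  have G1: "\<alpha> * \<gamma> * b^2 + \<alpha> * \<beta> * c^2 + \<beta> * \<gamma> * a^2 = 0"
    using square[of 0 2 1 0] by (simp add: all algebra_simps power2_eq_square)
  have G2: "\<gamma>^2 * a * b + \<alpha>^2 * b * c + \<beta>^2 * c * a = 0"
    using square[of 0 2 2 1] by (simp add: all algebra_simps power2_eq_square)
  have "(a^3 + b^3 + c^3)^3 = 27 * a^3 * b^3 * c^3"
  proof (rule hesse_point[where ?g0.0 = "c * \<gamma>" and ?g1.0 = "a * \<alpha>" and ?g2.0 = "b * \<beta>", OF two])
    show "a^3 \<noteq> 0" "b^3 \<noteq> 0" "c^3 \<noteq> 0" using nz by auto
    show "c * \<gamma> + a * \<alpha> + b * \<beta> = - 2" by (rule s0)
    show "c * \<gamma> * (a * \<alpha>) + a * \<alpha> * (b * \<beta>) + b * \<beta> * (c * \<gamma>) = 1" by (rule e2)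
    show "b * \<beta> * (c * \<gamma>) * a^3 + c * \<gamma> * (a * \<alpha>) * b^3 + a * \<alpha> * (b * \<beta>) * c^3 = 0"
      using G1 by algebra
    show "(c * \<gamma>)^2 * a^3 * b^3 + (a * \<alpha>)^2 * b^3 * c^3 + (b * \<beta>)^2 * c^3 * a^3 = 0"
      using G2 by algebra
  qed
  then show False using tA by (simp add: skl_typeA_params_def)
qed

section \<open>The twist is monomial\<close>

text \<open>Here \<open>b = a\<close>, and \<open>M\<close> has the rows
  \<open>(p0, p1, p2)\<close>, \<open>\<kappa>\<close> times
  \<open>(p0, \<omega> * p1, \<omega>^2 * p2)\<close> and \<open>\<kappa>'\<close> times
  \<open>(p0, \<omega>^2 * p1, \<omega> * p2)\<close>. Hypotheses \<open>i\<close> and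
  \<open>ii\<close> are the invariance of the coefficients \<open>c\<close> and \<open>a\<close> of
  \<open>w\<close>, and \<open>tr\<close> equates the traces of \<open>M\<close> and its
  inverse.\<close>

lemma fourier_False:
  fixes a c n p0 p1 p2 \<kappa> \<kappa>' \<omega> :: "'a::field"
  assumes \<omega>: "\<omega>^2 + \<omega> + 1 = 0" and \<kappa>: "\<kappa>^3 = 1" "\<kappa>'^3 = 1"
    and two: "(2::'a) \<noteq> 0" and three: "(3::'a) \<noteq> 0"
    and p: "p0^3 = n" "p1^3 = n" "p2^3 = n" "n \<noteq> 0"
    and i: "3 * n * c + 6 * a * (p0 * p1 * p2) = c"
    and ii: "3 * \<kappa> * \<kappa>' * (n * c - a * (p0 * p1 * p2)) = a"
    and tr: "3 * n * (p0 + \<kappa> * \<omega> * p1 + \<kappa>' * \<omega> * p2) = p0^2 + (\<kappa> * \<omega> * p1)^2 + (\<kappa>' * \<omega> * p2)^2"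
    and nz: "a \<noteq> 0" "c \<noteq> 0" "c^3 + 8 * a^3 \<noteq> 0" "c^3 \<noteq> a^3"
  shows False
proof -
  define P where "P = p0 * p1 * p2"
  define k where "k = \<kappa> * \<kappa>'"
  define Z where "Z = k * P"
  have k3: "k^3 = 1" unfolding k_def using \<kappa> by (simp add: power_mult_distrib)
  have Z3: "Z^3 = n^3" unfolding Z_def P_def power_mult_distrib k3 p by (simp add: power3_eq_cube)
  have w3: "\<omega>^3 = 1" using \<omega> by algebra
  have w1: "\<omega> \<noteq> 1" using \<omega> three by auto
  have 1: "c * (1 - 3 * n) = 6 * a * P"
  proof -
    have "6 * a * P = c - 3 * n * c" using i unfolding P_def by (simp add: eq_diff_eq add.commute)
    then show ?thesis by (simp add: algebra_simps)
  qed
  have 2: "a * (1 + 3 * Z) = 3 * k * n * c"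
  proof -
    have "a = 3 * k * n * c - 3 * k * (a * P)" using ii unfolding P_def k_def by (simp add: algebra_simps)
    then have "a + 3 * k * (a * P) = 3 * k * n * c" by (simp add: eq_diff_eq)
    then show ?thesis unfolding Z_def by (simp add: algebra_simps)
  qed
  \<comment> \<open>The product of 1 and 2 eliminates the ratio of \<open>a\<close> to
    \<open>c\<close>. Since \<open>Z^3 = n^3\<close>, the remaining unknown \<open>Z\<close> is
    \<open>n\<close> times a cube root of unity.\<close>
  have "a * c * ((1 - 3 * n) * (1 + 3 * Z) - 18 * n * Z) = 0" using 1 2 unfolding Z_def by algebra
  then have 3: "(1 - 3 * n) * (1 + 3 * Z) = 18 * n * Z" using nz by simp
  have "(Z - n) * (Z^2 + n * Z + n^2) = 0" using Z3 by algebra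
  then consider (eq) "Z = n" | (ne) "Z^2 + n * Z + n^2 = 0" by auto
  then show False
  proof cases
    case eq
    have n27: "27 * n^2 = 1" using 3 unfolding eq by algebra
    \<comment> \<open>\<open>p0\<close>, \<open>y1\<close>, \<open>y2\<close> is the diagonal of
      \<open>M\<close>: three cube roots of \<open>n\<close> with product
      \<open>\<omega>^2 * n\<close>. In each of the three resulting cases two of them coincide, and
      \<open>tr\<close> yields \<open>3 * n = \<zeta> * p0\<close> with
      \<open>\<zeta>^3 = -1\<close>, hence \<open>27 * n^2 = -1\<close> against
      \<open>n27\<close>.\<close>
    define y1 y2 where "y1 = \<kappa> * \<omega> * p1" "y2 = \<kappa>' * \<omega> * p2"
    have y: "y1^3 = n" "y2^3 = n" unfolding y1_y2_def using \<kappa> w3 p by (simp_all add: power_mult_distrib)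
    have prod: "p0 * y1 * y2 = \<omega>^2 * n"
      unfolding y1_y2_def eq[symmetric] Z_def P_def k_def by algebra
    have p00: "p0 \<noteq> 0" using p by auto
    have S: "3 * n * (p0 + y1 + y2) = p0^2 + y1^2 + y2^2" using tr unfolding y1_y2_def .
    have "(y1 - p0) * (y1 - \<omega> * p0) * (y1 - \<omega>^2 * p0) = 0"
    proof -
      have "y1^3 - p0^3 = 0" using y(1) p(1) by simp
      then show ?thesis using \<omega> w3 by algebra
    qed
    then consider "y1 = p0" | "y1 = \<omega> * p0" | "y1 = \<omega>^2 * p0" by auto
    then have "\<exists>\<zeta>. \<zeta>^3 = -1 \<and> 3 * n = \<zeta> * p0"
    proof cases
      case 1
      have "p0^2 * (y2 - \<omega>^2 * p0) = 0" using prod p(1) unfolding 1 by algebra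
      then have 2: "y2 = \<omega>^2 * p0" using p00 by simp
      have "(1 - \<omega>) * p0 * (3 * n + \<omega>^2 * p0) = 0" using S \<omega> unfolding 1 2 by algebra
      then have "3 * n = (- (\<omega>^2)) * p0" using p00 w1 by (simp add: eq_neg_iff_add_eq_0)
      moreover have "(- (\<omega>^2))^3 = -1" using w3 by algebra
      ultimately show ?thesis by blast
    next
      case a2: 2
      have "p0^2 * \<omega> * (y2 - \<omega> * p0) = 0" using prod p(1) unfolding a2 by algebra
      then have 2: "y2 = \<omega> * p0" using p00 w3 by auto
      have "(1 - \<omega>) * p0 * \<omega> * (3 * n + p0) = 0" using S \<omega> unfolding a2 2 by algebra
      then have "3 * n = (-1) * p0" using p00 w1 w3 by (auto simp add: eq_neg_iff_add_eq_0)
      moreover have "(-1)^3 = (-1::'a)" by simp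
      ultimately show ?thesis by blast
    next
      case a3: 3
      have "p0^2 * \<omega>^2 * (y2 - p0) = 0" using prod p(1) unfolding a3 by algebra
      then have 2: "y2 = p0" using p00 w3 by auto
      have "(1 - \<omega>) * p0 * (3 * n + \<omega>^2 * p0) = 0" using S \<omega> unfolding a3 2 by algebra
      then have "3 * n = (- (\<omega>^2)) * p0" using p00 w1 by (simp add: eq_neg_iff_add_eq_0)
      moreover have "(- (\<omega>^2))^3 = -1" using w3 by algebra
      ultimately show ?thesis by blast
    qed
    then obtain \<zeta> where z: "\<zeta>^3 = -1" "3 * n = \<zeta> * p0" by blast
    have "n * (27 * n^2 + 1) = 0" using z p(1) by algebra
    then have "1 + 1 = (0::'a)" using n27 p(4) by simp
    then show False using two by simp
  next
    case ne
    define z where "z = Z / n"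
    have Z: "Z = z * n" using p by (simp add: z_def)
    have "n^2 * (z^2 + z + 1) = 0" using ne unfolding Z by algebra
    then have zz: "z^2 + z + 1 = 0" using p by simp
    have z3: "z^3 = 1" using zz by algebra
    have z1: "z \<noteq> 1" using zz three by auto
    \<comment> \<open>For \<open>Z = z * n\<close>, equation 3 is quadratic in \<open>n\<close> and
      splits over the powers of \<open>z\<close>. Cubing 1 below removes the unknown roots of unity;
      then root A gives \<open>c^3 = a^3\<close> and root B gives
      \<open>c^3 = - 8 * a^3\<close>.\<close>
    have "(9 * n - (z - z^2)) * (9 * n - (1 - z)) * (1 + 2 * 0) = 0" using 3 zz unfolding Z by algebra
    then consider (A) "9 * n = z - z^2" | (B) "9 * n = 1 - z" by auto
    moreover have k1: "c^3 * (1 - 3 * n)^3 = 216 * a^3 * n^3"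
    proof -
      have "k * (c * (1 - 3 * n)) = 6 * a * (z * n)" using 1 unfolding Z[symmetric] Z_def by simp
      then have "(k * (c * (1 - 3 * n)))^3 = (6 * a * (z * n))^3" by simp
      then show ?thesis using k3 z3 by (simp add: power_mult_distrib)
    qed
    moreover have k2: "(3 - 9 * n)^3 * c^3 = 8 * a^3 * (9 * n)^3" using k1 by algebra
    have cub: "(1 - z)^3 \<noteq> 0" using z1 by simp
    ultimately show False
    proof cases
      case A
      have "8 * (1 - z)^3 * (c^3 - a^3) = 0" using k2 zz unfolding A by algebra
      moreover have "(8::'a) \<noteq> 0" using two power_not_zero[of "2::'a" 3] by simp
      ultimately show False using cub nz(4) by simp
    next
      case B
      have "(1 - z)^3 * (c^3 + 8 * a^3) = 0" using k2 zz unfolding B by algebra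
      then show False using cub nz(3) by simp
    qed
  qed
qed

section \<open>The action on the Hesse pencil\<close>

lemma cubic_coeffs:
  fixes p r :: "3 \<Rightarrow> 'a::field"
  assumes two: "(2::'a) \<noteq> 0"
    and h: "\<And>x. (r 0 + x * p 0) * (r 1 + x * p 1) * (r 2 + x * p 2) = u * (1 + x^3)"
    and pu: "p 0 * p 1 * p 2 = u"
  shows "p 0 * r 1 * r 2 + p 1 * r 0 * r 2 + p 2 * r 0 * r 1 = 0"
    "r 0 * p 1 * p 2 + r 1 * p 0 * p 2 + r 2 * p 0 * p 1 = 0"
proof -
  have c0: "r 0 * r 1 * r 2 = u" using h[of 0] by simp
  \<comment> \<open>The extreme coefficients are known, so the values at 1 and -1 determine the two
    middle ones.\<close>
  have "2 * (r 0 * p 1 * p 2 + r 1 * p 0 * p 2 + r 2 * p 0 * p 1) = 0" using h[of 1, simplified] h[of "-1", simplified] c0 pu by algebra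
  then show c2: "r 0 * p 1 * p 2 + r 1 * p 0 * p 2 + r 2 * p 0 * p 1 = 0" using two by (metis mult_eq_0_iff)
  show "p 0 * r 1 * r 2 + p 1 * r 0 * r 2 + p 2 * r 0 * r 1 = 0" using h[of 1, simplified] c0 c2 pu by algebra
qed

text \<open>The substitution by \<open>M\<close> fixes \<open>w(x,x,x)\<close> and rescales
  \<open>det w(x,_,_)\<close> by the square of \<open>det M\<close>. In terms of \<open>e\<close>
  and \<open>P\<close> these two cubics have the coefficient determinant \<open>\<Delta>\<close>,
  which is nonzero, so \<open>e\<close> and \<open>P\<close> transform within their span. The
  constants come from Cramer's rule.\<close>

lemma skl_web_cubics:
  fixes a b c :: "'a::field"
  assumes tA: "skl_typeA_params a b c" and "web (skl a b c) \<Phi> M q"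
  obtains u v u' v' where
    "\<forall>\<xi> y. (\<forall>j. y j = (\<Sum>i\<in>UNIV. \<xi> i * M i j)) \<longrightarrow>
       y 0 * y 1 * y 2 = u * (\<xi> 0 ^ 3 + \<xi> 1 ^ 3 + \<xi> 2 ^ 3) + v * (\<xi> 0 * \<xi> 1 * \<xi> 2)"
    "\<forall>\<xi> y. (\<forall>j. y j = (\<Sum>i\<in>UNIV. \<xi> i * M i j)) \<longrightarrow>
       y 0 ^ 3 + y 1 ^ 3 + y 2 ^ 3 = u' * (\<xi> 0 ^ 3 + \<xi> 1 ^ 3 + \<xi> 2 ^ 3) + v' * (\<xi> 0 * \<xi> 1 * \<xi> 2)"
proof -
  interpret web "skl a b c" \<Phi> M q by fact
  note nz = typeA_facts[OF tA]
  let ?w = "skl a b c"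
  define e where "e y = y 0 ^ 3 + y 1 ^ 3 + y 2 ^ 3" for y :: "3 \<Rightarrow> 'a"
  define P where "P y = y 0 * y 1 * y 2" for y :: "3 \<Rightarrow> 'a"
  define K where "K = a^3 + b^3 + c^3"
  define slice where "slice y = (\<chi> j k. \<Sum>i\<in>UNIV. ?w i j k * y i)" for y :: "3 \<Rightarrow> 'a"
  define M' :: "'a^3^3" where "M' = (\<chi> i j. M i j)"
  define D where "D = det M' ^ 2"
  have det_slice: "det (slice y) = K * P y - a * b * c * e y" for y
    unfolding det_3 slice_def K_def P_def e_def
    by (simp add: sum_3' skl_def algebra_simps power3_eq_cube)
  have s_inv: "c * e y + 3 * (a + b) * P y = c * e \<xi> + 3 * (a + b) * P \<xi>"
    and f_inv: "D * (K * P y - a * b * c * e y) = K * P \<xi> - a * b * c * e \<xi>"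
    if y: "\<And>j. y j = (\<Sum>i\<in>UNIV. \<xi> i * M i j)" for y \<xi>
  proof -
    have cub: "(\<Sum>i\<in>UNIV. \<Sum>j\<in>UNIV. \<Sum>k\<in>UNIV. ?w i j k * z i * z j * z k) = c * e z + 3 * (a + b) * P z" for z
      unfolding e_def P_def by (simp add: sum_3' skl_def algebra_simps power3_eq_cube)
    have "(\<Sum>i\<in>UNIV. \<Sum>j\<in>UNIV. \<Sum>k\<in>UNIV. ?w i j k * y i * y j * y k)
      = (\<Sum>i\<in>UNIV. \<Sum>j\<in>UNIV. \<Sum>k\<in>UNIV. (\<Sum>a\<in>UNIV. \<Sum>b\<in>UNIV. \<Sum>c\<in>UNIV. M i a * M j b * M k c * ?w a b c) * \<xi> i * \<xi> j * \<xi> k)"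
      unfolding y flatten_sums
      by (rule sum.reindex_bij_witness[of _ "\<lambda>(i,j,k,a,b,c). (a,b,c,(k,j,i))" "\<lambda>(a,b,c,(k,j,i)). (i,j,k,a,b,c)"])
        (auto simp: mult_ac)
    then show "c * e y + 3 * (a + b) * P y = c * e \<xi> + 3 * (a + b) * P \<xi>"
      unfolding w_inv cub .
    have "M' ** slice y ** transpose M' = slice \<xi>"
    proof -
      have "(\<Sum>d\<in>UNIV. (\<Sum>b\<in>UNIV. M j b * (\<Sum>i\<in>UNIV. ?w i b d * y i)) * M k d)
        = (\<Sum>i\<in>UNIV. (\<Sum>a\<in>UNIV. \<Sum>b\<in>UNIV. \<Sum>c\<in>UNIV. M i a * M j b * M k c * ?w a b c) * \<xi> i)" for j k
        unfolding y flatten_sums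
        by (rule sum.reindex_bij_witness[of _ "\<lambda>(i,a,b,d). (d,b,a,i)" "\<lambda>(d,b,a,i). (i,a,b,d)"]) (auto simp: mult_ac)
      then show ?thesis
        unfolding w_inv by (simp add: matrix_matrix_mult_def M'_def slice_def transpose_def vec_eq_iff)
    qed
    then have "det M' * det (slice y) * det M' = det (slice \<xi>)"
      by (metis det_mul det_transpose)
    then show "D * (K * P y - a * b * c * e y) = K * P \<xi> - a * b * c * e \<xi>"
      unfolding det_slice D_def power2_eq_square by (simp add: mult_ac)
  qed
  have D0: "D \<noteq> 0"
  proof -
    have "M' ** (\<chi> i j. N i j) = mat 1"
      using MN by (simp add: M'_def matrix_matrix_mult_def vec_eq_iff mat_def kd_def)
    then have "det M' * det (\<chi> i j. N i j) = 1" by (metis det_mul det_I)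
    then show ?thesis unfolding D_def by auto
  qed
  define \<Delta> where "\<Delta> = c * (c^3 + (a + b)^3)"
  have \<Delta>: "\<Delta> \<noteq> 0" "\<Delta> = c * K + 3 * (a + b) * (a * b * c)"
    using nz unfolding \<Delta>_def K_def by (simp, algebra)
  define E where "E = D * \<Delta>"
  have E0: "E \<noteq> 0" using D0 \<Delta> by (simp add: E_def)
  have quot: "x = A / E * y + B / E * z" if "E * x = A * y + B * z" for x y z A B
    using that E0 by (simp add: field_simps)
  show ?thesis
  proof (rule that[of "(a * b * c * D * c - c * a * b * c) / E" "(c * K + a * b * c * D * 3 * (a + b)) / E"
        "(K * D * c + 3 * (a + b) * (a * b * c)) / E" "(K * D * 3 * (a + b) - 3 * (a + b) * K) / E"])
    show "\<forall>\<xi> y. (\<forall>j. y j = (\<Sum>i\<in>UNIV. \<xi> i * M i j)) \<longrightarrow> y 0 * y 1 * y 2 = (a * b * c * D * c - c * a * b * c) / E * (\<xi> 0 ^ 3 + \<xi> 1 ^ 3 + \<xi> 2 ^ 3) + (c * K + a * b * c * D * 3 * (a + b)) / E * (\<xi> 0 * \<xi> 1 * \<xi> 2)"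
    proof (intro allI impI)
    fix \<xi> y :: "3 \<Rightarrow> 'a" assume "\<forall>j. y j = (\<Sum>i\<in>UNIV. \<xi> i * M i j)"
    then have y: "\<And>j. y j = (\<Sum>i\<in>UNIV. \<xi> i * M i j)" by blast
    have "E * P y = (a * b * c * D * c - c * a * b * c) * e \<xi> + (c * K + a * b * c * D * 3 * (a + b)) * P \<xi>"
      using s_inv[of y \<xi>, OF y] f_inv[of y \<xi>, OF y] unfolding E_def \<Delta>(2) by algebra
    then have "P y = (a * b * c * D * c - c * a * b * c) / E * e \<xi> + (c * K + a * b * c * D * 3 * (a + b)) / E * P \<xi>"
      by (rule quot)
    then show "y 0 * y 1 * y 2 = (a * b * c * D * c - c * a * b * c) / E * (\<xi> 0 ^ 3 + \<xi> 1 ^ 3 + \<xi> 2 ^ 3) + (c * K + a * b * c * D * 3 * (a + b)) / E * (\<xi> 0 * \<xi> 1 * \<xi> 2)"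
      unfolding P_def e_def .
    qed
    show "\<forall>\<xi> y. (\<forall>j. y j = (\<Sum>i\<in>UNIV. \<xi> i * M i j)) \<longrightarrow> y 0 ^ 3 + y 1 ^ 3 + y 2 ^ 3 = (K * D * c + 3 * (a + b) * (a * b * c)) / E * (\<xi> 0 ^ 3 + \<xi> 1 ^ 3 + \<xi> 2 ^ 3) + (K * D * 3 * (a + b) - 3 * (a + b) * K) / E * (\<xi> 0 * \<xi> 1 * \<xi> 2)"
    proof (intro allI impI)
    fix \<xi> y :: "3 \<Rightarrow> 'a" assume "\<forall>j. y j = (\<Sum>i\<in>UNIV. \<xi> i * M i j)"
    then have y: "\<And>j. y j = (\<Sum>i\<in>UNIV. \<xi> i * M i j)" by blast
    have "E * e y = (K * D * c + 3 * (a + b) * (a * b * c)) * e \<xi> + (K * D * 3 * (a + b) - 3 * (a + b) * K) * P \<xi>"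
      using s_inv[of y \<xi>, OF y] f_inv[of y \<xi>, OF y] unfolding E_def \<Delta>(2) by algebra
    then have "e y = (K * D * c + 3 * (a + b) * (a * b * c)) / E * e \<xi> + (K * D * 3 * (a + b) - 3 * (a + b) * K) / E * P \<xi>"
      by (rule quot)
    then show "y 0 ^ 3 + y 1 ^ 3 + y 2 ^ 3 = (K * D * c + 3 * (a + b) * (a * b * c)) / E * (\<xi> 0 ^ 3 + \<xi> 1 ^ 3 + \<xi> 2 ^ 3) + (K * D * 3 * (a + b) - 3 * (a + b) * K) / E * (\<xi> 0 * \<xi> 1 * \<xi> 2)"
      unfolding P_def e_def .
    qed
  qed
qed

text \<open>The ratios \<open>r j / p j\<close> have elementary symmetric functions 0, 0 and 1.
  Eliminating the third of them from the first two equations gives the quadratic equation for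
  \<open>\<omega>\<close>, the quotient of the second ratio by the first.\<close>

lemma ratio_roots:
  fixes p r :: "3 \<Rightarrow> 'a::field"
  assumes u: "p 0 * p 1 * p 2 = u" "r 0 * r 1 * r 2 = u" "u \<noteq> 0"
    and c1: "p 0 * r 1 * r 2 + p 1 * r 0 * r 2 + p 2 * r 0 * r 1 = 0"
    and c2: "r 0 * p 1 * p 2 + r 1 * p 0 * p 2 + r 2 * p 0 * p 1 = 0"
  obtains \<kappa> \<omega> where "\<kappa>^3 = 1" "\<omega>^2 + \<omega> + 1 = 0" "r 0 = \<kappa> * p 0" "r 1 = \<kappa> * \<omega> * p 1" "r 2 = \<kappa> * \<omega>^2 * p 2"
proof -
  have nz: "p 0 \<noteq> 0" "p 1 \<noteq> 0" "p 2 \<noteq> 0" "r 0 \<noteq> 0" using u by auto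
  define z where "z j = r j / p j" for j
  have r: "r 0 = z 0 * p 0" "r 1 = z 1 * p 1" "r 2 = z 2 * p 2" using nz by (simp_all add: z_def)
  have z0: "z 0 \<noteq> 0" using nz by (simp add: z_def)
  define \<omega> where "\<omega> = z 1 / z 0"
  have z1: "z 1 = z 0 * \<omega>" using z0 by (simp add: \<omega>_def)
  have "u * (z 0 + z 1 + z 2) = 0" using c2 unfolding r u(1)[symmetric] by algebra
  then have "z 0 + z 1 + z 2 = 0" using u by simp
  then have z2: "z 2 = - (z 0 * (1 + \<omega>))" unfolding z1 by algebra
  have "u * (z 0 * z 1 + z 0 * z 2 + z 1 * z 2) = 0" using c1 unfolding r u(1)[symmetric] by algebra
  then have "z 0 * z 1 + z 0 * z 2 + z 1 * z 2 = 0" using u by simp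
  then have "z 0 ^ 2 * (\<omega>^2 + \<omega> + 1) = 0" unfolding z1 z2 by algebra
  then have w: "\<omega>^2 + \<omega> + 1 = 0" using z0 by simp
  have z2': "z 2 = z 0 * \<omega>^2" using w unfolding z2 by algebra
  have "(p 0 * p 1 * p 2) * (z 0 * z 1 * z 2) = u" using u(2) unfolding r by (simp add: mult_ac)
  then have "u * (z 0 * z 1 * z 2) = u * 1" by (simp add: u(1))
  then have "z 0 * z 1 * z 2 = 1" using u by simp
  then have "z 0 ^ 3 = 1" using w unfolding z1 z2' by algebra
  then show ?thesis using w r z1 z2' by (intro that[of "z 0" \<omega>]) simp_all
qed

lemma skl_web_monomial:
  fixes a b c :: "'a::field"
  assumes tA: "skl_typeA_params a b c" and "web (skl a b c) \<Phi> M q"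
    and two: "(2::'a) \<noteq> 0" and three: "(3::'a) \<noteq> 0"
  shows "\<exists>k. M i k \<noteq> 0 \<and> (\<forall>j. j \<noteq> k \<longrightarrow> M i j = 0)"
proof -
  interpret web "skl a b c" \<Phi> M q by fact
  note nz = typeA_facts[OF tA]
  obtain u v u' v' where
    P': "\<forall>\<xi> y. (\<forall>j. y j = (\<Sum>i\<in>UNIV. \<xi> i * M i j)) \<longrightarrow>
       y 0 * y 1 * y 2 = u * (\<xi> 0 ^ 3 + \<xi> 1 ^ 3 + \<xi> 2 ^ 3) + v * (\<xi> 0 * \<xi> 1 * \<xi> 2)"
    and E': "\<forall>\<xi> y. (\<forall>j. y j = (\<Sum>i\<in>UNIV. \<xi> i * M i j)) \<longrightarrow>
       y 0 ^ 3 + y 1 ^ 3 + y 2 ^ 3 = u' * (\<xi> 0 ^ 3 + \<xi> 1 ^ 3 + \<xi> 2 ^ 3) + v' * (\<xi> 0 * \<xi> 1 * \<xi> 2)"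
    by (rule skl_web_cubics[OF assms(1,2)], rule that, assumption+)
  note P = P'[rule_format] and E = E'[rule_format]
  have row: "M i j = (\<Sum>l\<in>UNIV. kd l i * M l j)" for i j by simp
  have row2: "M k j + x * M i j = (\<Sum>l\<in>UNIV. (kd l k + x * kd l i) * M l j)" for i j k x
    by (simp add: distrib_right sum.distrib mult.assoc sum_distrib_left[symmetric])
  have k1: "kd 0 i ^ 3 + kd 1 i ^ 3 + kd 2 i ^ 3 = (1::'a)" "kd 0 i * kd 1 i * kd 2 i = (0::'a)" for i
  proof -
    have "\<forall>i. kd 0 i ^ 3 + kd 1 i ^ 3 + kd 2 i ^ 3 = (1::'a) \<and> kd 0 i * kd 1 i * kd 2 i = (0::'a)"
      by (simp add: forall_3' kd_def)
    then show "kd 0 i ^ 3 + kd 1 i ^ 3 + kd 2 i ^ 3 = (1::'a)" "kd 0 i * kd 1 i * kd 2 i = (0::'a)" by blast+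
  qed
  have k2: "(kd 0 k + x * kd 0 i) ^ 3 + (kd 1 k + x * kd 1 i) ^ 3 + (kd 2 k + x * kd 2 i) ^ 3 = 1 + x^3"
    "(kd 0 k + x * kd 0 i) * (kd 1 k + x * kd 1 i) * (kd 2 k + x * kd 2 i) = 0" if "i \<noteq> k" for i k and x :: 'a
  proof -
    have "\<forall>i k. i \<noteq> k \<longrightarrow> (kd 0 k + x * kd 0 i) ^ 3 + (kd 1 k + x * kd 1 i) ^ 3 + (kd 2 k + x * kd 2 i) ^ 3 = 1 + x^3 \<and>
       (kd 0 k + x * kd 0 i) * (kd 1 k + x * kd 1 i) * (kd 2 k + x * kd 2 i) = 0"
      by (simp add: forall_3' kd_def add.commute)
    then show "(kd 0 k + x * kd 0 i) ^ 3 + (kd 1 k + x * kd 1 i) ^ 3 + (kd 2 k + x * kd 2 i) ^ 3 = 1 + x^3"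
      "(kd 0 k + x * kd 0 i) * (kd 1 k + x * kd 1 i) * (kd 2 k + x * kd 2 i) = 0" using that by blast+
  qed
  \<comment> \<open>At a basis vector the transformed triangle takes the value \<open>u\<close>, so
    all rows of \<open>M\<close> have the same product of entries. This makes \<open>u\<close> the
    quantity that separates the two shapes of \<open>M\<close>.\<close>
  have pu: "M i 0 * M i 1 * M i 2 = u" for i
    using P[of "\<lambda>j. M i j" "\<lambda>l. kd l i", OF row] by (simp add: k1)
  have h: "(M k 0 + x * M i 0) * (M k 1 + x * M i 1) * (M k 2 + x * M i 2) = u * (1 + x^3)" if "i \<noteq> k" for i k x
    using P[of "\<lambda>j. M k j + x * M i j" "\<lambda>l. kd l k + x * kd l i", OF row2] by (simp add: k2[OF that])
  note cc = cubic_coeffs[of "\<lambda>j. M k j" "\<lambda>j. M i j" u for i k, OF two h pu]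
  have col: False if "\<And>i. M i j = 0" for j
    using M_inj[of "\<lambda>l. kd l j" j] that by simp
  have rownz: "\<exists>j. M i j \<noteq> 0" for i
  proof (rule ccontr)
    assume "\<not> (\<exists>j. M i j \<noteq> 0)"
    then have "(\<Sum>j\<in>UNIV. M i j * N j i) = 0" by simp
    then show False by (simp add: MN)
  qed
  show ?thesis
  proof (cases "u = 0")
    case True
    \<comment> \<open>If a row had exactly one zero entry, \<open>cc(2)\<close> would spread this
      zero over its whole column, against invertibility.\<close>
    have *: "M i 1 * M i 2 = 0" if "M i 0 = 0"
    proof (rule ccontr)
      assume ne: "M i 1 * M i 2 \<noteq> 0"
      have "M k 0 = 0" for k
        using cc(2)[of i k] that ne by (cases "k = i") auto
      then show False using col by blast
    qed
    have **: "M i 0 * M i 2 = 0" if "M i 1 = 0"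
    proof (rule ccontr)
      assume ne: "M i 0 * M i 2 \<noteq> 0"
      have "M k 1 = 0" for k
        using cc(2)[of i k] that ne by (cases "k = i") auto
      then show False using col by blast
    qed
    have ***: "M i 0 * M i 1 = 0" if "M i 2 = 0"
    proof (rule ccontr)
      assume ne: "M i 0 * M i 1 \<noteq> 0"
      have "M k 2 = 0" for k
        using cc(2)[of i k] that ne by (cases "k = i") auto
      then show False using col by blast
    qed
    have "M i 0 = 0 \<or> M i 1 = 0 \<or> M i 2 = 0" using pu[of i] True by auto
    moreover have "\<not> (M i 0 = 0 \<and> M i 1 = 0 \<and> M i 2 = 0)" using rownz[of i] forall_3'[of "\<lambda>j. M i j = 0"] by auto
    ultimately consider "M i 0 \<noteq> 0" "M i 1 = 0" "M i 2 = 0" | "M i 1 \<noteq> 0" "M i 0 = 0" "M i 2 = 0" | "M i 2 \<noteq> 0" "M i 0 = 0" "M i 1 = 0"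
      using * ** *** by auto
    then show ?thesis
    proof cases
      case 1 then show ?thesis by (intro exI[of _ 0]) (simp add: forall_3')
    next
      case 2 then show ?thesis by (intro exI[of _ 1]) (simp add: forall_3')
    next
      case 3 then show ?thesis by (intro exI[of _ 2]) (simp add: forall_3')
    qed
  next
    case u0: False
    have False
    proof (cases "a = b")
      case False
      \<comment> \<open>\<open>b * w 0 1 _ - a * w 1 0 _\<close> vanishes. Transported by
        \<open>M\<close>, this becomes a relation between the rows 0 and 1 of \<open>M\<close>,
        whose three components carry the factor \<open>b - a\<close>. Multiplying them together
        leaves \<open>c^3 + (a + b)^3\<close> times \<open>u^2\<close>.\<close>
      define V where "V l l' j = (\<Sum>x\<in>UNIV. \<Sum>y\<in>UNIV. skl a b c x y j * M l x * M l' y)" for l l' j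
      have V: "(\<Sum>j\<in>UNIV. M k j * V l l' j) = skl a b c l l' k" for k l l'
      proof -
        have "(\<Sum>j\<in>UNIV. M k j * V l l' j) = (\<Sum>x\<in>UNIV. \<Sum>y\<in>UNIV. \<Sum>j\<in>UNIV. M l x * M l' y * M k j * skl a b c x y j)"
          unfolding V_def flatten_sums
          by (rule sum.reindex_bij_witness[of _ "\<lambda>(x,y,j). (j,x,y)" "\<lambda>(j,x,y). (x,y,j)"]) (auto simp: mult_ac)
        then show ?thesis by (simp add: w_inv)
      qed
      have "b * V 0 1 j - a * V 1 0 j = 0" for j
      proof (rule M_inj)
        fix k
        have "(\<Sum>j\<in>UNIV. M k j * (b * V 0 1 j - a * V 1 0 j)) = b * (\<Sum>j\<in>UNIV. M k j * V 0 1 j) - a * (\<Sum>j\<in>UNIV. M k j * V 1 0 j)"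
          by (simp add: right_diff_distrib sum_subtractf sum_distrib_left mult_ac)
        also have "\<dots> = 0"
        proof -
          have "\<forall>k. b * skl a b c 0 1 k - a * skl a b c 1 0 k = 0" by (simp add: forall_3' skl_def)
          then show ?thesis by (simp add: V)
        qed
        finally show "(\<Sum>j\<in>UNIV. M k j * (b * V 0 1 j - a * V 1 0 j)) = 0" .
      qed
      from this[of 0] this[of 1] this[of 2]
      have "(b - a) * (c * M 0 0 * M 1 0 + (a + b) * M 0 2 * M 1 1) = 0"
           "(b - a) * (c * M 0 1 * M 1 1 + (a + b) * M 0 0 * M 1 2) = 0"
           "(b - a) * (c * M 0 2 * M 1 2 + (a + b) * M 0 1 * M 1 0) = 0"
        unfolding V_def by (simp_all add: sum_3' skl_def algebra_simps)
      then have "c * M 0 0 * M 1 0 + (a + b) * M 0 2 * M 1 1 = 0"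
           "c * M 0 1 * M 1 1 + (a + b) * M 0 0 * M 1 2 = 0"
           "c * M 0 2 * M 1 2 + (a + b) * M 0 1 * M 1 0 = 0"
        using False by auto
      then have "(c^3 + (a + b)^3) * ((M 0 0 * M 0 1 * M 0 2) * (M 1 0 * M 1 1 * M 1 2)) = 0"
        by algebra
      then show False using u0 nz(4) by (simp add: pu)
    next
      case True
      obtain \<kappa> \<omega> where \<kappa>: "\<kappa>^3 = 1" and \<omega>: "\<omega>^2 + \<omega> + 1 = 0"
        and r: "M 1 0 = \<kappa> * M 0 0" "M 1 1 = \<kappa> * \<omega> * M 0 1" "M 1 2 = \<kappa> * \<omega>^2 * M 0 2"
        by (rule ratio_roots[of "\<lambda>j. M 0 j" u "\<lambda>j. M 1 j", OF pu pu u0 cc[of 0 1]]) simp_all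
      obtain \<kappa>' \<omega>' where \<kappa>': "\<kappa>'^3 = 1" and \<omega>': "\<omega>'^2 + \<omega>' + 1 = 0"
        and s: "M 2 0 = \<kappa>' * M 0 0" "M 2 1 = \<kappa>' * \<omega>' * M 0 1" "M 2 2 = \<kappa>' * \<omega>'^2 * M 0 2"
        by (rule ratio_roots[of "\<lambda>j. M 0 j" u "\<lambda>j. M 2 j", OF pu pu u0 cc[of 0 2]]) simp_all
      have w3: "\<omega>^3 = 1" using \<omega> by algebra
      have w6: "\<omega>^6 = 1" "\<omega>^12 = 1" using w3 by algebra+
      have w1: "\<omega> \<noteq> 1" using \<omega> three by auto
      have kn: "\<kappa> \<noteq> 0" "\<kappa>' \<noteq> 0" using \<kappa> \<kappa>' by auto
      \<comment> \<open>With \<open>\<omega>' = \<omega>\<close> the three terms of the mixed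
        coefficient of rows 1 and 2 would coincide and not cancel. So \<open>M\<close> is a Fourier
        matrix up to scaling of rows and columns.\<close>
      have "(\<omega>' - \<omega>) * (\<omega>' - \<omega>^2) = 0" using \<omega> \<omega>' by algebra
      moreover have "\<omega>' \<noteq> \<omega>"
      proof
        assume eq: "\<omega>' = \<omega>"
        have "M 2 0 * M 1 1 * M 1 2 + M 2 1 * M 1 0 * M 1 2 + M 2 2 * M 1 0 * M 1 1 = 0"
          using cc(2)[of 1 2] by simp
        then have "\<kappa>' * \<kappa>^2 * 3 * (M 0 0 * M 0 1 * M 0 2) = 0" using w3 unfolding r s eq by algebra
        then show False using kn three u0 by (simp add: pu)
      qed
      ultimately have ww: "\<omega>' = \<omega>^2" by auto
      define p0 p1 p2 where "p0 = M 0 0" "p1 = M 0 1" "p2 = M 0 2"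
      note pd = p0_p1_p2_def[symmetric]
      have e: "(M 1 0 + x * M 0 0)^3 + (M 1 1 + x * M 0 1)^3 + (M 1 2 + x * M 0 2)^3 = u' * (1 + x^3)" for x
        using E[of "\<lambda>j. M 1 j + x * M 0 j" "\<lambda>l. kd l 1 + x * kd l 0", OF row2] by (simp add: kd_def add.commute)
      have pe: "M i 0 ^ 3 + M i 1 ^ 3 + M i 2 ^ 3 = u'" for i
        using E[of "\<lambda>j. M i j" "\<lambda>l. kd l i", OF row] by (simp add: k1)
      have n: "p1^3 = p0^3" "p2^3 = p0^3"
      proof -
        \<comment> \<open>\<open>X\<close> and \<open>Y\<close> are, up to the factor 3, the mixed
          coefficients of the sum of cubes along rows 0 and 1. Their vanishing is a linear system
          that makes the cubes \<open>p0^3\<close>, \<open>p1^3\<close>, \<open>p2^3\<close>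
          equal.\<close>
        define X where "X = M 1 0 * p0^2 + M 1 1 * p1^2 + M 1 2 * p2^2"
        define Y where "Y = M 1 0 ^ 2 * p0 + M 1 1 ^ 2 * p1 + M 1 2 ^ 2 * p2"
        have "3 * (X + Y) = ((M 1 0 + 1 * p0)^3 + (M 1 1 + 1 * p1)^3 + (M 1 2 + 1 * p2)^3)
            - (M 1 0 ^ 3 + M 1 1 ^ 3 + M 1 2 ^ 3) - (p0 ^ 3 + p1 ^ 3 + p2 ^ 3)"
          unfolding X_def Y_def by algebra
        also have "\<dots> = 0" using e[of 1] pe[of 0] pe[of 1] unfolding pd by simp
        finally have 1: "3 * (X + Y) = 0" .
        have "3 * (Y - X) = (M 1 0 ^ 3 + M 1 1 ^ 3 + M 1 2 ^ 3) - (p0 ^ 3 + p1 ^ 3 + p2 ^ 3)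
           - ((M 1 0 + (-1) * p0)^3 + (M 1 1 + (-1) * p1)^3 + (M 1 2 + (-1) * p2)^3)"
          unfolding X_def Y_def by algebra
        also have "\<dots> = 0" using e[of "-1"] pe[of 0] pe[of 1] unfolding pd by simp
        finally have 2: "3 * (Y - X) = 0" .
        have "X + Y = 0" "Y - X = 0" using 1 2 three by (metis mult_eq_0_iff)+
        then have "2 * X = 0" "2 * Y = 0" by algebra+
        then have XY0: "X = 0" "Y = 0" using two by (metis mult_eq_0_iff)+
        have X': "\<kappa> * (p0^3 + \<omega> * p1^3 + \<omega>^2 * p2^3) = 0"
          using XY0(1) unfolding X_def r pd by algebra
        have Y': "\<kappa>^2 * (p0^3 + \<omega>^2 * p1^3 + \<omega> * p2^3) = 0"
          using XY0(2) w3 unfolding Y_def r pd by algebra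
        have x: "p0^3 + \<omega> * p1^3 + \<omega>^2 * p2^3 = 0" and y: "p0^3 + \<omega>^2 * p1^3 + \<omega> * p2^3 = 0"
          using X' Y' kn by auto
        have "\<omega> * (1 - \<omega>) * (p1^3 - p2^3) = 0" using x y by algebra
        then have "p1^3 = p2^3" using w1 w3 by auto
        then show "p1^3 = p0^3" "p2^3 = p0^3" using x \<omega> by algebra+
      qed
      have n0: "p0^3 \<noteq> 0" using u0 pu[of 0] by (auto simp: pd)
      have i1: "3 * p0^3 * c + 6 * a * (p0 * p1 * p2) = c"
      proof -
        have "c * p0^3 + c * p1^3 + c * p2^3 + 6 * a * (p0 * p1 * p2) = c"
          using w_inv[of 0 0 0] unfolding True[symmetric]
          by (simp add: sum_3' skl_def pd algebra_simps power3_eq_cube)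
        then show ?thesis unfolding n by (simp add: algebra_simps)
      qed
      have i2: "3 * \<kappa> * \<kappa>' * (p0^3 * c - a * (p0 * p1 * p2)) = a"
      proof -
        have "c * (M 0 0 * M 1 0 * M 2 0 + M 0 1 * M 1 1 * M 2 1 + M 0 2 * M 1 2 * M 2 2)
           + a * (M 0 0 * M 1 1 * M 2 2 + M 0 1 * M 1 2 * M 2 0 + M 0 2 * M 1 0 * M 2 1
            + M 0 0 * M 1 2 * M 2 1 + M 0 1 * M 1 0 * M 2 2 + M 0 2 * M 1 1 * M 2 0) = a"
          using w_inv[of 0 1 2] unfolding True[symmetric]
          by (simp add: sum_3' skl_def algebra_simps)
        moreover have "c * (M 0 0 * M 1 0 * M 2 0 + M 0 1 * M 1 1 * M 2 1 + M 0 2 * M 1 2 * M 2 2)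
           + a * (M 0 0 * M 1 1 * M 2 2 + M 0 1 * M 1 2 * M 2 0 + M 0 2 * M 1 0 * M 2 1
            + M 0 0 * M 1 2 * M 2 1 + M 0 1 * M 1 0 * M 2 2 + M 0 2 * M 1 1 * M 2 0)
           = \<kappa> * \<kappa>' * (c * (p0^3 + p1^3 + p2^3) - 3 * (a * (p0 * p1 * p2)))"
          using \<omega> w3 unfolding r s ww pd by algebra
        ultimately have "\<kappa> * \<kappa>' * (c * (p0^3 + p1^3 + p2^3) - 3 * (a * (p0 * p1 * p2))) = a" by simp
        then show ?thesis unfolding n by (simp add: algebra_simps)
      qed
      define n' where "n' = p0^3"
      have np: "p0^3 = n'" "p1^3 = n'" "p2^3 = n'" "n' \<noteq> 0" using n n0 by (simp_all add: n'_def)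
      have cM: "M i j ^ 3 = n'" for i j
      proof -
        have "\<forall>i j. M i j ^ 3 = n'"
          using np(1-3) \<kappa> \<kappa>' w3 w6 by (simp add: forall_3' r s ww pd power_mult_distrib)
        then show ?thesis by blast
      qed
      \<comment> \<open>All entries have cube \<open>n'\<close>, so a square divided by
        \<open>n'\<close> is a reciprocal; a Fourier matrix is inverted by transposing its entrywise
        reciprocals and dividing by 3.\<close>
      have "N j k = M k j ^ 2 / (3 * n')" for j k
      proof -
        have inv: "(\<Sum>j\<in>UNIV. M i j * (M k j ^ 2 / (3 * n'))) = kd i k" for i k
        proof -
          have "(\<Sum>j\<in>UNIV. M i j * M k j ^ 2) = 3 * n' * kd i k"
          proof (cases "i = k")
            case True
            have "M k j * M k j ^ 2 = n'" for j using cM[of k j] by (simp add: power3_eq_cube power2_eq_square mult.assoc)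
            then show ?thesis by (simp add: True)
          next
            case False
            have "\<forall>i k. i \<noteq> k \<longrightarrow> (\<Sum>j\<in>UNIV. M i j * M k j ^ 2) = 0"
            proof -
              have A: "\<kappa> * p0^3 + \<kappa> * \<omega> * p1^3 + \<kappa> * \<omega>^2 * p2^3 = 0" for \<kappa> unfolding np using \<omega> by algebra
              have B: "\<kappa> * p0^3 + \<kappa> * \<omega>^2 * p1^3 + \<kappa> * \<omega> * p2^3 = 0" for \<kappa> unfolding np using \<omega> by algebra
              have "p0 * (\<kappa> * p0)^2 + p1 * (\<kappa> * \<omega> * p1)^2 + p2 * (\<kappa> * \<omega>^2 * p2)^2 = 0" using B[of "\<kappa>^2"] w3 by algebra
              moreover have "p0 * (\<kappa>' * p0)^2 + p1 * (\<kappa>' * \<omega>^2 * p1)^2 + p2 * (\<kappa>' * (\<omega>^2)^2 * p2)^2 = 0" using A[of "\<kappa>'^2"] w3 by algebra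
              moreover have "\<kappa> * p0 * p0^2 + \<kappa> * \<omega> * p1 * p1^2 + \<kappa> * \<omega>^2 * p2 * p2^2 = 0" using A[of "\<kappa>"] by algebra
              moreover have "\<kappa> * p0 * (\<kappa>' * p0)^2 + \<kappa> * \<omega> * p1 * (\<kappa>' * \<omega>^2 * p1)^2 + \<kappa> * \<omega>^2 * p2 * (\<kappa>' * (\<omega>^2)^2 * p2)^2 = 0" using B[of "\<kappa> * \<kappa>'^2"] w3 by algebra
              moreover have "\<kappa>' * p0 * p0^2 + \<kappa>' * \<omega>^2 * p1 * p1^2 + \<kappa>' * (\<omega>^2)^2 * p2 * p2^2 = 0" using B[of "\<kappa>'"] w3 by algebra
              moreover have "\<kappa>' * p0 * (\<kappa> * p0)^2 + \<kappa>' * \<omega>^2 * p1 * (\<kappa> * \<omega> * p1)^2 + \<kappa>' * (\<omega>^2)^2 * p2 * (\<kappa> * \<omega>^2 * p2)^2 = 0" using A[of "\<kappa>' * \<kappa>^2"] w3 by algebra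
              ultimately show ?thesis unfolding forall_3' sum_3' r s ww pd by simp
            qed
            then show ?thesis using False by (simp add: kd_def)
          qed
          then show ?thesis using np(4) three by (simp add: sum_divide_distrib[symmetric])
        qed
        have "N j k = (\<Sum>l\<in>UNIV. N j l * (\<Sum>m\<in>UNIV. M l m * (M k m ^ 2 / (3 * n'))))" by (simp only: inv kd_sum)
        also have "\<dots> = (\<Sum>m\<in>UNIV. (\<Sum>l\<in>UNIV. N j l * M l m) * (M k m ^ 2 / (3 * n')))"
          unfolding flatten_sums
          by (rule sum.reindex_bij_witness[of _ "\<lambda>(l,j). (j,l)" "\<lambda>(j,l). (l,j)"]) (auto simp: mult_ac)
        finally show ?thesis by (simp only: NM kd_sum)
      qed
      then have "(M 0 0 ^ 2 + M 1 1 ^ 2 + M 2 2 ^ 2) / (3 * n') = M 0 0 + M 1 1 + M 2 2"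
        using trace_eq by (simp add: sum_3' add_divide_distrib)
      then have "M 0 0 ^ 2 + M 1 1 ^ 2 + M 2 2 ^ 2 = 3 * n' * (M 0 0 + M 1 1 + M 2 2)"
        using np(4) three by (simp add: divide_eq_eq mult.commute)
      moreover have "M 2 2 = \<kappa>' * \<omega> * p2" using w3 unfolding s ww pd by algebra
      ultimately have tr: "3 * n' * (p0 + \<kappa> * \<omega> * p1 + \<kappa>' * \<omega> * p2) = p0^2 + (\<kappa> * \<omega> * p1)^2 + (\<kappa>' * \<omega> * p2)^2"
        by (simp add: r pd)
      show False
      proof (rule fourier_False[OF \<omega> \<kappa> \<kappa>' two three np _ _ tr nz(1,3)])
        show "3 * n' * c + 6 * a * (p0 * p1 * p2) = c" using i1 by (simp add: n'_def)
        show "3 * \<kappa> * \<kappa>' * (n' * c - a * (p0 * p1 * p2)) = a" using i2 by (simp add: n'_def)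
        have "c^3 + (a + b)^3 = c^3 + 8 * a^3" unfolding True[symmetric] by algebra
        then show "c^3 + 8 * a^3 \<noteq> 0" using nz(4) by simp
        show "c^3 \<noteq> a^3" using nz(5) True by auto
      qed
    qed
    then show ?thesis ..
  qed
qed

section \<open>Monomial twists\<close>

lemma eigenbasis_diagonal:
  fixes g h :: "3 \<Rightarrow> 3 \<Rightarrow> 'a::field"
  assumes gh: "\<And>i k. (\<Sum>j\<in>UNIV. g i j * h j k) = kd i k"
    and M: "\<And>i j. (\<Sum>a\<in>UNIV. M i a * h a j) = h i j * \<mu> j"
  shows "(\<Sum>j\<in>UNIV. h i j * g j k) = kd i k"
    and "(\<Sum>a\<in>UNIV. \<Sum>b\<in>UNIV. g i a * M a b * h b j) = \<mu> i * kd i j"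
proof -
  have "(\<chi> i j. g i j) ** (\<chi> i j. h i j) = mat 1"
    using gh by (simp add: matrix_matrix_mult_def vec_eq_iff mat_def kd_def)
  then have "(\<chi> i j. h i j) ** (\<chi> i j. g i j) = mat 1" by (simp add: matrix_left_right_inverse)
  then show "(\<Sum>j\<in>UNIV. h i j * g j k) = kd i k"
    by (simp add: matrix_matrix_mult_def vec_eq_iff mat_def kd_def)
  show "(\<Sum>a\<in>UNIV. \<Sum>b\<in>UNIV. g i a * M a b * h b j) = \<mu> i * kd i j"
  proof -
    have "(\<Sum>a\<in>UNIV. \<Sum>b\<in>UNIV. g i a * M a b * h b j) = (\<Sum>a\<in>UNIV. g i a * (\<Sum>b\<in>UNIV. M a b * h b j))"
      by (simp add: sum_distrib_left mult_ac)
    also have "\<dots> = (\<Sum>a\<in>UNIV. g i a * h a j) * \<mu> j"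
      unfolding M by (simp add: sum_distrib_left mult_ac)
    finally show ?thesis by (simp add: gh kd_def)
  qed
qed

lemma web_clock_basis_False:
  fixes w :: "'a::field tensor3"
  assumes "web w \<Phi> M q" and ns: "no_singular_square w"
    and gh: "\<And>i k. (\<Sum>j\<in>UNIV. g i j * h j k) = kd i k"
    and M: "\<And>i j. (\<Sum>a\<in>UNIV. M i a * h a j) = h i j * \<mu> j"
    and \<mu>: "\<mu> 0 = 1" "\<mu> 1 * \<mu> 1 = \<mu> 2" "\<mu> 2 * \<mu> 2 = \<mu> 1" "\<mu> 1 * \<mu> 2 = 1" "\<mu> 1 \<noteq> 1"
  shows False
proof -
  interpret web w \<Phi> M q by fact
  note hg = eigenbasis_diagonal(1)[OF gh M] and D = eigenbasis_diagonal(2)[OF gh M]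
  show False
    using web_clock_False[OF base_change[of h g, OF hg gh] D \<mu> no_singular_square_up3[OF gh hg ns]] by blast
qed

text \<open>The eigenspace of \<open>\<mu> = 1\<close> has a basis in which \<open>w 2 2 0\<close> and \<open>\<Phi> 2 2 0\<close> vanish, because these slices pair to
  \<open>- (1 + q) / 2 \<noteq> 0\<close>.\<close>

lemma web_reflection_diag_False:
  fixes w :: "'a::field tensor3"
  assumes "web w \<Phi> M q" and M: "\<And>i j. M i j = \<mu> i * kd i j"
    and \<mu>: "\<mu> 0 = 1" "\<mu> 1 = 1" "\<mu> 2 = -1" and two: "(2::'a) \<noteq> 0"
  shows False
proof -
  interpret web w \<Phi> M q by fact
  note r = rot_diag[OF M]
  define f0 f1 e0 e1 where "f0 = w 2 2 0" "f1 = w 2 2 1" "e0 = \<Phi> 2 2 0" "e1 = \<Phi> 2 2 1"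
  note fe = f0_f1_e0_e1_def
  define \<epsilon> where "\<epsilon> = f0 * e0 + f1 * e1"
  have m1: "-1 \<noteq> (1::'a)" using two by (metis add.right_inverse one_add_one)
  have q2: "(1 + q)^2 = 2 * q"
  proof -
    have "(\<Sum>i\<in>UNIV. M i i) = 1" by (simp add: sum_3' M \<mu>)
    then show ?thesis using trace_M by simp
  qed
  have z: "w 2 0 0 = 0" "w 2 0 1 = 0" "w 2 1 0 = 0" "w 2 1 1 = 0" "w 2 2 2 = 0"
    by (simp_all add: support_diag(1)[OF M] \<mu> m1)
  have cw: "w 2 0 2 = w 2 2 0" "w 2 1 2 = w 2 2 1" using cyc by metis+
  have c\<Phi>: "\<Phi> 2 0 2 = \<Phi> 2 2 0" "\<Phi> 2 1 2 = \<Phi> 2 2 1" using r[of 2 2 0] r[of 2 2 1] by (simp_all add: \<mu>)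
  have "2 * \<epsilon> = - (1 + q)"
    using bigon[of 2 2] by (simp add: sum_3' z cw c\<Phi> \<epsilon>_def fe algebra_simps)
  moreover have "1 + q \<noteq> 0" using q2 q0 two by auto
  ultimately have \<epsilon>: "\<epsilon> \<noteq> 0" by auto
  \<comment> \<open>Row 0 of \<open>g\<close> annihilates \<open>(f0, f1)\<close> and column 0 of
    \<open>h\<close> annihilates \<open>(e0, e1)\<close>. The pairing \<open>\<epsilon>\<close> is
    the determinant that makes the two matrices inverse to each other.\<close>
  define g where "g i j = (if i = 2 then kd 2 j else if i = 1 then (if j = 0 then e0 else if j = 1 then e1 else 0) / \<epsilon>
     else (if j = 0 then f1 else if j = 1 then - f0 else 0) / \<epsilon>)" for i j :: 3
  define h where "h i j = (if j = 2 then kd i 2 else if j = 1 then (if i = 0 then f0 else if i = 1 then f1 else 0)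
     else (if i = 0 then e1 else if i = 1 then - e0 else 0))" for i j :: 3
  have gh: "(\<Sum>j\<in>UNIV. g i j * h j k) = kd i k" for i k
  proof -
    have "\<forall>i k. (\<Sum>j\<in>UNIV. g i j * h j k) = kd i k"
      using \<epsilon> by (simp add: forall_3' sum_3' g_def h_def kd_def divide_simps) (simp add: \<epsilon>_def algebra_simps)
    then show ?thesis by blast
  qed
  have hg: "(\<Sum>j\<in>UNIV. h i j * g j k) = kd i k" for i k
  proof -
    have "\<forall>i k. (\<Sum>j\<in>UNIV. h i j * g j k) = kd i k"
      using \<epsilon> by (simp add: forall_3' sum_3' g_def h_def kd_def divide_simps) (simp add: \<epsilon>_def algebra_simps)
    then show ?thesis by blast
  qed
  have M': "(\<Sum>a\<in>UNIV. \<Sum>b\<in>UNIV. g i a * M a b * h b j) = \<mu> i * kd i j" for i j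
  proof -
    have "\<forall>i j. (\<Sum>a\<in>UNIV. \<Sum>b\<in>UNIV. g i a * M a b * h b j) = \<mu> i * kd i j"
      using \<epsilon> by (simp add: forall_3' sum_3' g_def h_def M \<mu> kd_def divide_simps) (simp add: \<epsilon>_def algebra_simps)
    then show ?thesis by blast
  qed
  have "up3 g w 2 2 0 = 0" "down3 h \<Phi> 2 2 0 = 0"
    by (simp_all add: up3_def down3_def sum_3' g_def h_def kd_def fe)
  then show False
    using web_reflection_False[OF base_change[of h g, OF hg gh] M' \<mu>] two by blast
qed

lemma web_reflection_basis_False:
  fixes w :: "'a::field tensor3"
  assumes "web w \<Phi> M q" and two: "(2::'a) \<noteq> 0"
    and gh: "\<And>i k. (\<Sum>j\<in>UNIV. g i j * h j k) = kd i k"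
    and M: "\<And>i j. (\<Sum>a\<in>UNIV. M i a * h a j) = h i j * \<mu> j"
    and \<mu>: "\<mu> 0 = 1" "\<mu> 1 = 1" "\<mu> 2 = -1"
  shows False
proof -
  interpret web w \<Phi> M q by fact
  note hg = eigenbasis_diagonal(1)[OF gh M] and D = eigenbasis_diagonal(2)[OF gh M]
  show False
    using web_reflection_diag_False[OF base_change[of h g, OF hg gh] D \<mu> two] by blast
qed

lemma (in web) monomial_data:
  assumes "\<And>i. \<exists>k. M i k \<noteq> 0 \<and> (\<forall>j. j \<noteq> k \<longrightarrow> M i j = 0)"
  obtains k d where "\<And>i j. M i j = d i * kd (k i) j" "\<And>i. d i \<noteq> 0" "inj k"
    "\<And>i j l. d i * d j * d l * w (k i) (k j) (k l) = w i j l"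
    "\<And>i. k i = i \<Longrightarrow> d i * N i i = 1" "\<And>i. k i \<noteq> i \<Longrightarrow> N (k i) (k i) = 0"
proof -
  obtain k where k: "\<And>i. M i (k i) \<noteq> 0" "\<And>i j. j \<noteq> k i \<Longrightarrow> M i j = 0"
    using assms by metis
  define d where "d i = M i (k i)" for i
  have M: "M i j = d i * kd (k i) j" for i j using k(2)[of j i] by (auto simp: d_def kd_def)
  have dN: "d i * N (k i) l = kd i l" for i l
    using MN[of i l] unfolding M by (simp add: mult.assoc sum_distrib_left[symmetric])
  show ?thesis
  proof (rule that[of d k])
    show "M i j = d i * kd (k i) j" for i j by (rule M)
    show "d i \<noteq> 0" for i using k(1) by (simp add: d_def)
    show "inj k"
    proof (rule injI, rule ccontr)
      fix x y assume "k x = k y" "x \<noteq> y"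
      then show False using dN[of x x] dN[of y x] k(1)[of y] by (auto simp: d_def kd_def)
    qed
    show "d i * d j * d l * w (k i) (k j) (k l) = w i j l" for i j l
    proof -
      have "w i j l = (\<Sum>a\<in>UNIV. kd (k i) a * (\<Sum>b\<in>UNIV. kd (k j) b * (\<Sum>c\<in>UNIV. kd (k l) c * (d i * d j * d l * w a b c))))"
        using w_inv[of i j l] unfolding M by (simp add: sum_distrib_left mult_ac del: kd_sum)
      then show ?thesis by simp
    qed
    show "d i * N i i = 1" if "k i = i" for i using dN[of i i] that by simp
    show "N (k i) (k i) = 0" if "k i \<noteq> i" for i
      using dN[of i "k i"] k(1)[of i] that by (auto simp: d_def kd_def)
  qed
qed

definition clock :: "'a::field \<Rightarrow> 3 \<Rightarrow> 'a" where
  "clock \<omega> j = (if j = 0 then 1 else if j = 1 then \<omega> else \<omega>^2)"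

lemma clock_simps [simp]: "clock \<omega> 0 = 1" "clock \<omega> 1 = \<omega>" "clock \<omega> 2 = \<omega>^2"
  by (simp_all add: clock_def)

text \<open>Orthogonality of the characters of the cyclic group of order 3; the inverse of a cube
  root of unity is its square.\<close>

lemma clock_orthogonal:
  fixes \<omega> :: "'a::field"
  assumes \<omega>: "\<omega>^2 + \<omega> + 1 = 0" and t: "3 * t = 1"
  shows "t * (1 + clock \<omega> i ^ 2 * clock \<omega> k + clock \<omega> i * clock \<omega> k ^ 2) = kd i k"
proof -
  have w3: "\<omega>^3 = 1" using \<omega> by algebra
  have p: "\<omega>^2 * \<omega> = 1" "\<omega> * \<omega>^2 = 1" "(\<omega>^2)^2 = \<omega>" "\<omega>^2 * \<omega>^2 = \<omega>"
    using w3 by algebra+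
  have p': "\<omega> * \<omega> = \<omega>^2" by (simp add: power2_eq_square)
  have z: "1 + \<omega> + \<omega>^2 = 0" "1 + \<omega>^2 + \<omega> = 0" "1 + 1 + 1 = (3::'a)" "t * 3 = 1"
    using \<omega> t by (simp_all add: ac_simps)
  have "\<forall>i k. t * (1 + clock \<omega> i ^ 2 * clock \<omega> k + clock \<omega> i * clock \<omega> k ^ 2) = kd i k"
    unfolding forall_3' by (simp only: clock_simps power_one mult_1_left mult_1_right p p' z) (simp add: kd_def)
  then show ?thesis by blast
qed

lemma skl_web_False:
  fixes a b c :: "'a::field"
  assumes tA: "skl_typeA_params a b c" and "web (skl a b c) \<Phi> M q"
    and two: "(2::'a) \<noteq> 0" and three: "(3::'a) \<noteq> 0"
    and \<omega>: "\<omega>^2 + \<omega> + 1 = (0::'a)"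
  shows False
proof -
  interpret web "skl a b c" \<Phi> M q by fact
  note nz = typeA_facts[OF tA]
  note ns = no_singular_square_skl[OF tA]
  have w3: "\<omega>^3 = 1" using \<omega> by algebra
  have w1: "\<omega> \<noteq> 1" using \<omega> three by auto
  obtain k d where M: "\<And>i j. M i j = d i * kd (k i) j" and d0: "\<And>i. d i \<noteq> 0" and inj: "inj k"
    and inv: "\<And>i j l. d i * d j * d l * skl a b c (k i) (k j) (k l) = skl a b c i j l"
    and Nfix: "\<And>i. k i = i \<Longrightarrow> d i * N i i = 1" and Nmov: "\<And>i. k i \<noteq> i \<Longrightarrow> N (k i) (k i) = 0"
    by (rule monomial_data[OF skl_web_monomial[OF assms(1,2) two three]]) (rule that)
  have sd: "skl a b c x x x = c" for x by (simp add: skl_def)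
  have d3: "d i ^ 3 = 1" for i
  proof -
    have "d i ^ 3 * c = 1 * c" using inv[of i i i] unfolding sd by (simp add: power3_eq_cube)
    then show ?thesis using nz(3) by (metis mult_right_cancel)
  qed
  \<comment> \<open>Up to the factor \<open>\<delta>\<close>, even permutations fix the coefficients
    \<open>a\<close> and \<open>b\<close> of \<open>w\<close>, and odd ones exchange them. Hence
    \<open>\<delta>\<close> or its square is 1, and \<open>\<delta>^3 = 1\<close> leaves
    \<open>\<delta> = 1\<close> in both cases.\<close>
  define \<delta> where "\<delta> = d 0 * d 1 * d 2"
  have i1: "\<delta> * skl a b c (k 0) (k 1) (k 2) = a" and i2: "\<delta> * skl a b c (k 0) (k 2) (k 1) = b"
    using inv[of 0 1 2] inv[of 0 2 1] by (simp_all add: \<delta>_def skl_def mult_ac)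
  have \<delta>3: "\<delta>^3 = 1" by (simp add: \<delta>_def power_mult_distrib d3)
  define t where "t = inverse (3::'a)"
  have t: "3 * t = 1" using three by (simp add: t_def)
  have even: False if \<delta>: "\<delta> = 1" and k: "(k 0 = 0 \<and> k 1 = 1 \<and> k 2 = 2) \<or> (k 0 = 1 \<and> k 1 = 2 \<and> k 2 = 0) \<or> (k 0 = 2 \<and> k 1 = 0 \<and> k 2 = 1)"
    using k
  proof (elim disjE conjE)
    assume k: "k 0 = 0" "k 1 = 1" "k 2 = 2"
    \<comment> \<open>The other two diagonal entries are cube roots of unity with product 1, so a
      cyclic relabelling by \<open>i\<close> brings the diagonal into the form required by the clock
      case.\<close>
    have shift: False if i: "d i = 1" "d (i + 1) \<noteq> 1" for i
    proof (rule web_clock_basis_False[OF assms(2) ns, of "\<lambda>x y. kd (x + i) y" "\<lambda>x y. kd x (y + i)" "\<lambda>x. d (x + i)"])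
      have "d i * d (1 + i) * d (2 + i) = 1"
      proof -
        have "\<forall>i. d i * d (1 + i) * d (2 + i) = 1"
          using \<delta>[unfolded \<delta>_def] by (simp add: forall_3' mult_ac)
        then show ?thesis by blast
      qed
      then have p: "d (1 + i) * d (2 + i) = 1" using i by simp
      then show "d (1 + i) * d (2 + i) = 1" .
      have "d (1 + i) * (d (1 + i) * d (1 + i)) = d (1 + i) * d (2 + i)"
        using d3[of "1 + i"] p by (simp add: power3_eq_cube mult.assoc)
      then show "d (1 + i) * d (1 + i) = d (2 + i)" using d0 by simp
      have "d (2 + i) * (d (2 + i) * d (2 + i)) = d (2 + i) * d (1 + i)"
        using d3[of "2 + i"] p by (simp add: power3_eq_cube mult.assoc mult.commute)
      then show "d (2 + i) * d (2 + i) = d (1 + i)" using d0 by simp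
      show "d (0 + i) = 1" "d (1 + i) \<noteq> 1" using i by (simp_all add: add.commute)
      show "(\<Sum>j\<in>UNIV. kd (x + i) j * kd j (y + i)) = kd x y" for x y
        unfolding kd_sum by (simp add: kd_def)
      show "(\<Sum>a\<in>UNIV. M x a * kd a (y + i)) = kd x (y + i) * d (y + i)" for x y
      proof -
        have "k x = x" for x
        proof -
          have "\<forall>x. k x = x" using k by (simp add: forall_3')
          then show ?thesis by blast
        qed
        then have "(\<Sum>a\<in>UNIV. M x a * kd a (y + i)) = d x * kd x (y + i)" unfolding kd_sum by (simp add: M)
        then show ?thesis by (simp add: kd_def)
      qed
    qed
    have kx: "k x = x" for x
    proof -
      have "\<forall>x. k x = x" using k by (simp add: forall_3')
      then show ?thesis by blast
    qed
    have N: "N i i = d i ^ 2" for i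
    proof -
      have "d i * N i i = d i * d i ^ 2" using Nfix[OF kx[of i]] d3[of i] by (simp add: power3_eq_cube power2_eq_square mult.assoc)
      then show ?thesis using d0 by simp
    qed
    have tr: "d 0 ^ 2 + d 1 ^ 2 + d 2 ^ 2 = d 0 + d 1 + d 2"
      using trace_eq by (simp add: sum_3' N M kx)
    have all1: False if "d 0 = 1" "d 1 = 1" "d 2 = 1"
    proof -
      have "d x = 1" for x
      proof -
        have "\<forall>x. d x = 1" using that by (simp add: forall_3')
        then show ?thesis by blast
      qed
      then have "M = kd" by (intro ext) (simp add: M kx)
      then show False using web_identity_False[OF tA _ two] assms(2) by blast
    qed
    have quad: "x^2 + x + 1 = 0" if "x^3 = 1" "x \<noteq> 1" for x :: 'a
    proof -
      have "(x - 1) * (x^2 + x + 1) = 0" using that(1) by algebra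
      then show ?thesis using that(2) by simp
    qed
    have prod: "d 0 * d 1 * d 2 = 1" using \<delta> by (simp add: \<delta>_def)
    show False
    proof (cases "d 0 = 1 \<or> d 1 = 1 \<or> d 2 = 1")
      case True
      then show False
        using shift[of 0] shift[of 1] shift[of 2] all1 prod by auto
    next
      case False
      \<comment> \<open>No diagonal entry is 1, so all are primitive cube roots of unity with
        product 1. They must be equal, and \<open>M\<close> is a nontrivial scalar, which only the
        traces can exclude.\<close>
      note q0' = quad[OF d3[of 0]] and q1' = quad[OF d3[of 1]] and q2' = quad[OF d3[of 2]]
      have eq: "x = y" if "x^2 + x + 1 = 0" "y^2 + y + 1 = 0" "x * y \<noteq> 1" for x y :: 'a
      proof (rule ccontr)
        assume "x \<noteq> y"
        have "(x - y) * (x * y - 1) = 0" using that(1,2) by algebra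
        then show False using that(3) \<open>x \<noteq> y\<close> by simp
      qed
      have "d 0 * d 1 \<noteq> 1" "d 1 * d 2 \<noteq> 1"
        using prod False by (auto simp: mult.assoc) (auto simp flip: mult.assoc)
      then have "d 0 = d 1" "d 1 = d 2"
        using eq q0' q1' q2' False by blast+
      then have e: "d 1 = d 0" "d 2 = d 0" by simp_all
      have "3 * (d 0 * (d 0 - 1)) = (d 0 ^ 2 + d 0 ^ 2 + d 0 ^ 2) - (d 0 + d 0 + d 0)" by algebra
      also have "\<dots> = 0" using tr unfolding e by simp
      finally have "3 * (d 0 * (d 0 - 1)) = 0" .
      then show False using three d0[of 0] False by simp
    qed
  next
    assume k: "k 0 = 1" "k 1 = 2" "k 2 = 0"
    define \<mu> where "\<mu> = clock \<omega>"
    \<comment> \<open>The columns of \<open>h\<close> are eigenvectors of the weighted 3-cycle, one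
      for each cube root of unity, normalised to 1 at index 0; the powers of \<open>d\<close> arise
      along the cycle. All entries have cube 1, and \<open>g\<close> is \<open>t\<close> times the
      transposed matrix of reciprocals.\<close>
    define h where "h i j = (if i = 0 then 1 else if i = 1 then \<mu> j * d 0 ^ 2 else \<mu> j ^ 2 * d 2)" for i j :: 3
    define g where "g j i = (if i = 0 then t else if i = 1 then t * d 0 * \<mu> j ^ 2 else t * d 2 ^ 2 * \<mu> j)" for i j :: 3
    show False
    proof (rule web_clock_basis_False[OF assms(2) ns, of g h \<mu>])
      show "(\<Sum>j\<in>UNIV. g i j * h j k) = kd i k" for i k
      proof -
        have "g i 0 * h 0 k + g i 1 * h 1 k + g i 2 * h 2 k = t * (1 + \<mu> i ^ 2 * \<mu> k + \<mu> i * \<mu> k ^ 2)"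
          using d3[of 0] d3[of 2] unfolding g_def h_def by (simp, algebra)
        then show ?thesis by (simp add: sum_3' \<mu>_def clock_orthogonal[OF \<omega> t])
      qed
      show "(\<Sum>a\<in>UNIV. M i a * h a j) = h i j * \<mu> j" for i j
      proof -
        have m3: "\<mu> j ^ 3 = 1"
        proof -
          have "\<omega>^6 = 1" using w3 by algebra
          then have "\<forall>j. \<mu> j ^ 3 = 1" using w3 by (simp add: \<mu>_def forall_3')
          then show ?thesis by blast
        qed
        have "\<forall>i. d i * h (k i) j = h i j * \<mu> j"
        proof -
          have "d 0 * (\<mu> j * d 0 ^ 2) = \<mu> j" using d3[of 0] by algebra
          moreover have "d 1 * (\<mu> j ^ 2 * d 2) = \<mu> j * d 0 ^ 2 * \<mu> j"
            using d3[of 0] \<delta>[unfolded \<delta>_def] by algebra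
          moreover have "d 2 = \<mu> j ^ 2 * d 2 * \<mu> j" using m3 by algebra
          ultimately show ?thesis unfolding forall_3' k by (simp add: h_def)
        qed
        then show ?thesis unfolding M by (simp add: mult.assoc sum_distrib_left[symmetric])
      qed
      show "\<mu> 0 = 1" "\<mu> 1 * \<mu> 1 = \<mu> 2" "\<mu> 2 * \<mu> 2 = \<mu> 1" "\<mu> 1 * \<mu> 2 = 1" "\<mu> 1 \<noteq> 1"
        using w3 w1 unfolding \<mu>_def by (simp_all add: power2_eq_square power3_eq_cube mult.assoc)
    qed
  next
    assume k: "k 0 = 2" "k 1 = 0" "k 2 = 1"
    define \<mu> where "\<mu> = clock \<omega>"
    define h where "h i j = (if i = 0 then 1 else if i = 1 then \<mu> j ^ 2 * d 1 else \<mu> j * d 1 * d 2)" for i j :: 3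
    define g where "g j i = (if i = 0 then t else if i = 1 then t * d 1 ^ 2 * \<mu> j else t * d 1 ^ 2 * d 2 ^ 2 * \<mu> j ^ 2)" for i j :: 3
    show False
    proof (rule web_clock_basis_False[OF assms(2) ns, of g h \<mu>])
      show "(\<Sum>j\<in>UNIV. g i j * h j k) = kd i k" for i k
      proof -
        have "g i 0 * h 0 k + g i 1 * h 1 k + g i 2 * h 2 k = t * (1 + \<mu> i ^ 2 * \<mu> k + \<mu> i * \<mu> k ^ 2)"
          using d3[of 1] d3[of 2] unfolding g_def h_def by (simp, algebra)
        then show ?thesis by (simp add: sum_3' \<mu>_def clock_orthogonal[OF \<omega> t])
      qed
      show "(\<Sum>a\<in>UNIV. M i a * h a j) = h i j * \<mu> j" for i j
      proof -
        have m3: "\<mu> j ^ 3 = 1"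
        proof -
          have "\<omega>^6 = 1" using w3 by algebra
          then have "\<forall>j. \<mu> j ^ 3 = 1" using w3 by (simp add: \<mu>_def forall_3')
          then show ?thesis by blast
        qed
        have "\<forall>i. d i * h (k i) j = h i j * \<mu> j"
        proof -
          have "d 0 * (\<mu> j * d 1 * d 2) = \<mu> j" using \<delta>[unfolded \<delta>_def] by algebra
          moreover have "d 1 = \<mu> j ^ 2 * d 1 * \<mu> j" using m3 by algebra
          moreover have "d 2 * (\<mu> j ^ 2 * d 1) = \<mu> j * d 1 * d 2 * \<mu> j" by algebra
          ultimately show ?thesis unfolding forall_3' k by (simp add: h_def)
        qed
        then show ?thesis unfolding M by (simp add: mult.assoc sum_distrib_left[symmetric])
      qed
      show "\<mu> 0 = 1" "\<mu> 1 * \<mu> 1 = \<mu> 2" "\<mu> 2 * \<mu> 2 = \<mu> 1" "\<mu> 1 * \<mu> 2 = 1" "\<mu> 1 \<noteq> 1"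
        using w3 w1 unfolding \<mu>_def by (simp_all add: power2_eq_square power3_eq_cube mult.assoc)
    qed
  qed
  have odd: False if k: "k i = i" "k (i + 1) = i + 2" "k (i + 2) = i + 1" and \<delta>: "d i * d (i + 1) * d (i + 2) = 1" for i
  proof -
    define s where "s = inverse (2::'a)"
    have s: "2 * s = 1" using two by (simp add: s_def)
    have S3: "(\<Sum>j\<in>UNIV. f j) = f i + f (i + 1) + f (i + 2)" for f :: "3 \<Rightarrow> 'a"
    proof -
      have "\<forall>i. (\<Sum>j\<in>UNIV. f j) = f i + f (i + 1) + f (i + 2)" by (simp add: forall_3' sum_3' add_ac)
      then show ?thesis by blast
    qed
    have A3: "x = i \<or> x = i + 1 \<or> x = i + 2" for x
    proof -
      have "\<forall>i x::3. x = i \<or> x = i + 1 \<or> x = i + 2" by (simp add: forall_3')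
      then show ?thesis by blast
    qed
    have "(\<Sum>j\<in>UNIV. M j j) = d i" "(\<Sum>j\<in>UNIV. N j j) = N i i"
      using Nmov[of "i + 1"] Nmov[of "i + 2"] unfolding S3 M k by (simp_all add: kd_def)
    \<comment> \<open>The diagonals of \<open>M\<close> and \<open>N\<close> are supported at the
      fixed index \<open>i\<close>, so equal traces mean that \<open>d i\<close> is its own
      inverse.\<close>
    then have "d i * d i = 1" using trace_eq Nfix[OF k(1)] by simp
    then have di: "d i = 1" using d3[of i] by (simp add: power3_eq_cube)
    have dd: "d (i + 1) * d (i + 2) = 1" using \<delta> di by simp
    \<comment> \<open>Column 0 is the fixed basis vector. Columns 1 and 2 are the symmetric and
      antisymmetric eigenvectors of the weighted transposition, with entries
      \<open>d (i + 1)\<close> and \<open>1\<close> or \<open>- 1\<close>.\<close>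
    define h where "h x j = (if j = 0 then kd i x else if x = i + 1 then d (i + 1) else if x = i + 2 then (if j = 1 then 1 else - 1) else 0)" for x j :: 3
    define g where "g j x = (if j = 0 then kd i x else if x = i + 1 then s * d (i + 2) else if x = i + 2 then (if j = 1 then s else - s) else 0)" for x j :: 3
    show False
    proof (rule web_reflection_basis_False[OF assms(2) two, of g h "\<lambda>j. if j = 2 then - 1 else 1"])
      have "\<forall>x y. g x i * h i y + g x (i + 1) * h (i + 1) y + g x (i + 2) * h (i + 2) y = kd x y"
      proof -
        have A: "s * d (i + 2) * d (i + 1) = s" using dd by (simp only: mult.assoc mult.commute[of "d (i + 2)"] mult_1_right)
        have B: "s + s = 1" using s by (simp only: mult_2)
        show ?thesis unfolding forall_3' g_def h_def kd_def by (simp add: A B)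
      qed
      then show "(\<Sum>j\<in>UNIV. g x j * h j y) = kd x y" for x y unfolding S3 by blast
      have "d x * h (k x) y = h x y * (if y = 2 then - 1 else 1)" for x y
      proof -
        have "\<forall>y. d x * h (k x) y = h x y * (if y = 2 then - 1 else 1)"
          using A3[of x]
        proof (elim disjE)
          assume x: "x = i"
          show ?thesis unfolding x k h_def kd_def di by (simp add: forall_3')
        next
          assume x: "x = i + 1"
          show ?thesis unfolding x k h_def kd_def by (simp add: forall_3')
        next
          assume x: "x = i + 2"
          show ?thesis unfolding x k h_def kd_def using dd by (simp add: forall_3' mult.commute)
        qed
        then show ?thesis by blast
      qed
      then show "(\<Sum>a\<in>UNIV. M x a * h a y) = h x y * (if y = 2 then - 1 else 1)" for x y
        unfolding M by (simp add: mult.assoc sum_distrib_left[symmetric])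
    qed simp_all
  qed
  have ab: "\<delta> = 1" if "skl a b c (k 0) (k 1) (k 2) = b" "skl a b c (k 0) (k 2) (k 1) = a"
  proof -
    have "\<delta> * (\<delta> * a) = a" using i1 i2 that by simp
    then have "(\<delta> * \<delta>) * a = 1 * a" by (simp add: mult.assoc)
    then have "\<delta> * \<delta> = 1" using nz(1) by (metis mult_right_cancel)
    then show ?thesis using \<delta>3 by (simp add: power3_eq_cube)
  qed
  have kne: "k 0 \<noteq> k 1" "k 0 \<noteq> k 2" "k 1 \<noteq> k 2" using inj by (simp_all add: inj_eq)
  have 3: "x = 0 \<or> x = 1 \<or> x = 2" for x :: 3
  proof -
    have "\<forall>x::3. x = 0 \<or> x = 1 \<or> x = 2" by (simp add: forall_3')
    then show ?thesis by blast
  qed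
  consider (E) "(k 0 = 0 \<and> k 1 = 1 \<and> k 2 = 2) \<or> (k 0 = 1 \<and> k 1 = 2 \<and> k 2 = 0) \<or> (k 0 = 2 \<and> k 1 = 0 \<and> k 2 = 1)"
    | (O0) "k 0 = 0" "k 1 = 2" "k 2 = 1" | (O1) "k 1 = 1" "k 2 = 0" "k 0 = 2" | (O2) "k 2 = 2" "k 0 = 1" "k 1 = 0"
    using 3[of "k 0"] 3[of "k 1"] 3[of "k 2"] kne by auto
  then show False
  proof cases
    case E
    then have "skl a b c (k 0) (k 1) (k 2) = a" by (auto simp: skl_def)
    then have "\<delta> * a = 1 * a" using i1 by simp
    then have "\<delta> = 1" using nz(1) by (metis mult_right_cancel)
    then show False using even E by blast
  next
    case O0
    then have "\<delta> = 1" by (intro ab) (simp_all add: skl_def)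
    then show False using odd[of 0] O0 by (simp add: \<delta>_def mult_ac)
  next
    case O1
    then have "\<delta> = 1" by (intro ab) (simp_all add: skl_def)
    then show False using odd[of 1] O1 by (simp add: \<delta>_def mult_ac)
  next
    case O2
    then have "\<delta> = 1" by (intro ab) (simp_all add: skl_def)
    then show False using odd[of 2] O2 by (simp add: \<delta>_def mult_ac)
  qed
qed

section \<open>Degree two of quadratic algebras\<close>

lemma nc_T_add: "p \<in> nc_T \<Longrightarrow> r \<in> nc_T \<Longrightarrow> nc_add p r \<in> nc_T"
proof -
  assume p: "p \<in> nc_T" and r: "r \<in> nc_T"
  have "{w. p w + r w \<noteq> 0} \<subseteq> {w. p w \<noteq> 0} \<union> {w. r w \<noteq> 0}" by auto
  moreover have "finite ({w. p w \<noteq> 0} \<union> {w. r w \<noteq> 0})" using p r by (simp add: nc_T_def)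
  ultimately have "finite {w. p w + r w \<noteq> 0}" by (rule finite_subset)
  moreover have "\<forall>w. p w + r w \<noteq> 0 \<longrightarrow> set w \<subseteq> {..<3}"
    using p r by (metis (mono_tags, lifting) add.right_neutral mem_Collect_eq nc_T_def)
  ultimately show ?thesis by (simp add: nc_T_def nc_add_def)
qed

lemma nc_T_zero: "nc_zero \<in> nc_T"
  by (simp add: nc_T_def nc_zero_def)

lemma nc_T_mono: "set u \<subseteq> {..<3} \<Longrightarrow> nc_mono u \<in> nc_T"
  by (simp add: nc_T_def nc_mono_def)

lemma nc_T_smult: "p \<in> nc_T \<Longrightarrow> nc_smult c p \<in> nc_T"
proof -
  assume p: "p \<in> nc_T"
  have "{w. c * p w \<noteq> 0} \<subseteq> {w. p w \<noteq> 0}" by auto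
  then have "finite {w. c * p w \<noteq> 0}" using p by (auto simp: nc_T_def intro: finite_subset)
  then show ?thesis using p unfolding nc_T_def nc_smult_def
    by (auto simp del: mult_eq_0_iff) (metis mult_zero_right subsetD lessThan_iff)
qed

lemma nc_T_mul: "p \<in> nc_T \<Longrightarrow> r \<in> nc_T \<Longrightarrow> nc_mul p r \<in> nc_T"
proof -
  assume p: "p \<in> nc_T" and r: "r \<in> nc_T"
  have ex: "\<exists>u v. w = u @ v \<and> p u \<noteq> 0 \<and> r v \<noteq> 0" if w: "nc_mul p r w \<noteq> 0" for w
  proof -
    obtain i where "p (take i w) * r (drop i w) \<noteq> 0"
      using w unfolding nc_mul_def by (meson sum.not_neutral_contains_not_neutral)
    then show ?thesis
      by (intro exI[of _ "take i w"] exI[of _ "drop i w"]) auto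
  qed
  have "{w. nc_mul p r w \<noteq> 0} \<subseteq> (\<lambda>(u, v). u @ v) ` ({w. p w \<noteq> 0} \<times> {w. r w \<noteq> 0})"
    using ex by force
  moreover have "finite ((\<lambda>(u, v). u @ v) ` ({w. p w \<noteq> 0} \<times> {w. r w \<noteq> 0}))"
    using p r by (simp add: nc_T_def)
  ultimately have "finite {w. nc_mul p r w \<noteq> 0}" by (rule finite_subset)
  moreover have "set w \<subseteq> {..<3}" if w: "nc_mul p r w \<noteq> 0" for w
  proof -
    obtain u v where "w = u @ v" "p u \<noteq> 0" "r v \<noteq> 0" using ex[OF w] by blast
    then show ?thesis using p r by (simp add: nc_T_def)
  qed
  ultimately show ?thesis by (simp add: nc_T_def)
qed

text \<open>Elements of the ideal have no terms of degree below two, so multiplication by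
  \<open>a\<close> and \<open>b\<close> affects degree two only through their constant terms. The
  degree-two part therefore stays in any subspace \<open>L\<close> that contains the
  generators.\<close>

lemma nc_ideal_degree_two:
  assumes p: "p \<in> nc_ideal G"
    and G: "\<And>g. g \<in> G \<Longrightarrow> g \<in> nc_T \<and> nc_homog 2 g \<and> (\<lambda>i j. g [i, j]) \<in> L"
    and L0: "(\<lambda>i j. 0) \<in> L"
    and Ladd: "\<And>u v. u \<in> L \<Longrightarrow> v \<in> L \<Longrightarrow> (\<lambda>i j. u i j + v i j) \<in> L"
    and Lsc: "\<And>u c. u \<in> L \<Longrightarrow> (\<lambda>i j. c * u i j) \<in> L"
  shows "p \<in> nc_T \<and> p [] = 0 \<and> (\<forall>i. p [i] = 0) \<and> (\<lambda>i j. p [i, j]) \<in> L"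
  using p
proof induction
  case (gen g)
  then show ?case using G[of g] by (auto simp: nc_homog_def)
next
  case zero
  then show ?case using L0 nc_T_zero by (simp add: nc_zero_def)
next
  case (add p r)
  then show ?case using Ladd nc_T_add by (auto simp: nc_add_def)
next
  case (mul p a b)
  have "(\<lambda>i j. nc_mul (nc_mul a p) b [i, j]) = (\<lambda>i j. (a [] * b []) * p [i, j])"
    using mul.IH by (intro ext) (simp add: nc_mul_def numeral_2_eq_2 sum.atMost_Suc mult_ac)
  moreover have "nc_mul (nc_mul a p) b [] = 0" "nc_mul (nc_mul a p) b [i] = 0" for i
    using mul.IH by (simp_all add: nc_mul_def sum.atMost_Suc)
  moreover have "nc_mul (nc_mul a p) b \<in> nc_T"
    using mul by (intro nc_T_mul) auto
  ultimately show ?case using mul Lsc[of "\<lambda>i j. p [i, j]" "a [] * b []"] by auto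
qed

section \<open>Graded endomorphisms of the free algebra in low degree\<close>

locale graded_hom =
  fixes F :: "'a::field ncpoly \<Rightarrow> 'a ncpoly"
  assumes F_add: "\<And>p r. p \<in> nc_T \<Longrightarrow> r \<in> nc_T \<Longrightarrow> F (nc_add p r) = nc_add (F p) (F r)"
    and F_mul: "\<And>p r. p \<in> nc_T \<Longrightarrow> r \<in> nc_T \<Longrightarrow> F (nc_mul p r) = nc_mul (F p) (F r)"
    and F_smult: "\<And>c p. p \<in> nc_T \<Longrightarrow> F (nc_smult c p) = nc_smult c (F p)"
    and F_homog: "\<And>n p. p \<in> nc_T \<Longrightarrow> nc_homog n p \<Longrightarrow> nc_homog n (F p)"
begin

lemma F_sum:
  assumes "finite S" "\<And>u. u \<in> S \<Longrightarrow> set u \<subseteq> {..<3}"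
  shows "(\<lambda>w. \<Sum>u\<in>S. c u * nc_mono u w) \<in> nc_T \<and>
    F (\<lambda>w. \<Sum>u\<in>S. c u * nc_mono u w) = (\<lambda>w. \<Sum>u\<in>S. c u * F (nc_mono u) w)"
  using assms
proof (induction S rule: finite_induct)
  case empty
  have "F (nc_smult 0 nc_zero) = nc_smult 0 (F nc_zero)" by (rule F_smult[OF nc_T_zero])
  then show ?case using nc_T_zero by (simp add: nc_smult_def nc_zero_def)
next
  case (insert u S)
  have u: "nc_smult (c u) (nc_mono u) \<in> nc_T" by (rule nc_T_smult, rule nc_T_mono) (use insert in auto)
  have IH: "(\<lambda>w. \<Sum>u\<in>S. c u * nc_mono u w) \<in> nc_T"
    "F (\<lambda>w. \<Sum>u\<in>S. c u * nc_mono u w) = (\<lambda>w. \<Sum>u\<in>S. c u * F (nc_mono u) w)"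
    using insert by auto
  have eq: "(\<lambda>w. \<Sum>u\<in>insert u S. c u * nc_mono u w) = nc_add (nc_smult (c u) (nc_mono u)) (\<lambda>w. \<Sum>u\<in>S. c u * nc_mono u w)"
    using insert(1,2) by (simp add: nc_add_def nc_smult_def)
  have "F (nc_smult (c u) (nc_mono u)) = nc_smult (c u) (F (nc_mono u))"
    by (rule F_smult, rule nc_T_mono) (use insert in auto)
  then show ?case
    unfolding eq F_add[OF u IH(1)] IH(2) using insert(1,2) nc_T_add[OF u IH(1)]
    by (simp add: nc_add_def nc_smult_def)
qed

lemma F_expand:
  assumes p: "p \<in> nc_T"
  shows "F p w = (\<Sum>u\<in>{u. p u \<noteq> 0}. p u * F (nc_mono u) w)"
proof -
  have fin: "finite {u. p u \<noteq> 0}" using p by (simp add: nc_T_def)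
  have "p = (\<lambda>w. \<Sum>u\<in>{u. p u \<noteq> 0}. p u * nc_mono u w)"
    using fin by (intro ext) (simp add: nc_mono_def if_distrib cong: if_cong)
  then have "F p = F (\<lambda>w. \<Sum>u\<in>{u. p u \<noteq> 0}. p u * nc_mono u w)" by simp
  also have "\<dots> = (\<lambda>w. \<Sum>u\<in>{u. p u \<noteq> 0}. p u * F (nc_mono u) w)"
    using F_sum[of "{u. p u \<noteq> 0}" p] fin p by (auto simp: nc_T_def)
  finally show ?thesis by metis
qed

lemma F_mono_zero:
  assumes "set u \<subseteq> {..<3}" "length w \<noteq> length u"
  shows "F (nc_mono u) w = 0"
proof -
  have "nc_homog (length u) (nc_mono u :: 'a ncpoly)" by (simp add: nc_homog_def nc_mono_def)
  then have "nc_homog (length u) (F (nc_mono u))" by (rule F_homog[OF nc_T_mono[OF assms(1)]])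
  then show ?thesis using assms(2) by (auto simp: nc_homog_def)
qed

lemma F_degree_one:
  assumes p: "p \<in> nc_T"
  shows "F p [i] = (\<Sum>k<3. p [k] * F (nc_mono [k]) [i])"
proof -
  have fin: "finite {u. p u \<noteq> 0}" using p by (simp add: nc_T_def)
  have "F p [i] = (\<Sum>u\<in>{u. p u \<noteq> 0} \<union> (\<lambda>k. [k]) ` {..<3}. p u * F (nc_mono u) [i])"
    unfolding F_expand[OF p] by (rule sum.mono_neutral_left) (use fin in auto)
  also have "\<dots> = (\<Sum>u\<in>(\<lambda>k. [k]) ` {..<3}. p u * F (nc_mono u) [i])"
  proof (rule sum.mono_neutral_right)
    show "\<forall>u\<in>({u. p u \<noteq> 0} \<union> (\<lambda>k. [k]) ` {..<3}) - (\<lambda>k. [k]) ` {..<3}. p u * F (nc_mono u) [i] = 0"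
    proof
      fix u assume u: "u \<in> ({u. p u \<noteq> 0} \<union> (\<lambda>k. [k]) ` {..<3}) - (\<lambda>k. [k]) ` {..<3}"
      then have s: "set u \<subseteq> {..<3}" using p by (auto simp: nc_T_def)
      have "length u \<noteq> 1"
      proof
        assume "length u = 1"
        then obtain k where "u = [k]" by (auto simp: length_Suc_conv)
        then show False using u s by auto
      qed
      then show "p u * F (nc_mono u) [i] = 0" using F_mono_zero[OF s, of "[i]"] by simp
    qed
  qed (use fin in auto)
  also have "\<dots> = (\<Sum>k<3. p [k] * F (nc_mono [k]) [i])"
    by (subst sum.reindex) (auto simp: inj_on_def)
  finally show ?thesis .
qed

text \<open>As \<open>F\<close> preserves degree, only words of length two contribute, and on these
  multiplicativity expresses \<open>F\<close> through its matrix on the generators.\<close>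

lemma F_degree_two:
  assumes p: "p \<in> nc_T"
  shows "F p [i, j] = (\<Sum>k<3. \<Sum>l<3. p [k, l] * (F (nc_mono [k]) [i] * F (nc_mono [l]) [j]))"
proof -
  have fin: "finite {u. p u \<noteq> 0}" using p by (simp add: nc_T_def)
  let ?I = "(\<lambda>(k, l). [k, l]) ` ({..<3} \<times> {..<3})"
  have "F p [i, j] = (\<Sum>u\<in>{u. p u \<noteq> 0} \<union> ?I. p u * F (nc_mono u) [i, j])"
    unfolding F_expand[OF p] by (rule sum.mono_neutral_left) (use fin in auto)
  also have "\<dots> = (\<Sum>u\<in>?I. p u * F (nc_mono u) [i, j])"
  proof (rule sum.mono_neutral_right)
    show "\<forall>u\<in>({u. p u \<noteq> 0} \<union> ?I) - ?I. p u * F (nc_mono u) [i, j] = 0"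
    proof
      fix u assume u: "u \<in> ({u. p u \<noteq> 0} \<union> ?I) - ?I"
      then have s: "set u \<subseteq> {..<3}" using p by (auto simp: nc_T_def)
      have "length u \<noteq> 2"
      proof
        assume "length u = 2"
        then obtain k l where "u = [k, l]" by (auto simp: length_Suc_conv numeral_2_eq_2)
        then show False using u s by auto
      qed
      then show "p u * F (nc_mono u) [i, j] = 0" using F_mono_zero[OF s, of "[i, j]"] by simp
    qed
  qed (use fin in auto)
  also have "\<dots> = (\<Sum>(k, l)\<in>{..<3} \<times> {..<3}. p [k, l] * F (nc_mono [k, l]) [i, j])"
    by (subst sum.reindex) (auto simp: inj_on_def case_prod_beta)
  also have "\<dots> = (\<Sum>(k, l)\<in>{..<3} \<times> {..<3}. p [k, l] * (F (nc_mono [k]) [i] * F (nc_mono [l]) [j]))"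
  proof (rule sum.cong[OF refl], clarify)
    fix k l :: nat assume kl: "k < 3" "l < 3"
    have "nc_mono [k, l] = nc_mul (nc_mono [k]) (nc_mono [l] :: 'a ncpoly)"
    proof
      fix w :: "nat list"
      have "nc_mul (nc_mono [k]) (nc_mono [l] :: 'a ncpoly) w = (\<Sum>m\<le>length w. if take m w = [k] \<and> drop m w = [l] then 1 else 0)"
        unfolding nc_mul_def nc_mono_def by (rule sum.cong) auto
      also have "\<dots> = (if w = [k, l] then 1 else 0)"
      proof (cases "w = [k, l]")
        case True
        then show ?thesis by (simp add: numeral_2_eq_2 sum.atMost_Suc)
      next
        case False
        have "\<not> (take m w = [k] \<and> drop m w = [l])" for m
          using False append_take_drop_id[of m w] by (metis append_Cons append_Nil)
        then have "(\<Sum>m\<le>length w. if take m w = [k] \<and> drop m w = [l] then 1 else 0) = (0::'a)"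
          by (intro sum.neutral) simp
        then show ?thesis using False by simp
      qed
      finally show "nc_mono [k, l] w = nc_mul (nc_mono [k]) (nc_mono [l] :: 'a ncpoly) w"
        by (simp add: nc_mono_def)
    qed
    then have "F (nc_mono [k, l]) = nc_mul (F (nc_mono [k])) (F (nc_mono [l]))"
      using F_mul[OF nc_T_mono[of "[k]"] nc_T_mono[of "[l]"]] kl by simp
    then show "p [k, l] * F (nc_mono [k, l]) [i, j] = p [k, l] * (F (nc_mono [k]) [i] * F (nc_mono [l]) [j])"
      using kl by (simp add: nc_mul_def numeral_2_eq_2 sum.atMost_Suc F_mono_zero)
  qed
  finally show ?thesis by (simp add: sum.cartesian_product)
qed

lemma F_zero: "F nc_zero = nc_zero"
proof -
  have "F (nc_smult 0 nc_zero) = nc_smult 0 (F nc_zero)" by (rule F_smult[OF nc_T_zero])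
  then show ?thesis by (simp add: nc_smult_def nc_zero_def)
qed

end

section \<open>Letters as elements of the index type\<close>

definition ix :: "3 \<Rightarrow> nat" where
  "ix i = (if i = 0 then 0 else if i = 1 then 1 else 2)"

definition xi :: "nat \<Rightarrow> 3" where
  "xi n = (if n = 0 then 0 else if n = 1 then 1 else 2)"

lemma xi_ix [simp]: "xi (ix i) = i"
proof -
  have "\<forall>i. xi (ix i) = i" by (simp add: forall_3' xi_def ix_def)
  then show ?thesis by blast
qed

lemma ix_less [simp]: "ix i < 3"
  by (simp add: ix_def)

lemma sum_ix: "(\<Sum>k<3. f k) = (\<Sum>i\<in>UNIV. f (ix i))"
proof -
  have "{..<3::nat} = {0, 1, 2}" by auto
  then show ?thesis by (simp add: sum_3' ix_def add.assoc)
qed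

lemma quad_elem_T: "quad_elem v \<in> nc_T"
proof -
  have "{w. quad_elem v w \<noteq> 0} \<subseteq> {w. set w \<subseteq> {..<3} \<and> length w = 2}" by (auto simp: quad_elem_def split: if_splits)
  moreover have "finite {w. set w \<subseteq> {..<3::nat} \<and> length w = 2}" by (rule finite_lists_length_eq) simp
  ultimately have "finite {w. quad_elem v w \<noteq> 0}" by (rule finite_subset)
  then show ?thesis by (auto simp: nc_T_def quad_elem_def split: if_splits)
qed

lemma quad_elem_homog: "nc_homog 2 (quad_elem v)"
  by (auto simp: nc_homog_def quad_elem_def split: if_splits)

lemma quad_elem_eval: "quad_elem v [ix i, ix j] = v (ix i) (ix j)"
  by (simp add: quad_elem_def)

lemma skl_rel_T: "n < 3 \<Longrightarrow> skl_rel a b c n \<in> nc_T"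
proof -
  assume n: "n < 3"
  have "skl_rel a b c n = nc_add (nc_add (nc_smult a (nc_mono [(n + 1) mod 3, (n + 2) mod 3])) (nc_smult b (nc_mono [(n + 2) mod 3, (n + 1) mod 3]))) (nc_smult c (nc_mono [n, n]))"
    by (simp only: skl_rel_def nc_add_def nc_smult_def)
  moreover have "set [(n + 1) mod 3, (n + 2) mod 3] \<subseteq> {..<3}" "set [(n + 2) mod 3, (n + 1) mod 3] \<subseteq> {..<3}" "set [n, n] \<subseteq> {..<3}"
    using n by auto
  ultimately show ?thesis by (simp only:) (intro nc_T_add nc_T_smult nc_T_mono)
qed

lemma skl_rel_homog:
  fixes a b c :: "'a::comm_ring_1"
  shows "nc_homog 2 (skl_rel a b c n)"
  unfolding nc_homog_def
proof (intro allI impI, rule ccontr)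
  fix w assume w: "skl_rel a b c n w \<noteq> 0" and len: "length w \<noteq> 2"
  have "nc_mono [x, y] w = (0::'a)" for x y using len by (auto simp: nc_mono_def)
  then show False using w by (simp only: skl_rel_def mult_zero_right add_0_left simp_thms)
qed

lemma ix_simps: "ix 0 = 0" "ix 1 = 1" "ix 2 = 2" by (simp_all add: ix_def)

lemma mod3_sums: "(0 + 1) mod 3 = (1::nat)" "(0 + 2) mod 3 = (2::nat)" "(1+1) mod 3 = (2::nat)" "(1+2) mod 3 = (0::nat)" "(2+1) mod 3 = (0::nat)" "(2+2) mod 3 = (1::nat)" by simp_all

lemma skl_rel_eval: "skl_rel a b c (ix n) [ix i, ix j] = skl a b c n i j"
proof -
  have 0: "skl_rel a b c 0 w = a * nc_mono [1, 2] w + b * nc_mono [2, 1] w + c * nc_mono [0, 0] w"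
    "skl_rel a b c 1 w = a * nc_mono [2, 0] w + b * nc_mono [0, 2] w + c * nc_mono [1, 1] w"
    "skl_rel a b c 2 w = a * nc_mono [0, 1] w + b * nc_mono [1, 0] w + c * nc_mono [2, 2] w" for w
    unfolding skl_rel_def mod3_sums by (rule refl)+
  have "\<forall>n i j. skl_rel a b c (ix n) [ix i, ix j] = skl a b c n i j"
    unfolding forall_3' ix_simps 0 by (simp add: nc_mono_def skl_def)
  then show ?thesis by blast
qed

text \<open>\<open>opA r q\<close> is the operator \<open>R - q\<close>.\<close>

definition opA :: "(3 \<Rightarrow> 3 \<Rightarrow> 3 \<Rightarrow> 3 \<Rightarrow> 'a::comm_ring_1) \<Rightarrow> 'a \<Rightarrow> (3 \<Rightarrow> 3 \<Rightarrow> 'a) \<Rightarrow> 3 \<Rightarrow> 3 \<Rightarrow> 'a" where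
  "opA r q v i j = (\<Sum>k\<in>UNIV. \<Sum>l\<in>UNIV. r i j k l * v k l) - q * v i j"

lemma opA_add: "opA r q (\<lambda>i j. u i j + v i j) i j = opA r q u i j + opA r q v i j"
  by (simp add: opA_def distrib_left sum.distrib)

lemma opA_scale: "opA r q (\<lambda>i j. c * v i j) i j = c * opA r q v i j"
  by (simp add: opA_def right_diff_distrib sum_distrib_left mult_ac)

lemma applyR_ix: "applyR R v (ix i) (ix j) = (\<Sum>k\<in>UNIV. \<Sum>l\<in>UNIV. R (ix i) (ix j) (ix k) (ix l) * v (ix k) (ix l))"
  unfolding applyR_def sum_ix by (rule refl)

text \<open>\<open>g\<close> is the matrix of the isomorphism in degree one. Comparing the ideals in
  degree two, \<open>g \<otimes> g\<close> carries the image of \<open>R - q\<close> onto the span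
  of the Sklyanin slices; the last two conclusions are the two inclusions.\<close>

lemma graded_iso_degree_two:
  fixes R :: "nat \<Rightarrow> nat \<Rightarrow> nat \<Rightarrow> nat \<Rightarrow> 'a::field"
  defines "r \<equiv> \<lambda>i j k l. R (ix i) (ix j) (ix k) (ix l)"
  assumes iso: "nc_graded_iso (nc_ideal (S_rels R q)) (nc_ideal (Skl_rels a b c))"
  obtains g where "\<And>x. (\<And>i. (\<Sum>j\<in>UNIV. g i j * x j) = 0) \<Longrightarrow> \<forall>j. x j = 0"
    "\<And>v. \<exists>y. \<forall>i j. (\<Sum>k\<in>UNIV. \<Sum>l\<in>UNIV. g i k * g j l * opA r q v k l) = (\<Sum>n\<in>UNIV. y n * skl a b c n i j)"
    "\<And>n. \<exists>v. \<forall>i j. (\<Sum>k\<in>UNIV. \<Sum>l\<in>UNIV. g i k * g j l * opA r q v k l) = skl a b c n i j"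
proof -
  from iso obtain F :: "'a ncpoly \<Rightarrow> 'a ncpoly" where bij: "bij_betw F nc_T nc_T"
    and F1: "\<forall>p\<in>nc_T. \<forall>r\<in>nc_T. F (nc_add p r) = nc_add (F p) (F r)"
    and F2: "\<forall>p\<in>nc_T. \<forall>r\<in>nc_T. F (nc_mul p r) = nc_mul (F p) (F r)"
    and F3: "\<forall>c. \<forall>p\<in>nc_T. F (nc_smult c p) = nc_smult c (F p)"
    and F4: "\<forall>n. \<forall>p\<in>nc_T. nc_homog n p \<longrightarrow> nc_homog n (F p)"
    and img: "F ` nc_ideal (S_rels R q) = nc_ideal (Skl_rels a b c)"
    unfolding nc_graded_iso_def by (elim exE conjE)
  have F: "graded_hom F"
    unfolding graded_hom_def using F1 F2 F3 F4 by simp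
  interpret graded_hom F by (rule F)
  define g where "g i k = F (nc_mono [ix k]) [ix i]" for i k
  have ev2: "F p [ix i, ix j] = (\<Sum>k\<in>UNIV. \<Sum>l\<in>UNIV. g i k * g j l * p [ix k, ix l])" if "p \<in> nc_T" for p i j
    unfolding F_degree_two[OF that] sum_ix g_def by (simp add: mult_ac)
  have L: "p \<in> nc_T \<and> p [] = 0 \<and> (\<forall>i. p [i] = 0) \<and> (\<lambda>i j. p [i, j]) \<in> {u. \<exists>v. \<forall>i j. u (ix i) (ix j) = opA r q v i j}"
    if "p \<in> nc_ideal (S_rels R q)" for p
  proof (rule nc_ideal_degree_two[OF that])
    fix e assume "e \<in> S_rels R q"
    then obtain v where e: "e = quad_elem (\<lambda>i j. applyR R v i j - q * v i j)" by (auto simp: S_rels_def)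
    have "\<forall>i j. e [ix i, ix j] = opA r q (\<lambda>i j. v (ix i) (ix j)) i j"
      unfolding e quad_elem_eval applyR_ix opA_def r_def by simp
    then show "e \<in> nc_T \<and> nc_homog 2 e \<and> (\<lambda>i j. e [i, j]) \<in> {u. \<exists>v. \<forall>i j. u (ix i) (ix j) = opA r q v i j}"
      using e quad_elem_T quad_elem_homog by blast
  next
    show "(\<lambda>i j. 0) \<in> {u. \<exists>v. \<forall>i j. u (ix i) (ix j) = opA r q v i j}"
      by (auto intro!: exI[of _ "\<lambda>_ _. 0"] simp: opA_def)
  next
    fix u v :: "nat \<Rightarrow> nat \<Rightarrow> 'a"
    assume "u \<in> {u. \<exists>v. \<forall>i j. u (ix i) (ix j) = opA r q v i j}" "v \<in> {u. \<exists>v. \<forall>i j. u (ix i) (ix j) = opA r q v i j}"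
    then obtain u' v' where "\<forall>i j. u (ix i) (ix j) = opA r q u' i j" "\<forall>i j. v (ix i) (ix j) = opA r q v' i j" by blast
    then have "\<forall>i j. u (ix i) (ix j) + v (ix i) (ix j) = opA r q (\<lambda>i j. u' i j + v' i j) i j"
      by (simp add: opA_add)
    then show "(\<lambda>i j. u i j + v i j) \<in> {u. \<exists>v. \<forall>i j. u (ix i) (ix j) = opA r q v i j}" by blast
  next
    fix u :: "nat \<Rightarrow> nat \<Rightarrow> 'a" and d
    assume "u \<in> {u. \<exists>v. \<forall>i j. u (ix i) (ix j) = opA r q v i j}"
    then obtain u' where "\<forall>i j. u (ix i) (ix j) = opA r q u' i j" by blast
    then have "\<forall>i j. d * u (ix i) (ix j) = opA r q (\<lambda>i j. d * u' i j) i j"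
      by (simp add: opA_scale)
    then show "(\<lambda>i j. d * u i j) \<in> {u. \<exists>v. \<forall>i j. u (ix i) (ix j) = opA r q v i j}" by blast
  qed
  have L': "p \<in> nc_T \<and> p [] = 0 \<and> (\<forall>i. p [i] = 0) \<and> (\<lambda>i j. p [i, j]) \<in> {u. \<exists>y. \<forall>i j. u (ix i) (ix j) = (\<Sum>n\<in>UNIV. y n * skl a b c n i j)}"
    if "p \<in> nc_ideal (Skl_rels a b c)" for p
  proof (rule nc_ideal_degree_two[OF that])
    fix e assume "e \<in> Skl_rels a b c"
    then obtain n where n: "n < 3" and e: "e = skl_rel a b c n" by (auto simp: Skl_rels_def)
    have ixn: "ix (xi n) = n" using n by (auto simp: ix_def xi_def)
    have "\<forall>i j. e [ix i, ix j] = (\<Sum>m\<in>UNIV. kd m (xi n) * skl a b c m i j)"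
      using skl_rel_eval[of a b c "xi n"] by (simp add: e ixn)
    then have m: "(\<lambda>i j. e [i, j]) \<in> {u. \<exists>y. \<forall>i j. u (ix i) (ix j) = (\<Sum>n\<in>UNIV. y n * skl a b c n i j)}"
      unfolding mem_Collect_eq by (rule exI[of _ "\<lambda>m. kd m (xi n)"])
    show "e \<in> nc_T \<and> nc_homog 2 e \<and> (\<lambda>i j. e [i, j]) \<in> {u. \<exists>y. \<forall>i j. u (ix i) (ix j) = (\<Sum>n\<in>UNIV. y n * skl a b c n i j)}"
      by (intro conjI m) (unfold e, rule skl_rel_T[OF n], rule skl_rel_homog)
  next
    show "(\<lambda>i j. 0) \<in> {u. \<exists>y. \<forall>i j. u (ix i) (ix j) = (\<Sum>n\<in>UNIV. y n * skl a b c n i j)}"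
      by (auto intro!: exI[of _ "\<lambda>_. 0"])
  next
    fix u v :: "nat \<Rightarrow> nat \<Rightarrow> 'a"
    assume "u \<in> {u. \<exists>y. \<forall>i j. u (ix i) (ix j) = (\<Sum>n\<in>UNIV. y n * skl a b c n i j)}" "v \<in> {u. \<exists>y. \<forall>i j. u (ix i) (ix j) = (\<Sum>n\<in>UNIV. y n * skl a b c n i j)}"
    then obtain u' v' where "\<forall>i j. u (ix i) (ix j) = (\<Sum>n\<in>UNIV. u' n * skl a b c n i j)" "\<forall>i j. v (ix i) (ix j) = (\<Sum>n\<in>UNIV. v' n * skl a b c n i j)" by blast
    then have "\<forall>i j. u (ix i) (ix j) + v (ix i) (ix j) = (\<Sum>n\<in>UNIV. (u' n + v' n) * skl a b c n i j)"
      by (simp add: distrib_right sum.distrib)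
    then show "(\<lambda>i j. u i j + v i j) \<in> {u. \<exists>y. \<forall>i j. u (ix i) (ix j) = (\<Sum>n\<in>UNIV. y n * skl a b c n i j)}"
      by (auto intro!: exI[of _ "\<lambda>n. u' n + v' n"])
  next
    fix u :: "nat \<Rightarrow> nat \<Rightarrow> 'a" and d
    assume "u \<in> {u. \<exists>y. \<forall>i j. u (ix i) (ix j) = (\<Sum>n\<in>UNIV. y n * skl a b c n i j)}"
    then obtain u' where "\<forall>i j. u (ix i) (ix j) = (\<Sum>n\<in>UNIV. u' n * skl a b c n i j)" by blast
    then have "\<forall>i j. d * u (ix i) (ix j) = (\<Sum>n\<in>UNIV. (d * u' n) * skl a b c n i j)"
      by (simp add: sum_distrib_left mult.assoc)
    then show "(\<lambda>i j. d * u i j) \<in> {u. \<exists>y. \<forall>i j. u (ix i) (ix j) = (\<Sum>n\<in>UNIV. y n * skl a b c n i j)}"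
      by (auto intro!: exI[of _ "\<lambda>n. d * u' n"])
  qed
  show ?thesis
  proof (rule that[of g])
    fix x assume x: "\<And>i. (\<Sum>j\<in>UNIV. g i j * x j) = 0"
    define p where "p = (\<lambda>w. \<Sum>u\<in>(\<lambda>j. [ix j]) ` UNIV. x (xi (hd u)) * nc_mono u w)"
    have pT: "p \<in> nc_T" unfolding p_def by (rule conjunct1[OF F_sum]) auto
    have inj: "inj (\<lambda>j. [ix j])" by (rule injI) (metis list.inject xi_ix)
    have ev: "p [ix j] = x j" for j
      unfolding p_def by (subst sum.reindex[OF inj]) (auto simp: nc_mono_def if_distrib inj_eq[OF inj, simplified] cong: if_cong)
    have len: "p w = 0" if "length w \<noteq> 1" for w
      unfolding p_def by (rule sum.neutral) (use that in \<open>auto simp: nc_mono_def\<close>)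
    have "F p w = 0" for w
    proof (cases "length w = 1 \<and> set w \<subseteq> {..<3}")
      case True
      then obtain n where w: "w = [n]" and n: "n < 3" by (auto simp: length_Suc_conv)
      have ixn: "ix (xi n) = n" using n by (auto simp: ix_def xi_def)
      have "F p [ix (xi n)] = (\<Sum>j\<in>UNIV. g (xi n) j * x j)"
        unfolding F_degree_one[OF pT] sum_ix ev g_def by (simp add: mult_ac)
      then show ?thesis using x by (simp add: w ixn)
    next
      case False
      have "nc_homog 1 p" using len by (auto simp: nc_homog_def)
      then have "nc_homog 1 (F p)" by (rule F_homog[OF pT])
      moreover have "F p \<in> nc_T" using bij pT by (auto simp: bij_betw_def)
      ultimately show ?thesis using False by (auto simp: nc_homog_def nc_T_def)
    qed
    then have "F p = F nc_zero" unfolding F_zero by (auto simp: nc_zero_def)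
    then have "p = nc_zero" using bij pT nc_T_zero by (auto simp: bij_betw_def dest: inj_onD)
    then show "\<forall>j. x j = 0" using ev by (simp add: nc_zero_def)
  next
    fix v :: "3 \<Rightarrow> 3 \<Rightarrow> 'a"
    define e where "e = quad_elem (\<lambda>i j. applyR R (\<lambda>i j. v (xi i) (xi j)) i j - q * v (xi i) (xi j))"
    have "e \<in> nc_ideal (S_rels R q)" unfolding e_def S_rels_def by (rule nc_ideal.gen) blast
    then have "F e \<in> nc_ideal (Skl_rels a b c)" using img by blast
    then obtain y where y: "\<And>i j. F e [ix i, ix j] = (\<Sum>n\<in>UNIV. y n * skl a b c n i j)"
      using L' by blast
    have ek: "e [ix k, ix l] = opA r q v k l" for k l
      unfolding e_def quad_elem_eval applyR_ix opA_def r_def by simp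
    have eT: "e \<in> nc_T" unfolding e_def by (rule quad_elem_T)
    then show "\<exists>y. \<forall>i j. (\<Sum>k\<in>UNIV. \<Sum>l\<in>UNIV. g i k * g j l * opA r q v k l) = (\<Sum>n\<in>UNIV. y n * skl a b c n i j)"
      using y unfolding ev2[OF eT] ek by (intro exI[of _ y] allI)
  next
    fix n
    have "skl_rel a b c (ix n) \<in> nc_ideal (Skl_rels a b c)"
      by (rule nc_ideal.gen) (simp add: Skl_rels_def)
    then obtain p where p: "p \<in> nc_ideal (S_rels R q)" and Fp: "F p = skl_rel a b c (ix n)"
      using img by (metis imageE)
    have pT: "p \<in> nc_T" using L[OF p] by blast
    from L[OF p] obtain v where v: "\<forall>i j. p [ix i, ix j] = opA r q v i j" by blast
    have "\<forall>i j. F p [ix i, ix j] = skl a b c n i j" unfolding Fp skl_rel_eval by blast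
    then show "\<exists>v. \<forall>i j. (\<Sum>k\<in>UNIV. \<Sum>l\<in>UNIV. g i k * g j l * opA r q v k l) = skl a b c n i j"
      unfolding ev2[OF pT] v[rule_format] by (rule exI[of _ v])
  qed
qed

section \<open>Hecke symmetries\<close>

definition op12 :: "(3 \<Rightarrow> 3 \<Rightarrow> 3 \<Rightarrow> 3 \<Rightarrow> 'a::comm_ring_1) \<Rightarrow> 'a tensor3 \<Rightarrow> 'a tensor3" where
  "op12 r t i j k = (\<Sum>a\<in>UNIV. \<Sum>b\<in>UNIV. r i j a b * t a b k)"

definition op23 :: "(3 \<Rightarrow> 3 \<Rightarrow> 3 \<Rightarrow> 3 \<Rightarrow> 'a::comm_ring_1) \<Rightarrow> 'a tensor3 \<Rightarrow> 'a tensor3" where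
  "op23 r t i j k = (\<Sum>b\<in>UNIV. \<Sum>c\<in>UNIV. r j k b c * t i b c)"

definition basis3 :: "3 \<times> 3 \<times> 3 \<Rightarrow> 'a::comm_ring_1 tensor3" where
  "basis3 x i j k = kd (fst x) i * (kd (fst (snd x)) j * kd (snd (snd x)) k)"

lemma basis3_sum: "t i j k = (\<Sum>x\<in>UNIV. t (fst x) (fst (snd x)) (snd (snd x)) * basis3 x i j k)"
proof -
  have "(\<Sum>x\<in>UNIV. t (fst x) (fst (snd x)) (snd (snd x)) * basis3 x i j k)
      = (\<Sum>a\<in>UNIV. kd a i * (\<Sum>b\<in>UNIV. kd b j * (\<Sum>c\<in>UNIV. kd c k * t a b c)))"
    unfolding basis3_def flatten_sums
    by (rule sum.reindex_bij_witness[of _ id id]) (auto simp: mult_ac)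
  then show ?thesis by simp
qed

lemma op12_sum: "op12 r (\<lambda>i j k. \<Sum>x\<in>(UNIV::(3 \<times> 3 \<times> 3) set). c x * u x i j k) = (\<lambda>i j k. \<Sum>x\<in>UNIV. c x * op12 r (u x) i j k)"
proof (intro ext)
  fix i j k
  have "(\<Sum>a\<in>UNIV. \<Sum>b\<in>UNIV. r i j a b * (\<Sum>x\<in>(UNIV::(3 \<times> 3 \<times> 3) set). c x * u x a b k))
     = (\<Sum>x\<in>UNIV. c x * (\<Sum>a\<in>UNIV. \<Sum>b\<in>UNIV. r i j a b * u x a b k))"
    unfolding flatten_sums
    by (rule sum.reindex_bij_witness[of _ "\<lambda>(x,a,b). (a,b,x)" "\<lambda>(a,b,x). (x,a,b)"]) (auto simp: mult_ac)
  then show "op12 r (\<lambda>i j k. \<Sum>x\<in>UNIV. c x * u x i j k) i j k = (\<Sum>x\<in>UNIV. c x * op12 r (u x) i j k)"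
    by (simp only: op12_def)
qed

lemma op23_sum: "op23 r (\<lambda>i j k. \<Sum>x\<in>(UNIV::(3 \<times> 3 \<times> 3) set). c x * u x i j k) = (\<lambda>i j k. \<Sum>x\<in>UNIV. c x * op23 r (u x) i j k)"
proof (intro ext)
  fix i j k
  have "(\<Sum>a\<in>UNIV. \<Sum>b\<in>UNIV. r j k a b * (\<Sum>x\<in>(UNIV::(3 \<times> 3 \<times> 3) set). c x * u x i a b))
     = (\<Sum>x\<in>UNIV. c x * (\<Sum>a\<in>UNIV. \<Sum>b\<in>UNIV. r j k a b * u x i a b))"
    unfolding flatten_sums
    by (rule sum.reindex_bij_witness[of _ "\<lambda>(x,a,b). (a,b,x)" "\<lambda>(a,b,x). (x,a,b)"]) (auto simp: mult_ac)
  then show "op23 r (\<lambda>i j k. \<Sum>x\<in>UNIV. c x * u x i j k) i j k = (\<Sum>x\<in>UNIV. c x * op23 r (u x) i j k)"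
    by (simp only: op23_def)
qed

text \<open>For the extension of scalars: over the larger field the relation is known only on
  tensors with entries in the image of the embedding, and the basis tensors are such.\<close>

lemma braid_of_basis:
  assumes "\<And>x. op12 r (op23 r (op12 r (basis3 x))) = op23 r (op12 r (op23 r (basis3 x)))"
  shows "op12 r (op23 r (op12 r t)) = op23 r (op12 r (op23 r t))"
proof -
  obtain c where t: "t = (\<lambda>i j k. \<Sum>x\<in>UNIV. c x * basis3 x i j k)"
  proof (rule that[of "\<lambda>x. t (fst x) (fst (snd x)) (snd (snd x))"])
    show "t = (\<lambda>i j k. \<Sum>x\<in>UNIV. t (fst x) (fst (snd x)) (snd (snd x)) * basis3 x i j k)"
      by (intro ext) (rule basis3_sum)
  qed
  show ?thesis unfolding t op12_sum op23_sum assms by (rule refl)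
qed

lemma hom_op:
  fixes f :: "'k::comm_ring_1 \<Rightarrow> 'K::comm_ring_1"
  assumes "\<And>x y. f (x + y) = f x + f y" "\<And>x y. f (x * y) = f x * f y"
  shows "op12 (\<lambda>i j k l. f (r i j k l)) (\<lambda>i j k. f (t i j k)) = (\<lambda>i j k. f (op12 r t i j k))"
    "op23 (\<lambda>i j k l. f (r i j k l)) (\<lambda>i j k. f (t i j k)) = (\<lambda>i j k. f (op23 r t i j k))"
  by (simp_all add: op12_def op23_def sum_3' assms fun_eq_iff)

text \<open>The second conclusion is the Hecke relation with \<open>R + 1\<close> written as
  \<open>(R - q) + (1 + q)\<close>.\<close>

lemma hecke_symmetry_ops:
  fixes R :: "nat \<Rightarrow> nat \<Rightarrow> nat \<Rightarrow> nat \<Rightarrow> 'k::field"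
  defines "r \<equiv> \<lambda>i j k l. R (ix i) (ix j) (ix k) (ix l)"
  assumes "is_hecke_symmetry R q"
  shows "op12 r (op23 r (op12 r t)) = op23 r (op12 r (op23 r t))"
    and "opA r q (\<lambda>i j. opA r q v i j + (1 + q) * v i j) i j = 0"
proof -
  have braid: "R12 R (R23 R (R12 R t)) (ix i) (ix j) (ix k) = R23 R (R12 R (R23 R t)) (ix i) (ix j) (ix k)" for t i j k
    using assms(2) unfolding is_hecke_symmetry_def by (meson ix_less)
  have hecke: "applyR R (\<lambda>a b. applyR R v a b + v a b) (ix i) (ix j) - q * (applyR R v (ix i) (ix j) + v (ix i) (ix j)) = 0" for v i j
    using assms(2) unfolding is_hecke_symmetry_def by (meson ix_less)
  have a: "(\<lambda>i j k. R12 R T (ix i) (ix j) (ix k)) = op12 r (\<lambda>i j k. T (ix i) (ix j) (ix k))" for T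
    unfolding R12_def op12_def r_def sum_ix by (rule refl)
  have b: "(\<lambda>i j k. R23 R T (ix i) (ix j) (ix k)) = op23 r (\<lambda>i j k. T (ix i) (ix j) (ix k))" for T
    unfolding R23_def op23_def r_def sum_ix by (rule refl)
  have t: "(\<lambda>i j k. t (xi (ix i)) (xi (ix j)) (xi (ix k))) = t" by simp
  have "op12 r (op23 r (op12 r t)) = (\<lambda>i j k. R12 R (R23 R (R12 R (\<lambda>i j k. t (xi i) (xi j) (xi k)))) (ix i) (ix j) (ix k))"
    unfolding a b t by (rule refl)
  also have "\<dots> = (\<lambda>i j k. R23 R (R12 R (R23 R (\<lambda>i j k. t (xi i) (xi j) (xi k)))) (ix i) (ix j) (ix k))"
    unfolding braid by (rule refl)
  also have "\<dots> = op23 r (op12 r (op23 r t))"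
    unfolding a b t by (rule refl)
  finally show "op12 r (op23 r (op12 r t)) = op23 r (op12 r (op23 r t))" .
  have "opA r q (\<lambda>i j. opA r q v i j + (1 + q) * v i j) i j
     = applyR R (\<lambda>a b. applyR R (\<lambda>i j. v (xi i) (xi j)) a b + v (xi a) (xi b)) (ix i) (ix j)
        - q * (applyR R (\<lambda>i j. v (xi i) (xi j)) (ix i) (ix j) + v (xi (ix i)) (xi (ix j)))"
    unfolding applyR_ix xi_ix opA_def r_def by (simp add: algebra_simps)
  then show "opA r q (\<lambda>i j. opA r q v i j + (1 + q) * v i j) i j = 0"
    using hecke[of "\<lambda>i j. v (xi i) (xi j)" i j] by simp
qed

lemma opA_basis: "opA r q v i j = (\<Sum>k\<in>UNIV. \<Sum>l\<in>UNIV. opA r q (\<lambda>a b. kd k a * kd l b) i j * v k l)"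
proof -
  have "(\<Sum>a\<in>UNIV. \<Sum>b\<in>UNIV. r i j a b * (kd k a * kd l b)) = r i j k l" for k l
  proof -
    have "(\<Sum>a\<in>UNIV. \<Sum>b\<in>UNIV. r i j a b * (kd k a * kd l b)) = (\<Sum>a\<in>UNIV. kd k a * (\<Sum>b\<in>UNIV. kd l b * r i j a b))"
      by (simp only: sum_distrib_left mult_ac)
    then show ?thesis by simp
  qed
  then have "opA r q (\<lambda>a b. kd k a * kd l b) i j = r i j k l - q * (kd k i * kd l j)" for k l
    unfolding opA_def by simp
  moreover have "(\<Sum>k\<in>UNIV. \<Sum>l\<in>UNIV. (r i j k l - q * (kd k i * kd l j)) * v k l)
    = (\<Sum>k\<in>UNIV. \<Sum>l\<in>UNIV. r i j k l * v k l) - q * (\<Sum>k\<in>UNIV. kd k i * (\<Sum>l\<in>UNIV. kd l j * v k l))"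
    by (simp add: left_diff_distrib sum_subtractf sum_distrib_left mult.assoc del: kd_sum)
  ultimately show ?thesis by (simp add: opA_def)
qed

lemma hecke_of_basis:
  assumes "\<And>k l i j. opA r q (\<lambda>a b. opA r q (\<lambda>a b. kd k a * kd l b) a b + (1 + q) * (kd k a * kd l b)) i j = 0"
  shows "opA r q (\<lambda>a b. opA r q v a b + (1 + q) * v a b) i j = 0"
proof -
  define S where "S k l i j = opA r q (\<lambda>a b. kd k a * kd l b) i j" for k l i j
  have S: "opA r q v i j = (\<Sum>k\<in>UNIV. \<Sum>l\<in>UNIV. S k l i j * v k l)" for v i j
    unfolding S_def by (rule opA_basis)
  have z: "opA r q (S k l) i j + (1 + q) * S k l i j = 0" for k l i j
    using assms[of k l i j] unfolding opA_add opA_scale S_def .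
  have "opA r q (\<lambda>a b. opA r q v a b + (1 + q) * v a b) i j = opA r q (opA r q v) i j + (1 + q) * opA r q v i j"
    by (simp only: opA_add opA_scale)
  also have "opA r q (opA r q v) i j = (\<Sum>k\<in>UNIV. \<Sum>l\<in>UNIV. opA r q (S k l) i j * v k l)"
    unfolding S flatten_sums
    by (rule sum.reindex_bij_witness[of _ "\<lambda>(k,(l,(a,b))). (a,b,k,l)" "\<lambda>(a,b,k,l). (k,(l,(a,b)))"]) (auto simp: mult_ac)
  also have "\<dots> + (1 + q) * opA r q v i j = (\<Sum>k\<in>UNIV. \<Sum>l\<in>UNIV. (opA r q (S k l) i j + (1 + q) * S k l i j) * v k l)"
    unfolding S[of v] by (simp only: distrib_right sum.distrib sum_distrib_left mult.assoc)
  finally show ?thesis by (simp only: z) simp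
qed

lemma hom_opA:
  fixes f :: "'k::comm_ring_1 \<Rightarrow> 'K::comm_ring_1"
  assumes add: "\<And>x y. f (x + y) = f x + f y" and mult: "\<And>x y. f (x * y) = f x * f y"
  shows "opA (\<lambda>i j k l. f (r i j k l)) (f q) (\<lambda>i j. f (v i j)) i j = f (opA r q v i j)"
proof -
  have "f (x - y) = f x - f y" for x y
    using add[of "x - y" y] by simp
  then show ?thesis by (simp add: opA_def sum_3' add mult)
qed

text \<open>The superpotential is pulled back along \<open>g\<close>, so that its slices span the
  image of \<open>R - q\<close> in the original basis. The web is found there and then moved by
  \<open>g\<close> to Sklyanin coordinates.\<close>

lemma hecke_skl_False:
  fixes r :: "3 \<Rightarrow> 3 \<Rightarrow> 3 \<Rightarrow> 3 \<Rightarrow> 'a::field" and q :: 'a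
  assumes q0: "q \<noteq> 0" and two: "(2::'a) \<noteq> 0" and three: "(3::'a) \<noteq> 0" and \<omega>: "\<omega>^2 + \<omega> + 1 = (0::'a)"
    and braid: "\<And>t. op12 r (op23 r (op12 r t)) = op23 r (op12 r (op23 r t))"
    and hecke: "\<And>v i j. opA r q (\<lambda>i j. opA r q v i j + (1 + q) * v i j) i j = 0"
    and tA: "skl_typeA_params a b c"
    and ker: "\<And>x. (\<And>i. (\<Sum>j\<in>UNIV. g i j * x j) = 0) \<Longrightarrow> \<forall>j. x j = 0"
    and into: "\<And>v. \<exists>y. \<forall>i j. (\<Sum>k\<in>UNIV. \<Sum>l\<in>UNIV. g i k * g j l * opA r q v k l) = (\<Sum>n\<in>UNIV. y n * skl a b c n i j)"
    and onto: "\<And>n. \<exists>v. \<forall>i j. (\<Sum>k\<in>UNIV. \<Sum>l\<in>UNIV. g i k * g j l * opA r q v k l) = skl a b c n i j"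
  shows False
proof -
  obtain h where hg: "\<And>i k. (\<Sum>j\<in>UNIV. h i j * g j k) = kd i k" and gh: "\<And>i k. (\<Sum>j\<in>UNIV. g i j * h j k) = kd i k"
  proof (rule matrix_inverse_ex[of g])
    fix x assume "\<And>i. (\<Sum>j\<in>UNIV. g i j * x j) = 0"
    then show "\<forall>j. x j = 0" by (rule ker)
  next
    fix B assume "\<And>i k. (\<Sum>j\<in>UNIV. B i j * g j k) = kd i k" "\<And>i k. (\<Sum>j\<in>UNIV. g i j * B j k) = kd i k"
    then show thesis by (rule that)
  qed
  define w where "w = up3 h (skl a b c)"
  have rk: "no_rank_one w" unfolding w_def by (rule no_rank_one_up3[OF gh hg no_rank_one_skl[OF tA]])
  have ov: "simple_overlap w" unfolding w_def by (rule simple_overlap_up3[OF gh hg simple_overlap_skl[OF tA]])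
  have cyc: "w i j k = w j k i" for i j k
  proof -
    have "up3 h (skl a b c) i j k = (\<Sum>x\<in>UNIV. \<Sum>y\<in>UNIV. \<Sum>z\<in>UNIV. h i x * h j y * h k z * skl a b c y z x)"
      unfolding up3_def by (intro sum.cong refl) (subst skl_cyc, rule refl)
    also have "\<dots> = up3 h (skl a b c) j k i"
      unfolding up3_def flatten_sums
      by (rule sum.reindex_bij_witness[of _ "\<lambda>(b,c,a). (a,b,c)" "\<lambda>(a,b,c). (b,c,a)"]) (auto simp: mult_ac)
    finally show ?thesis by (simp only: w_def)
  qed
  have undo_g: "u i j = (\<Sum>i'\<in>UNIV. \<Sum>j'\<in>UNIV. h i i' * h j j' * (\<Sum>k\<in>UNIV. \<Sum>l\<in>UNIV. g i' k * g j' l * u k l))" for u :: "3 \<Rightarrow> 3 \<Rightarrow> 'a" and i j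
  proof -
    have "(\<Sum>i'\<in>UNIV. \<Sum>j'\<in>UNIV. h i i' * h j j' * (\<Sum>k\<in>UNIV. \<Sum>l\<in>UNIV. g i' k * g j' l * u k l))
      = (\<Sum>k\<in>UNIV. (\<Sum>i'\<in>UNIV. h i i' * g i' k) * (\<Sum>l\<in>UNIV. (\<Sum>j'\<in>UNIV. h j j' * g j' l) * u k l))"
      unfolding flatten_sums
      by (rule sum.reindex_bij_witness[of _ "\<lambda>(k,(l,j'),i'). (i',j',k,l)" "\<lambda>(i',j',k,l). (k,(l,j'),i')"]) (auto simp: mult_ac)
    then show ?thesis by (simp add: hg)
  qed
  obtain y where y: "\<And>k l i j. (\<Sum>k'\<in>UNIV. \<Sum>l'\<in>UNIV. g i k' * g j l' * opA r q (\<lambda>a b. kd k a * kd l b) k' l') = (\<Sum>n\<in>UNIV. y k l n * skl a b c n i j)"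
  proof -
    have "\<forall>k l. \<exists>y. \<forall>i j. (\<Sum>k'\<in>UNIV. \<Sum>l'\<in>UNIV. g i k' * g j l' * opA r q (\<lambda>a b. kd k a * kd l b) k' l') = (\<Sum>n\<in>UNIV. y n * skl a b c n i j)"
      using into by blast
    then obtain y where "\<forall>k l i j. (\<Sum>k'\<in>UNIV. \<Sum>l'\<in>UNIV. g i k' * g j l' * opA r q (\<lambda>a b. kd k a * kd l b) k' l') = (\<Sum>n\<in>UNIV. y k l n * skl a b c n i j)"
      unfolding choice_iff by blast
    then show thesis by (intro that[of y]) blast
  qed
  \<comment> \<open>\<open>y\<close> holds the coordinates of \<open>R - q\<close> in the Sklyanin
    slices; the factor \<open>g\<close> turns them into coordinates in the slices of
    \<open>w\<close>.\<close>
  define \<Phi> where "\<Phi> n k l = (\<Sum>m\<in>UNIV. g m n * y k l m)" for n k l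
  have hskl: "(\<Sum>i'\<in>UNIV. \<Sum>j'\<in>UNIV. h i i' * h j j' * (\<Sum>m\<in>UNIV. z m * skl a b c m i' j')) = (\<Sum>n\<in>UNIV. w n i j * (\<Sum>m\<in>UNIV. g m n * z m))" for z i j
  proof -
    have "(\<Sum>n\<in>UNIV. w n i j * (\<Sum>m\<in>UNIV. g m n * z m))
      = (\<Sum>i'\<in>UNIV. \<Sum>j'\<in>UNIV. h i i' * h j j' * (\<Sum>m\<in>UNIV. z m * (\<Sum>x\<in>UNIV. (\<Sum>n\<in>UNIV. g m n * h n x) * skl a b c x i' j')))"
      unfolding w_def up3_def flatten_sums
      by (rule sum.reindex_bij_witness[of _ "\<lambda>(i',j',m,x,n). (n,m,x,i',j')" "\<lambda>(n,m,x,i',j'). (i',j',m,x,n)"]) (auto simp: mult_ac)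
    then show ?thesis by (simp add: gh)
  qed
  have A: "opA r q v i j = (\<Sum>n\<in>UNIV. w n i j * phi \<Phi> n v)" for v i j
  proof -
    have "opA r q (\<lambda>a b. kd k a * kd l b) i j = (\<Sum>n\<in>UNIV. w n i j * \<Phi> n k l)" for k l
    proof -
      have "opA r q (\<lambda>a b. kd k a * kd l b) i j = (\<Sum>i'\<in>UNIV. \<Sum>j'\<in>UNIV. h i i' * h j j' * (\<Sum>n\<in>UNIV. y k l n * skl a b c n i' j'))"
        by (subst undo_g) (simp only: y)
      then show ?thesis unfolding hskl \<Phi>_def .
    qed
    then have "opA r q v i j = (\<Sum>k\<in>UNIV. \<Sum>l\<in>UNIV. (\<Sum>n\<in>UNIV. w n i j * \<Phi> n k l) * v k l)"
      by (subst opA_basis) simp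
    also have "\<dots> = (\<Sum>n\<in>UNIV. w n i j * phi \<Phi> n v)"
      unfolding phi_def flatten_sums
      by (rule sum.reindex_bij_witness[of _ "\<lambda>(n,k,l). (k,l,n)" "\<lambda>(k,l,n). (n,k,l)"]) (auto simp: mult_ac)
    finally show ?thesis .
  qed
  have AA: "opA r q (\<lambda>i j. opA r q v i j) i j = - (1 + q) * opA r q v i j" for v i j
  proof -
    have "opA r q (\<lambda>i j. opA r q v i j + (1 + q) * v i j) i j = opA r q (\<lambda>i j. opA r q v i j) i j + (1 + q) * opA r q v i j"
      by (simp only: opA_add opA_scale)
    then have "opA r q (\<lambda>i j. opA r q v i j) i j + (1 + q) * opA r q v i j = 0" by (simp only: hecke)
    then show ?thesis by (simp only: eq_neg_iff_add_eq_0 mult_minus_left)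
  qed
  have surj: "\<exists>v. \<forall>n. phi \<Phi> n v = kd n m" for m
  proof -
    obtain v where v: "\<And>n i j. (\<Sum>k\<in>UNIV. \<Sum>l\<in>UNIV. g i k * g j l * opA r q (v n) k l) = skl a b c n i j"
    proof -
      have "\<forall>n. \<exists>v. \<forall>i j. (\<Sum>k\<in>UNIV. \<Sum>l\<in>UNIV. g i k * g j l * opA r q v k l) = skl a b c n i j"
        by (intro allI) (rule onto)
      then obtain v where "\<forall>n i j. (\<Sum>k\<in>UNIV. \<Sum>l\<in>UNIV. g i k * g j l * opA r q (v n) k l) = skl a b c n i j"
        unfolding choice_iff by blast
      then show thesis by (intro that[of v]) blast
    qed
    define x where "x k l = (\<Sum>a\<in>UNIV. h m a * v a k l)" for k l
    have "(\<Sum>n\<in>UNIV. w n i j * phi \<Phi> n x) = w m i j" for i j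
    proof -
      have "opA r q x i j = (\<Sum>a\<in>UNIV. h m a * opA r q (v a) i j)"
        unfolding x_def sum_3' opA_add opA_scale by (simp only: opA_add opA_scale)
      also have "\<dots> = (\<Sum>z\<in>UNIV. h m z * (\<Sum>i'\<in>UNIV. \<Sum>j'\<in>UNIV. h i i' * h j j' * skl a b c z i' j'))"
        by (rule sum.cong[OF refl], subst undo_g) (simp only: v)
      also have "\<dots> = w m i j"
        unfolding w_def up3_def by (simp only: sum_distrib_left mult_ac)
      finally show ?thesis by (simp only: A)
    qed
    then have "(\<Sum>n\<in>UNIV. w n i j * (phi \<Phi> n x - kd n m)) = 0 * 0" for i j
      by (simp add: right_diff_distrib sum_subtractf)
    then have "\<forall>n. phi \<Phi> n x - kd n m = 0"
      using rk[unfolded no_rank_one_def, rule_format, of "\<lambda>n. phi \<Phi> n x - kd n m" "\<lambda>_. 0" "\<lambda>_. 0"] by blast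
    then show ?thesis by auto
  qed
  have a12: "A12 w \<Phi> t = (\<lambda>i j k. opA r q (\<lambda>a b. t a b k) i j)" for t
    by (simp add: A12_def A fun_eq_iff)
  have a23: "A23 w \<Phi> t = (\<lambda>i j k. opA r q (\<lambda>a b. t i a b) j k)" for t
    by (simp add: A23_def A fun_eq_iff)
  have o12: "op12 r t = (\<lambda>i j k. q * t i j k + A12 w \<Phi> t i j k)" for t
    by (simp add: a12 op12_def opA_def fun_eq_iff)
  have o23: "op23 r t = (\<lambda>i j k. q * t i j k + A23 w \<Phi> t i j k)" for t
    by (simp add: a23 op23_def opA_def fun_eq_iff)
  have l12: "A12 w \<Phi> (\<lambda>i j k. q * t i j k + u i j k) = (\<lambda>i j k. q * A12 w \<Phi> t i j k + A12 w \<Phi> u i j k)" for t u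
    unfolding a12 opA_add opA_scale by (rule refl)
  have l23: "A23 w \<Phi> (\<lambda>i j k. q * t i j k + u i j k) = (\<lambda>i j k. q * A23 w \<Phi> t i j k + A23 w \<Phi> u i j k)" for t u
    unfolding a23 opA_add opA_scale by (rule refl)
  have s12: "A12 w \<Phi> (A12 w \<Phi> t) = (\<lambda>i j k. - (1 + q) * A12 w \<Phi> t i j k)" for t
    unfolding a12 AA by (rule refl)
  have s23: "A23 w \<Phi> (A23 w \<Phi> t) = (\<lambda>i j k. - (1 + q) * A23 w \<Phi> t i j k)" for t
    unfolding a23 AA by (rule refl)
  \<comment> \<open>Expand the braid relation with \<open>R = q + A\<close>. The products of two
    different \<open>A\<close>-operators cancel, and \<open>A^2 = - (1 + q) * A\<close> turns the
    squares into linear terms, leaving \<open>- q * A\<close> on each side.\<close>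
  have "A12 w \<Phi> (A23 w \<Phi> (A12 w \<Phi> t)) i j k - q * A12 w \<Phi> t i j k
        = A23 w \<Phi> (A12 w \<Phi> (A23 w \<Phi> t)) i j k - q * A23 w \<Phi> t i j k" for t i j k
  proof -
    have "op12 r (op23 r (op12 r t)) i j k = op23 r (op12 r (op23 r t)) i j k" by (simp only: braid)
    then show ?thesis unfolding o12 o23 l12 l23 s12 s23 by (simp add: algebra_simps)
  qed
  moreover have "(\<Sum>n\<in>UNIV. w n i j * phi \<Phi> n (\<lambda>a b. \<Sum>m\<in>UNIV. w m a b * phi \<Phi> m v)) = - (1 + q) * (\<Sum>n\<in>UNIV. w n i j * phi \<Phi> n v)" for v i j
    using AA[of v i j] unfolding A .
  ultimately obtain M where "web w \<Phi> M q"
    using web_of_braid[OF q0 cyc rk ov surj] by blast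
  then interpret web w \<Phi> M q .
  have "up3 g w = skl a b c" unfolding w_def by (rule up3_inverse[OF gh])
  then have "web (skl a b c) (down3 h \<Phi>) (\<lambda>i j. \<Sum>a\<in>UNIV. \<Sum>b\<in>UNIV. g i a * M a b * h b j) q"
    using base_change[of h g, OF hg gh] by (simp only:)
  then show False by (rule skl_web_False[OF tA _ two three \<omega>])
qed

theorem theorem5p1:
  fixes R :: "nat \<Rightarrow> nat \<Rightarrow> nat \<Rightarrow> nat \<Rightarrow> 'k::field" and q :: 'k
    and f :: "'k \<Rightarrow> 'K::field"
  assumes "(2::'k) \<noteq> 0" and "(3::'k) \<noteq> 0"
    and "is_hecke_symmetry R q"
    and "is_alg_closure f"
  shows "\<not> typeA_over (S_rels (\<lambda>i j k l. f (R i j k l)) (f q))"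
proof
  assume "typeA_over (S_rels (\<lambda>i j k l. f (R i j k l)) (f q))"
  then obtain a b c where tA: "skl_typeA_params a b c"
    and iso: "nc_graded_iso (nc_ideal (S_rels (\<lambda>i j k l. f (R i j k l)) (f q))) (nc_ideal (Skl_rels a b c))"
    unfolding typeA_over_def by blast
  have f_add: "f (x + y) = f x + f y" and f_mult: "f (x * y) = f x * f y" and f1: "f 1 = 1"
    and closed: "degree p > 0 \<Longrightarrow> \<exists>z. poly p z = 0" for x y and p :: "'K poly"
    using assms(4) unfolding is_alg_closure_def by blast+
  have f0: "f 0 = 0" using f_add[of 0 0] unfolding add_0_left by (rule add_cancel_right_right[THEN iffD1])
  have f_nz: "f x \<noteq> 0" if "x \<noteq> 0" for x
  proof
    assume "f x = 0"
    then have "f (x * inverse x) = 0" by (simp add: f_mult)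
    then show False using that f1 by simp
  qed
  have f2: "f 2 = 2" using f_add[of 1 1] f1 by simp
  have f3: "f 3 = 3" using f_add[of 2 1] f1 f2 by simp
  define r where "r i j k l = R (ix i) (ix j) (ix k) (ix l)" for i j k l
  note ops = hecke_symmetry_ops[OF assms(3), folded r_def]
  \<comment> \<open>Algebraic closedness enters here: diagonalising a 3-cycle requires a primitive
    cube root of unity.\<close>
  obtain \<omega> :: 'K where "poly [:1, 1, 1:] \<omega> = 0"
    using closed[of "[:1, 1, 1:]"] by auto
  then have \<omega>: "\<omega>^2 + \<omega> + 1 = 0" by (simp add: power2_eq_square algebra_simps)
  show False
  proof (rule graded_iso_degree_two[OF iso])
    fix g :: "3 \<Rightarrow> 3 \<Rightarrow> 'K"
    assume ker: "\<And>x. (\<And>i. (\<Sum>j\<in>UNIV. g i j * x j) = 0) \<Longrightarrow> \<forall>j. x j = 0"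
    and into: "\<And>v. \<exists>y. \<forall>i j. (\<Sum>k\<in>UNIV. \<Sum>l\<in>UNIV. g i k * g j l * opA (\<lambda>i j k l. f (R (ix i) (ix j) (ix k) (ix l))) (f q) v k l) = (\<Sum>n\<in>UNIV. y n * skl a b c n i j)"
    and onto: "\<And>n. \<exists>v. \<forall>i j. (\<Sum>k\<in>UNIV. \<Sum>l\<in>UNIV. g i k * g j l * opA (\<lambda>i j k l. f (R (ix i) (ix j) (ix k) (ix l))) (f q) v k l) = skl a b c n i j"
    have kd: "f (kd i j) = kd i j" for i j :: 3 by (simp add: kd_def f0 f1)
    have basis: "basis3 x = (\<lambda>i j k. f (basis3 x i j k))" for x
      by (intro ext) (simp only: basis3_def f_mult kd)
    have r: "(\<lambda>i j k l. f (R (ix i) (ix j) (ix k) (ix l))) = (\<lambda>i j k l. f (r i j k l))"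
      unfolding r_def by (rule refl)
    note hom = hom_op[of f, OF f_add f_mult]
    note homA = hom_opA[of f, OF f_add f_mult]
    have q: "q \<noteq> 0" using assms(3) by (simp add: is_hecke_symmetry_def)
    have braid: "op12 (\<lambda>i j k l. f (r i j k l)) (op23 (\<lambda>i j k l. f (r i j k l)) (op12 (\<lambda>i j k l. f (r i j k l)) t))
      = op23 (\<lambda>i j k l. f (r i j k l)) (op12 (\<lambda>i j k l. f (r i j k l)) (op23 (\<lambda>i j k l. f (r i j k l)) t))" for t
    proof (rule braid_of_basis)
      fix x
      show "op12 (\<lambda>i j k l. f (r i j k l)) (op23 (\<lambda>i j k l. f (r i j k l)) (op12 (\<lambda>i j k l. f (r i j k l)) (basis3 x)))
        = op23 (\<lambda>i j k l. f (r i j k l)) (op12 (\<lambda>i j k l. f (r i j k l)) (op23 (\<lambda>i j k l. f (r i j k l)) (basis3 x)))"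
        by (subst (1 2) basis) (simp only: hom ops(1))
    qed
    have hecke: "opA (\<lambda>i j k l. f (r i j k l)) (f q) (\<lambda>a b. opA (\<lambda>i j k l. f (r i j k l)) (f q) v a b + (1 + f q) * v a b) i j = 0" for v i j
    proof (rule hecke_of_basis)
      fix k l i j
      have "opA (\<lambda>i j k l. f (r i j k l)) (f q) (\<lambda>a b. opA (\<lambda>i j k l. f (r i j k l)) (f q) (\<lambda>a b. f (kd k a * kd l b)) a b + (f 1 + f q) * f (kd k a * kd l b)) i j
        = f (opA r q (\<lambda>a b. opA r q (\<lambda>a b. kd k a * kd l b) a b + (1 + q) * (kd k a * kd l b)) i j)"
        by (simp only: homA f_add[symmetric] f_mult[symmetric])
      also have "\<dots> = 0" by (simp only: ops(2) f0)
      finally show "opA (\<lambda>i j k l. f (r i j k l)) (f q) (\<lambda>a b. opA (\<lambda>i j k l. f (r i j k l)) (f q) (\<lambda>a b. kd k a * kd l b) a b + (1 + f q) * (kd k a * kd l b)) i j = 0"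
        by (simp only: f_mult kd f1)
    qed
    have two: "(2::'K) \<noteq> 0" using f_nz[OF assms(1)] unfolding f2 .
    have three: "(3::'K) \<noteq> 0" using f_nz[OF assms(2)] unfolding f3 .
    show False
      by (rule hecke_skl_False[OF f_nz[OF q] two three \<omega> braid hecke tA ker into[unfolded r] onto[unfolded r]])
  qed
qed

end
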